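(* Let $P\in L_2[0,1]$ be an arithmetically self-similar function with step $\nu>0$ and of positive spectral order $D$, with self-similarity parameters $n$, $a_k$, $d_k$, $\beta_k$ ($k=1,\dots,n$). Let $\rho\in\mathcal H'$ be the derivative of $P$ and let $T_\rho$ be the associated linear operator pencil. Assume that there exists an index $k\le n$ for which one of the following conditions holds: (a) $d_k>0$ and the ratio $\dfrac{\ln(a_k|d_k|)}{\nu}$ is odd; (b) $d_k<0$ and the ratio $\dfrac{\ln(a_k|d_k|)}{\nu}$ is even. Then the following statements hold. (1) There exist continuous non-negative $1$-periodic functions $s_+$ and $s_-$ on $\mathbb R$ such that, as $\lambda\to\pm\infty$, $$\operatorname{ind}T_\rho(\lambda)=|\lambda|^{D/2}\left(s_{\pm}\left(\frac{\ln|\lambda|}{\nu}\right)+o(1)\right)$$ (with $s_+$ for $\lambda\to+\infty$ and $s_-$ for $\lambda\to-\infty$). (2) If $d_k<0$ for some $k\in\{1,\dots,n\}$, then $s_+(t)=s_-(t)$ for all $t\in\mathbb R$. (3) If $\mathfrak I[\rho,|y|^2]>0$ for some function $y\in\mathcal H$, then the function $s_+$ is positive (everywhere). Analogously, if $\mathfrak I[\rho,|y|^2]<0$ for some function $y\in\mathcal H$, then the function $s_-$ is positive (everywhere).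
   Context: Self-similar functions. Let $n>1$ be a natural number and let $a_k>0$, $d_k$, $\beta_k$ ($k=1,\dots,n$) be real numbers with $\sum_{k=1}^n a_k=1$. Put $\alpha_1=0$, $\alpha_k=\sum_{l=1}^{k-1}a_l$ for $k=2,\dots,n+1$. The similarity operator $G:L_2[0,1]\to L_2[0,1]$ is $$G(f)=\sum_{k=1}^n\{\beta_k\,\chi_{(\alpha_k,\alpha_{k+1})}+d_k\,G_k(f)\},$$ where $\chi_\Gamma$ is the characteristic function of the interval $\Gamma$ and $G_k$ is the continuous linear operator on $L_2[0,1]$ determined by $G_k(\chi_{(\zeta,\xi)})=\chi_{(\alpha_k+a_k\zeta,\,\alpha_k+a_k\xi)}$ for all $(\zeta,\xi)\subset[0,1]$; that is, $(G_kf)(x)=f((x-\alpha_k)/a_k)$ for $x\in(\alpha_k,\alpha_{k+1})$ and $(G_kf)(x)=0$ otherwise. It is always assumed that $\sum_{k=1}^n a_k|d_k|^2<1$. A function $f\in L_2[0,1]$ with $G(f)=f$ is called self-similar, and $n,a_k,d_k,\beta_k$ are called its self-similarity parameters. Arithmetic self-similarity. $f$ is arithmetically self-similar if it has self-similarity parameters such that for some $\nu>0$: for every $k\in\{1,\dots,n\}$ there is $l_k\in\mathbb N=\{1,2,\dots\}$ with $(a_k|d_k|)\cdot(a_k|d_k|-e^{-l_k\nu})=0$. The maximal $\nu$ with this property (for the given parameters) is called the step of self-similarity. Spectral order. $f$ is a self-similar function of positive spectral order if it has self-similarity parameters such that at least two of the numbers $d_k$ are nonzero and at least one of the numbers $\beta_k$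 is nonzero. Its spectral order is then the unique positive solution $D$ of $\sum_{k=1}^n(a_k|d_k|)^{D/2}=1$ (with $0^{D/2}=0$). In the theorem, one set of parameters $n,a_k,d_k,\beta_k$ of $P$ is fixed; it is the one with respect to which $\nu$ is the step, the positivity of the spectral order is witnessed, $D$ is computed, and conditions (a), (b) are imposed. Spaces and pencil. $\mathcal H$ is the (complex) Sobolev space $\overset{\circ}{W}{}_2^1[0,1]$ of functions vanishing at $0$ and $1$, with norm $\|y\|_{\mathcal H}=\|y'\|_{L_2[0,1]}$. $\mathcal H'=\overset{\circ}{W}{}_2^{-1}[0,1]$ is its dual relative to $L_2[0,1]$, i.e. the completion of $L_2[0,1]$ in the norm $\|y\|_{\mathcal H'}=\sup_{\|z\|_{\mathcal H}=1}|\langle y,z\rangle_{L_2[0,1]}|$. $\mathfrak I[y,z]$ ($y\in\mathcal H'$, $z\in\mathcal H$) is the sesquilinear form extending by continuity $\mathfrak I[y,z]=\int_0^1 y\overline z\,dx$, $y\in L_2[0,1]$. The derivative of $P\in L_2[0,1]$ is the element $\rho\in\mathcal H'$ with $\mathfrak I[\rho,y]=-\int_0^1P\overline{y'}\,dx$ for all $y\in\mathcal H$. The pencil $T_\rho$ of bounded operators $T_\rho(\lambda):\mathcal H\to\mathcal H'$ is defined by $$\mathfrak I[T_\rho(\lambda)y,z]=\int_0^1 y'\overline{z'}\,dx-\lambda\,\mathfrak I[\rho,\overline yz]=\int_0^1\{y'\overline{z'}+\lambda P\cdot(y'\overline z+y\overline{z'})\}\,dx,\qquad \lambda\in\mathbb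 C,\ y,z\in\mathcal H.$$ The index of inertia $\operatorname{ind}S$ of an operator $S:\mathcal H\to\mathcal H'$ is the maximum of the dimensions of subspaces $\mathcal M\subset\mathcal H$ for which there is $\varepsilon>0$ such that $\mathfrak I[Sy,y]\le-\varepsilon\|y\|_{\mathcal H}^2$ for all $y\in\mathcal M$. *)

theory Defs
  imports
    "HOL-Analysis.Analysis"
    "HOL-Library.Function_Algebras"
    "HOL-Library.Complex_Order"
    "HOL-Library.Extended_Nat"
    "HOL-Library.Extended_Real"
begin

section \<open>Self-similar functions\<close>

abbreviation unit_leb :: "real measure" where
  "unit_leb \<equiv> lebesgue_on {0..1}"

text \<open>Elements of $L_2[0,1]$ are represented by functions; equality in $L_2[0,1]$ is equality
  almost everywhere with respect to \<open>unit_leb\<close>.\<close>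

definition L2 :: "(real \<Rightarrow> complex) set" where
  "L2 = {f. f \<in> borel_measurable unit_leb \<and> integrable unit_leb (\<lambda>x. (norm (f x))\<^sup>2)}"

text \<open>The parameters $a_k$, $d_k$, $\beta_k$ are functions on \<open>nat\<close>, of which only the values at
  \<open>1, \<dots>, n\<close> matter.\<close>

definition self_sim_params :: "nat \<Rightarrow> (nat \<Rightarrow> real) \<Rightarrow> (nat \<Rightarrow> real) \<Rightarrow> bool" where
  "self_sim_params n a d \<longleftrightarrow>
     n > 1 \<and> (\<forall>k\<in>{1..n}. a k > 0) \<and> (\<Sum>k=1..n. a k) = 1 \<and> (\<Sum>k=1..n. a k * \<bar>d k\<bar>\<^sup>2) < 1"

definition alpha :: "(nat \<Rightarrow> real) \<Rightarrow> nat \<Rightarrow> real" where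
  "alpha a k = (\<Sum>l\<in>{1..<k}. a l)"

definition sim_piece :: "(nat \<Rightarrow> real) \<Rightarrow> nat \<Rightarrow> (real \<Rightarrow> complex) \<Rightarrow> (real \<Rightarrow> complex)" where
  "sim_piece a k f x =
     (if x \<in> {alpha a k<..<alpha a (k + 1)} then f ((x - alpha a k) / a k) else 0)"

definition sim_op ::
  "nat \<Rightarrow> (nat \<Rightarrow> real) \<Rightarrow> (nat \<Rightarrow> real) \<Rightarrow> (nat \<Rightarrow> real) \<Rightarrow> (real \<Rightarrow> complex) \<Rightarrow> (real \<Rightarrow> complex)" where
  "sim_op n a d \<beta> f x =
     (\<Sum>k=1..n. of_real (\<beta> k) * indicator {alpha a k<..<alpha a (k + 1)} x
               + of_real (d k) * sim_piece a k f x)"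

definition self_similar ::
  "nat \<Rightarrow> (nat \<Rightarrow> real) \<Rightarrow> (nat \<Rightarrow> real) \<Rightarrow> (nat \<Rightarrow> real) \<Rightarrow> (real \<Rightarrow> complex) \<Rightarrow> bool" where
  "self_similar n a d \<beta> f \<longleftrightarrow>
     self_sim_params n a d \<and> f \<in> L2 \<and> (AE x in unit_leb. sim_op n a d \<beta> f x = f x)"

definition arith_with :: "nat \<Rightarrow> (nat \<Rightarrow> real) \<Rightarrow> (nat \<Rightarrow> real) \<Rightarrow> real \<Rightarrow> bool" where
  "arith_with n a d \<nu> \<longleftrightarrow>
     \<nu> > 0 \<and> (\<forall>k\<in>{1..n}. \<exists>l::nat. l \<ge> 1 \<and>
       (a k * \<bar>d k\<bar>) * (a k * \<bar>d k\<bar> - exp (- real l * \<nu>)) = 0)"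

definition is_step :: "nat \<Rightarrow> (nat \<Rightarrow> real) \<Rightarrow> (nat \<Rightarrow> real) \<Rightarrow> real \<Rightarrow> bool" where
  "is_step n a d \<nu> \<longleftrightarrow> arith_with n a d \<nu> \<and> (\<forall>\<mu>. arith_with n a d \<mu> \<longrightarrow> \<mu> \<le> \<nu>)"

definition pos_spectral_order :: "nat \<Rightarrow> (nat \<Rightarrow> real) \<Rightarrow> (nat \<Rightarrow> real) \<Rightarrow> bool" where
  "pos_spectral_order n d \<beta> \<longleftrightarrow>
     card {k\<in>{1..n}. d k \<noteq> 0} \<ge> 2 \<and> (\<exists>k\<in>{1..n}. \<beta> k \<noteq> 0)"

definition is_spectral_order :: "nat \<Rightarrow> (nat \<Rightarrow> real) \<Rightarrow> (nat \<Rightarrow> real) \<Rightarrow> real \<Rightarrow> bool" where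
  "is_spectral_order n a d D \<longleftrightarrow> D > 0 \<and> (\<Sum>k=1..n. (a k * \<bar>d k\<bar>) powr (D / 2)) = 1"


section \<open>The space \<open>H\<close> and its dual\<close>

text \<open>On an interval, the Sobolev functions are the absolutely continuous functions with
  square-integrable derivative, i.e. the indefinite integrals of $L_2$ functions.\<close>

definition has_L2_deriv :: "(real \<Rightarrow> complex) \<Rightarrow> (real \<Rightarrow> complex) \<Rightarrow> bool" where
  "has_L2_deriv y g \<longleftrightarrow>
     g \<in> L2 \<and> (\<forall>x\<in>{0..1}. y x = y 0 + (LINT t|lebesgue_on {0..x}. g t))"

text \<open>The derivative is determined up to a null set only, and is used below only under
  integrals over $[0,1]$.\<close>

definition L2_deriv :: "(real \<Rightarrow> complex) \<Rightarrow> (real \<Rightarrow> complex)" where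
  "L2_deriv y = (SOME g. has_L2_deriv y g)"

text \<open>Extension by zero outside $[0,1]$ makes the function representing an element of
  \<open>H\<close> unique.\<close>

definition H :: "(real \<Rightarrow> complex) set" where
  "H = {y. (\<exists>g. has_L2_deriv y g) \<and> y 0 = 0 \<and> y 1 = 0 \<and> (\<forall>x. x \<notin> {0..1} \<longrightarrow> y x = 0)}"

definition H_norm :: "(real \<Rightarrow> complex) \<Rightarrow> real" where
  "H_norm y = sqrt (LINT x|unit_leb. (norm (L2_deriv y x))\<^sup>2)"

type_synonym functional = "(real \<Rightarrow> complex) \<Rightarrow> complex"

definition antilinear_on_H :: "functional \<Rightarrow> bool" where
  "antilinear_on_H \<phi> \<longleftrightarrow>
     (\<forall>u\<in>H. \<forall>v\<in>H. \<forall>c. \<phi> (\<lambda>x. c * u x + v x) = cnj c * \<phi> u + \<phi> v)"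

definition dual_norm :: "functional \<Rightarrow> ereal" where
  "dual_norm \<phi> = (SUP z\<in>{z\<in>H. H_norm z = 1}. ereal (norm (\<phi> z)))"

definition L2_functional :: "(real \<Rightarrow> complex) \<Rightarrow> functional" where
  "L2_functional f z = (if z \<in> H then (LINT x|unit_leb. f x * cnj (z x)) else 0)"

text \<open>The completion of $L_2[0,1]$ in the dual norm is realised as the closure of the image of
  $L_2[0,1]$ among the antilinear functionals on \<open>H\<close> (which are set to zero off \<open>H\<close>, so that
  each element has one representative).  In this model, the extension by continuity of
  the pairing is evaluation.\<close>

definition H_dual :: "functional set" where
  "H_dual = {\<phi>. antilinear_on_H \<phi> \<and> (\<forall>z. z \<notin> H \<longrightarrow> \<phi> z = 0) \<and>
     (\<exists>f :: nat \<Rightarrow> real \<Rightarrow> complex. (\<forall>m. f m \<in> L2) \<and>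
        (\<lambda>m. dual_norm (\<lambda>z. \<phi> z - L2_functional (f m) z)) \<longlonglongrightarrow> 0)}"

definition pairing :: "functional \<Rightarrow> (real \<Rightarrow> complex) \<Rightarrow> complex" where
  "pairing \<phi> z = \<phi> z"

definition is_derivative_of :: "functional \<Rightarrow> (real \<Rightarrow> complex) \<Rightarrow> bool" where
  "is_derivative_of \<rho> P \<longleftrightarrow>
     \<rho> \<in> H_dual \<and> (\<forall>y\<in>H. pairing \<rho> y = - (LINT x|unit_leb. P x * cnj (L2_deriv y x)))"


section \<open>The pencil and the index of inertia\<close>

definition pencil :: "functional \<Rightarrow> complex \<Rightarrow> (real \<Rightarrow> complex) \<Rightarrow> functional" where
  "pencil \<rho> \<mu> y z =
     (if z \<in> H then (LINT x|unit_leb. L2_deriv y x * cnj (L2_deriv z x))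
                      - \<mu> * pairing \<rho> (\<lambda>x. cnj (y x) * z x)
      else 0)"

global_interpretation cfun: vector_space "\<lambda>(c::complex) (f::real \<Rightarrow> complex). (\<lambda>x. c * f x)"
  by unfold_locales (auto simp: fun_eq_iff algebra_simps)

definition edim :: "(real \<Rightarrow> complex) set \<Rightarrow> enat" where
  "edim M = (if \<exists>B. finite B \<and> cfun.span B = M then enat (cfun.dim M) else \<infinity>)"

text \<open>The inequality below is in the order of \<open>complex\<close> from \<open>Complex_Order\<close>: it says that the
  left-hand side is real and bounded as indicated.\<close>

definition neg_subspace :: "((real \<Rightarrow> complex) \<Rightarrow> functional) \<Rightarrow> (real \<Rightarrow> complex) set \<Rightarrow> bool" where
  "neg_subspace S M \<longleftrightarrow> cfun.subspace M \<and> M \<subseteq> H \<and>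
     (\<exists>\<epsilon>>0. \<forall>y\<in>M. pairing (S y) y \<le> - of_real (\<epsilon> * (H_norm y)\<^sup>2))"

definition ind :: "((real \<Rightarrow> complex) \<Rightarrow> functional) \<Rightarrow> enat" where
  "ind S = (SUP M\<in>{M. neg_subspace S M}. edim M)"

end

theory Submission
  imports Defs
begin

text \<open>Let \<open>N(\<lambda>)\<close> be the index of inertia at \<open>\<lambda>\<close>.  Cutting \<open>[0,1]\<close> at the \<open>n - 1\<close> nodes \<open>\<alpha>\<^sub>2, \<dots>, \<alpha>\<^sub>n\<close>
  decouples the quadratic form: on functions supported in the \<open>k\<close>-th cell it is a rescaled copy of
  the form at \<open>\<lambda> a\<^sub>k d\<^sub>k\<close>, because the constants \<open>\<beta>\<^sub>k\<close> integrate to zero against the derivative of a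
  function vanishing at the nodes.  Hence \<open>N(\<lambda>) = \<Sum>\<^sub>k N(\<lambda> a\<^sub>k d\<^sub>k) + O(1)\<close>.  Since \<open>N\<close> vanishes near \<open>0\<close> and
  all \<open>a\<^sub>k |d\<^sub>k|\<close> are less than \<open>1\<close>, this also shows that \<open>N\<close> is finite.

  With \<open>a\<^sub>k |d\<^sub>k| = exp (- l\<^sub>k \<nu>)\<close> and \<open>u\<^sub>\<plusminus>(t) = exp (- \<nu> t D / 2) N(\<plusminus> exp (\<nu> t))\<close> one gets a renewal equation
  along \<open>t + \<int>\<close> for the pair \<open>(u\<^sub>+, u\<^sub>-)\<close>, in which the terms with \<open>d\<^sub>k < 0\<close> exchange the two signs
  (without such terms the two equations decouple).
  Maximality of the step makes the numbers \<open>l\<^sub>k\<close> coprime, and condition (a) or (b) excludes that the sign is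
  tied to the parity of the time, so oscillations along \<open>t + \<int>\<close> contract to zero and \<open>u\<^sub>\<plusminus>\<close>
  converges to a periodic limit, uniformly in \<open>t\<close>.  Positivity follows since \<open>u\<^sub>\<plusminus>\<close> is also a
  supersolution of the homogeneous equation.

  Continuity of the limit holds because \<open>N\<close> jumps by at most \<open>1\<close>: a jump by \<open>2\<close> would yield
  approximate null vectors of the form with vanishing Cauchy data at \<open>0\<close>, contradicting unique
  continuation.\<close>

section \<open>Renewal equations with signs\<close>

text \<open>The weight is only square-integrable, so \<open>\<rho>\<close> is a distribution, and
  everything is done with forms rather than with eigenvalues or solutions. An element y of
  \<open>H\<close> enters through its derivative g, which turns the form into an explicit integral
  over g and \<open>prim g\<close> with bounds in the L2 norm of g alone. The index is counted by
  finite families that are orthogonal and negative for the form: lower bounds come from exhibiting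
  families, upper bounds from counting functionals on whose common kernel the form is nonnegative.
  No spectral theorem or compactness enters; the price is that unique continuation has to be
  quantitative, with a constant that beats the small defect of the null vectors. Bounded jumps of
  the index suffice for a continuous limit because the normalisation multiplies them by a factor
  tending to zero while the convergence is uniform in the starting time. This uniformity shapes the
  renewal estimates: they may depend only on bounds of a sequence, not on the sequence
  itself.\<close>

inductive reach :: "'k set \<Rightarrow> ('k \<Rightarrow> nat) \<Rightarrow> ('k \<Rightarrow> real) \<Rightarrow> nat \<Rightarrow> real \<Rightarrow> bool"
  for K l e where
  reach_0: "reach K l e 0 1"
| reach_step: "reach K l e s \<tau> \<Longrightarrow> k \<in> K \<Longrightarrow> reach K l e (s + l k) (e k * \<tau>)"

text \<open>\<open>reach K l e s \<tau>\<close> records a finite word over \<open>K\<close> with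
  total delay \<open>s\<close> and product of signs \<open>\<tau>\<close>; concatenating words adds
  delays and multiplies signs.\<close>

lemma reach_add:
  assumes "reach K l e s \<tau>" "reach K l e s' \<tau>'"
  shows "reach K l e (s + s') (\<tau> * \<tau>')"
  using assms
proof (induction rule: reach.induct)
  case reach_0
  then show ?case by simp
next
  case (reach_step s \<tau> k)
  then have "reach K l e ((s + s') + l k) (e k * (\<tau> * \<tau>'))"
    by (intro reach.reach_step) auto
  then show ?case by (simp add: algebra_simps)
qed

lemma reach_single: "k \<in> K \<Longrightarrow> reach K l e (l k) (e k)"
  using reach_step[OF reach_0] by force

lemma reach_mult: "reach K l e s \<tau> \<Longrightarrow> reach K l e (m * s) (\<tau> ^ m)"
proof (induction m)
  case (Suc m)
  then show ?case using reach_add[of K l e s \<tau> "m * s" "\<tau> ^ m"] by simp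
qed (simp add: reach_0)

text \<open>The delays of words form a numerical semigroup with coprime generators. The least
  positive difference of two of its elements must divide every generator, hence is 1; two
  consecutive elements \<open>b\<close> and \<open>b + 1\<close> then generate everything from
  \<open>b * b\<close> on.\<close>

lemma reach_eventually:
  assumes K: "K \<noteq> {}" and pos: "\<And>k. k \<in> K \<Longrightarrow> l k > 0"
    and gcd1: "\<And>g::nat. (\<And>k. k \<in> K \<Longrightarrow> g dvd l k) \<Longrightarrow> g = 1"
  shows "\<exists>J. \<forall>s\<ge>J. \<exists>\<tau>. reach K l e s \<tau>"
proof -
  define S where "S = {s. \<exists>\<tau>. reach K l e s \<tau>}"
  have S0: "0 \<in> S" unfolding S_def using reach_0 by blast
  have Sadd: "a + b \<in> S" if "a \<in> S" "b \<in> S" for a b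
    using that unfolding S_def by (auto intro: reach_add)
  have Sk: "l k \<in> S" if "k \<in> K" for k
    unfolding S_def using reach_single[OF that] by blast
  have Smul: "m * a \<in> S" if "a \<in> S" for a m
    using that unfolding S_def by (auto intro: reach_mult)
  define diff where "diff g \<longleftrightarrow> g > 0 \<and> (\<exists>b\<in>S. b + g \<in> S)" for g :: nat
  obtain k0 where k0: "k0 \<in> K" using K by blast
  have ex: "\<exists>g. diff g" unfolding diff_def using S0 Sk[OF k0] pos[OF k0] by force
  define g where "g = (LEAST g. diff g)"
  have g: "diff g" unfolding g_def using ex by (rule LeastI_ex)
  then obtain b where b: "b \<in> S" "b + g \<in> S" "g > 0" unfolding diff_def by blast
  have "g dvd l k" if k: "k \<in> K" for k
  proof (rule ccontr)
    assume nd: "\<not> g dvd l k"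
    define q where "q = l k div g"
    have r: "l k mod g > 0" "l k mod g < g" using nd b(3) by (auto simp: dvd_eq_mod_eq_0)
    \<comment> \<open>If \<open>g\<close> did not divide \<open>l k\<close>, the smaller number
      \<open>l k mod g\<close> would also be a difference: added to \<open>q * (b + g)\<close> it
      gives \<open>q * b + l k\<close>, and both numbers lie in \<open>S\<close>.\<close>
    have eq: "q * (b + g) + l k mod g = q * b + l k"
      unfolding q_def by (metis add.assoc add_mult_distrib2 div_mult_mod_eq)
    have "q * (b + g) + l k mod g \<in> S" unfolding eq using b Sk[OF k] Smul Sadd by blast
    moreover have "q * (b + g) \<in> S" using b Smul by blast
    ultimately have "diff (l k mod g)" unfolding diff_def using r by blast
    then have "g \<le> l k mod g" unfolding g_def by (rule Least_le)
    then show False using r by simp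
  qed
  then have g1: "g = 1" using gcd1 by blast
  have "s \<in> S" if s: "s \<ge> b * b" for s
  proof (cases "b = 0")
    case True
    then show ?thesis using b g1 Smul[of 1 s] by simp
  next
    case False
    define q where "q = s div b"
    define r where "r = s mod b"
    have "r < b" using False unfolding r_def by simp
    \<comment> \<open>The quotient exceeds the remainder, so \<open>r\<close> of the
      \<open>q\<close> copies of \<open>b\<close> can be exchanged for \<open>b + 1\<close>.\<close>
    have "q \<ge> b" using s False unfolding q_def by (metis div_le_mono nonzero_mult_div_cancel_right)
    then have "r \<le> q" using \<open>r < b\<close> by simp
    have "s = (q - r) * b + r * (b + 1)"
      using \<open>r \<le> q\<close> div_mult_mod_eq[of s b] unfolding q_def[symmetric] r_def[symmetric]
      by (simp add: algebra_simps)
    then show ?thesis using b g1 Smul Sadd by metis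
  qed
  then show ?thesis unfolding S_def by blast
qed

section \<open>Renewal inequalities: maximum principle and contraction of oscillations\<close>

locale renewal =
  fixes K :: "'k set" and p :: "'k \<Rightarrow> real" and l :: "'k \<Rightarrow> nat" and e :: "'k \<Rightarrow> real"
    and L :: nat and T :: "real set"
  assumes finK: "finite K" and p_pos: "\<And>k. k \<in> K \<Longrightarrow> p k > 0" and p_sum: "(\<Sum>k\<in>K. p k) = 1"
    and l_pos: "\<And>k. k \<in> K \<Longrightarrow> l k \<ge> 1" and l_le: "\<And>k. k \<in> K \<Longrightarrow> l k \<le> L"
    and T_closed: "\<And>\<sigma> k. \<sigma> \<in> T \<Longrightarrow> k \<in> K \<Longrightarrow> \<sigma> * e k \<in> T"
begin

text \<open>The range \<open>j \<ge> i + L\<close> keeps every \<open>j - l k\<close> at or above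
  \<open>i\<close>, so the subtraction of natural numbers never truncates.\<close>

definition subsol :: "nat \<Rightarrow> (real \<Rightarrow> nat \<Rightarrow> real) \<Rightarrow> bool" where
  "subsol i y \<longleftrightarrow> (\<forall>\<sigma>\<in>T. \<forall>j\<ge>i + L. y \<sigma> j \<le> (\<Sum>k\<in>K. p k * y (\<sigma> * e k) (j - l k)))"

lemma subsolD: "subsol i y \<Longrightarrow> \<sigma> \<in> T \<Longrightarrow> j \<ge> i + L \<Longrightarrow> y \<sigma> j \<le> (\<Sum>k\<in>K. p k * y (\<sigma> * e k) (j - l k))"
  by (simp add: subsol_def)

lemma subsol_mono: "subsol i y \<Longrightarrow> i \<le> i' \<Longrightarrow> subsol i' y"
  by (simp add: subsol_def)

text \<open>Discrete maximum principle: each value is bounded by a convex combination of values at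
  most \<open>L\<close> steps earlier, so a bound on one window of length \<open>L\<close>
  persists.\<close>

lemma subsol_le_max:
  assumes sub: "subsol i y" and win: "\<And>\<sigma> j. \<sigma> \<in> T \<Longrightarrow> i \<le> j \<Longrightarrow> j < i + L \<Longrightarrow> y \<sigma> j \<le> M"
    and "\<sigma> \<in> T" "i \<le> j"
  shows "y \<sigma> j \<le> M"
  using assms(3,4)
proof (induction j arbitrary: \<sigma> rule: less_induct)
  case (less j)
  show ?case
  proof (cases "j < i + L")
    case True
    then show ?thesis using win less.prems by blast
  next
    case False
    then have "y \<sigma> j \<le> (\<Sum>k\<in>K. p k * y (\<sigma> * e k) (j - l k))"
      using subsolD[OF sub] less.prems by auto
    also have "\<dots> \<le> (\<Sum>k\<in>K. p k * M)"
    proof (rule sum_mono)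
      fix k assume k: "k \<in> K"
      have "y (\<sigma> * e k) (j - l k) \<le> M"
        using less.IH[of "j - l k" "\<sigma> * e k"] l_pos[OF k] l_le[OF k] False less.prems T_closed[OF _ k]
        by auto
      then show "p k * y (\<sigma> * e k) (j - l k) \<le> p k * M" using p_pos[OF k] by simp
    qed
    also have "\<dots> = M" using p_sum by (simp flip: sum_distrib_right)
    finally show ?thesis .
  qed
qed

text \<open>Unfolding the inequality along one word keeps the value at its end with weight
  \<open>\<pi>\<close>, the product of the \<open>p k\<close> along it, and bounds every branch off
  the word by \<open>M\<close>. The weight depends on the word only, not on \<open>y\<close>,
  \<open>M\<close> or the time.\<close>

lemma subsol_reach:
  assumes "reach K l e s \<tau>"
  shows "\<exists>\<pi>. 0 < \<pi> \<and> \<pi> \<le> 1 \<and> (\<forall>y M i. subsol i y \<longrightarrow> (\<forall>\<sigma>\<in>T. \<forall>j\<ge>i. y \<sigma> j \<le> M) \<longrightarrow>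
    (\<forall>\<sigma>\<in>T. \<forall>j\<ge>i + L + s. y \<sigma> j \<le> \<pi> * y (\<sigma> * \<tau>) (j - s) + (1 - \<pi>) * M))"
  using assms
proof (induction rule: reach.induct)
  case reach_0
  show ?case by (intro exI[of _ 1]) auto
next
  case (reach_step s \<tau> k)
  then obtain \<pi> where \<pi>: "0 < \<pi>" "\<pi> \<le> 1" and IH: "\<And>y M i \<sigma> j. subsol i y \<Longrightarrow>
    (\<forall>\<sigma>\<in>T. \<forall>j\<ge>i. y \<sigma> j \<le> M) \<Longrightarrow> \<sigma> \<in> T \<Longrightarrow> j \<ge> i + L + s \<Longrightarrow>
    y \<sigma> j \<le> \<pi> * y (\<sigma> * \<tau>) (j - s) + (1 - \<pi>) * M"
    by blast
  have k: "k \<in> K" by fact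
  have pk: "0 < p k" "p k \<le> 1"
    using p_pos k p_sum member_le_sum[OF k, of p] finK by (auto simp: less_imp_le)
  show ?case
  proof (intro exI[of _ "p k * \<pi>"] conjI allI impI ballI)
    show "0 < p k * \<pi>" using pk \<pi> by simp
    show "p k * \<pi> \<le> 1" using pk \<pi> by (simp add: mult_le_one)
    fix y M i \<sigma> j
    assume sub: "subsol i y" and M: "\<forall>\<sigma>\<in>T. \<forall>j\<ge>i. y \<sigma> j \<le> M" and \<sigma>: "\<sigma> \<in> T" and j: "i + L + (s + l k) \<le> j"
    have "y \<sigma> j \<le> (\<Sum>k\<in>K. p k * y (\<sigma> * e k) (j - l k))"
      using subsolD[OF sub \<sigma>] j by simp
    also have "\<dots> = p k * y (\<sigma> * e k) (j - l k) + (\<Sum>k\<in>K - {k}. p k * y (\<sigma> * e k) (j - l k))"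
      using finK k by (simp add: sum.remove)
    also have "(\<Sum>k\<in>K - {k}. p k * y (\<sigma> * e k) (j - l k)) \<le> (\<Sum>k\<in>K - {k}. p k * M)"
    proof (rule sum_mono)
      fix k' assume k': "k' \<in> K - {k}"
      have "y (\<sigma> * e k') (j - l k') \<le> M"
        using M T_closed[OF \<sigma>, of k'] l_le[of k'] k' j by auto
      then show "p k' * y (\<sigma> * e k') (j - l k') \<le> p k' * M" using p_pos k' by simp
    qed
    also have "(\<Sum>k\<in>K - {k}. p k * M) = (1 - p k) * M"
      using sum.remove[OF finK k, of p] p_sum by (simp flip: sum_distrib_right)
    also have "y (\<sigma> * e k) (j - l k) \<le> \<pi> * y (\<sigma> * e k * \<tau>) (j - l k - s) + (1 - \<pi>) * M"
      using IH[OF sub M T_closed[OF \<sigma> k], of "j - l k"] j by auto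
    finally show "y \<sigma> j \<le> p k * \<pi> * y (\<sigma> * (e k * \<tau>)) (j - (s + l k)) + (1 - p k * \<pi>) * M"
      using pk by (simp add: algebra_simps)
  qed
qed

text \<open>One low value pulls down all later values of every sign, with a single weight: delays
  from \<open>J\<close> to \<open>J + L\<close> give finitely many weights, their minimum works on a
  window, and the maximum principle carries the bound on.\<close>

lemma subsol_reach_window:
  assumes finT: "finite T" and J: "\<And>s \<sigma> \<tau>. s \<ge> J \<Longrightarrow> \<sigma> \<in> T \<Longrightarrow> \<tau> \<in> T \<Longrightarrow> \<exists>\<rho>. reach K l e s \<rho> \<and> \<sigma> * \<rho> = \<tau>"
  shows "\<exists>\<pi>. 0 < \<pi> \<and> \<pi> \<le> 1 \<and> (\<forall>y M i. subsol i y \<longrightarrow> (\<forall>\<sigma>\<in>T. \<forall>j\<ge>i. y \<sigma> j \<le> M) \<longrightarrow>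
    (\<forall>\<sigma>\<in>T. \<forall>\<tau>\<in>T. \<forall>j\<ge>i + L + J. y \<sigma> j \<le> \<pi> * y \<tau> (i + L) + (1 - \<pi>) * M))"
proof (cases "T = {}")
  case True
  then show ?thesis by (intro exI[of _ 1]) auto
next
  case False
  define good where "good \<pi> s \<sigma> \<tau> \<longleftrightarrow> (\<forall>y M i. subsol i y \<longrightarrow> (\<forall>\<sigma>\<in>T. \<forall>j\<ge>i. y \<sigma> j \<le> M) \<longrightarrow>
     y \<sigma> (i + L + s) \<le> \<pi> * y \<tau> (i + L) + (1 - \<pi>) * M)" for \<pi> s \<sigma> \<tau>
  have "\<exists>\<pi>. 0 < \<pi> \<and> \<pi> \<le> 1 \<and> good \<pi> s \<sigma> \<tau>" if s: "s \<ge> J" and \<sigma>: "\<sigma> \<in> T" and \<tau>: "\<tau> \<in> T" for s \<sigma> \<tau>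
  proof -
    obtain \<rho> where \<rho>: "reach K l e s \<rho>" "\<sigma> * \<rho> = \<tau>" using J[OF s \<sigma> \<tau>] by blast
    show ?thesis
      using subsol_reach[OF \<rho>(1)] \<sigma> \<rho>(2) unfolding good_def
      by (metis (no_types, lifting) add_diff_cancel_right' order_refl)
  qed
  then obtain f where f: "\<And>s \<sigma> \<tau>. s \<ge> J \<Longrightarrow> \<sigma> \<in> T \<Longrightarrow> \<tau> \<in> T \<Longrightarrow> 0 < f s \<sigma> \<tau> \<and> f s \<sigma> \<tau> \<le> 1 \<and> good (f s \<sigma> \<tau>) s \<sigma> \<tau>"
    by metis
  define F where "F = (\<lambda>(s,\<sigma>,\<tau>). f s \<sigma> \<tau>) ` ({J..J + L} \<times> T \<times> T)"
  have finF: "finite F" "F \<noteq> {}" unfolding F_def using finT False by auto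
  define \<pi> where "\<pi> = Min F"
  have "\<pi> \<in> F" unfolding \<pi>_def using finF by simp
  then have \<pi>: "0 < \<pi>" "\<pi> \<le> 1" unfolding F_def using f by auto
  have main: "y \<sigma> j \<le> \<pi> * y \<tau> (i + L) + (1 - \<pi>) * M"
    if sub: "subsol i y" and M: "\<forall>\<sigma>\<in>T. \<forall>j\<ge>i. y \<sigma> j \<le> M" and \<sigma>: "\<sigma> \<in> T" and \<tau>: "\<tau> \<in> T" and j: "j \<ge> i + L + J"
    for y M i \<sigma> \<tau> j
  proof (rule subsol_le_max[OF subsol_mono[OF sub] _ \<sigma> j])
    fix \<sigma>' j' assume \<sigma>': "\<sigma>' \<in> T" and j': "i + L + J \<le> j'" "j' < i + L + J + L"
    define s where "s = j' - (i + L)"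
    have s: "s \<ge> J" "s \<le> J + L" "j' = i + L + s" using j' unfolding s_def by auto
    have "f s \<sigma>' \<tau> \<in> F" unfolding F_def
      using s \<sigma>' \<tau> by (intro image_eqI[of _ _ "(s, \<sigma>', \<tau>)"]) auto
    then have ge: "\<pi> \<le> f s \<sigma>' \<tau>" unfolding \<pi>_def using finF by simp
    have "y \<sigma>' j' \<le> f s \<sigma>' \<tau> * y \<tau> (i + L) + (1 - f s \<sigma>' \<tau>) * M"
      using f[OF s(1) \<sigma>' \<tau>] sub M unfolding good_def s(3) by blast
    also have "\<dots> = M - f s \<sigma>' \<tau> * (M - y \<tau> (i + L))" by (simp add: algebra_simps)
    \<comment> \<open>Lowering the weight only weakens the bound because
      \<open>y \<tau> (i + L) \<le> M\<close>.\<close>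
    also have "\<dots> \<le> M - \<pi> * (M - y \<tau> (i + L))"
      using ge M \<tau> by (intro diff_left_mono mult_right_mono) auto
    finally show "y \<sigma>' j' \<le> \<pi> * y \<tau> (i + L) + (1 - \<pi>) * M" by (simp add: algebra_simps)
  qed simp
  show ?thesis using \<pi> main by blast
qed

text \<open>\<open>I\<close> is chosen before \<open>x\<close>, so that the estimate will hold for
  all starting times at once. Upper bounds \<open>M\<close> for \<open>x\<close> and
  \<open>m\<close> for \<open>- x\<close>, each perturbed by \<open>A * r ^ j\<close>, are improved
  together: every block of \<open>Q\<close> steps multiplies \<open>M + m\<close> by
  \<open>1 - \<pi>\<close>, up to a small error.\<close>

lemma renewal_osc:
  assumes finT: "finite T" and J: "\<And>s \<sigma> \<tau>. s \<ge> J \<Longrightarrow> \<sigma> \<in> T \<Longrightarrow> \<tau> \<in> T \<Longrightarrow> \<exists>\<rho>. reach K l e s \<rho> \<and> \<sigma> * \<rho> = \<tau>"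
    and r: "0 < r" "r < 1" and C: "C \<ge> 0" and \<epsilon>: "\<epsilon> > 0"
  shows "\<exists>I. \<forall>x. (\<forall>\<sigma>\<in>T. \<forall>j. \<bar>x \<sigma> j\<bar> \<le> B) \<longrightarrow>
    (\<forall>\<sigma>\<in>T. \<forall>j\<ge>L. \<bar>x \<sigma> j - (\<Sum>k\<in>K. p k * x (\<sigma> * e k) (j - l k))\<bar> \<le> C * r ^ j) \<longrightarrow>
    (\<forall>\<sigma>\<in>T. \<forall>\<tau>\<in>T. \<forall>i\<ge>I. \<forall>j\<ge>I. \<bar>x \<sigma> i - x \<tau> j\<bar> \<le> \<epsilon>)"
proof (cases "T = {}")
  case True
  then show ?thesis by auto
next
  case False
  then obtain \<tau>0 where \<tau>0: "\<tau>0 \<in> T" by blast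
  obtain \<pi> where \<pi>: "0 < \<pi>" "\<pi> \<le> 1" and step0: "\<forall>y M i. subsol i y \<longrightarrow> (\<forall>\<sigma>\<in>T. \<forall>j\<ge>i. y \<sigma> j \<le> M) \<longrightarrow>
    (\<forall>\<sigma>\<in>T. \<forall>\<tau>\<in>T. \<forall>j\<ge>i + L + J. y \<sigma> j \<le> \<pi> * y \<tau> (i + L) + (1 - \<pi>) * M)"
    using subsol_reach_window[of J, OF finT] J by blast
  have step: "y \<sigma> j \<le> \<pi> * y \<tau> (i + L) + (1 - \<pi>) * M"
    if "subsol i y" "\<forall>\<sigma>\<in>T. \<forall>j\<ge>i. y \<sigma> j \<le> M" "\<sigma> \<in> T" "\<tau> \<in> T" "j \<ge> i + L + J" for y M i \<sigma> \<tau> j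
    using step0[THEN spec, THEN spec, THEN spec, THEN mp, OF that(1), THEN mp, OF that(2)] that(3-5) by blast
  \<comment> \<open>\<open>A\<close> solves \<open>C + A = A / r\<close>: all delays are at least 1,
    so averaging \<open>A * r ^ j\<close> over the past gains a factor \<open>1 / r\<close>, which
    pays for \<open>C * r ^ j\<close>.\<close>
  define A where "A = C * r / (1 - r)"
  have A: "A \<ge> 0" "C + A \<le> A / r" using r C unfolding A_def by (auto simp: field_simps)
  define Q where "Q = L + J"
  have "(\<lambda>j. 2 * A * r ^ j) \<longlonglongrightarrow> 2 * A * 0"
    using r by (intro tendsto_intros LIMSEQ_power_zero) auto
  then have "\<forall>\<^sub>F j in sequentially. 2 * A * r ^ j < \<epsilon> / 2"
    using \<epsilon> by (intro order_tendstoD) auto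
  then obtain i0 where i0: "\<And>j. j \<ge> i0 \<Longrightarrow> 2 * A * r ^ j < \<epsilon> / 2"
    unfolding eventually_sequentially by blast
  \<comment> \<open>The starting value of \<open>M + m\<close>, with both bounds equal to
    \<open>\<bar>B\<bar> + A\<close>.\<close>
  define \<Delta> where "\<Delta> = 2 * \<bar>B\<bar> + 2 * A"
  have "(\<lambda>n. (1 - \<pi>) ^ n * \<Delta>) \<longlonglongrightarrow> 0 * \<Delta>"
    using \<pi> by (intro tendsto_intros LIMSEQ_power_zero) auto
  then have "\<forall>\<^sub>F n in sequentially. (1 - \<pi>) ^ n * \<Delta> < \<epsilon> / 2"
    using \<epsilon> by (intro order_tendstoD) auto
  then obtain n where n: "(1 - \<pi>) ^ n * \<Delta> < \<epsilon> / 2" unfolding eventually_sequentially by blast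
  show ?thesis
  proof (intro exI[of _ "i0 + n * Q"] allI impI)
    fix x assume xB: "\<forall>\<sigma>\<in>T. \<forall>j. \<bar>x \<sigma> j\<bar> \<le> B"
      and xr: "\<forall>\<sigma>\<in>T. \<forall>j\<ge>L. \<bar>x \<sigma> j - (\<Sum>k\<in>K. p k * x (\<sigma> * e k) (j - l k))\<bar> \<le> C * r ^ j"
    \<comment> \<open>Adding a multiple of \<open>r ^ j\<close> absorbs the error term: it turns a solution up to
      \<open>C * r ^ j\<close> into an exact subsolution.\<close>
    have sub: "subsol 0 (\<lambda>\<sigma> j. c * x \<sigma> j + A * r ^ j)" if c: "c = 1 \<or> c = -1" for c
      unfolding subsol_def
    proof (intro ballI allI impI)
      fix \<sigma> j assume \<sigma>: "\<sigma> \<in> T" and j: "0 + L \<le> j"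
      have le: "c * x \<sigma> j \<le> (\<Sum>k\<in>K. p k * (c * x (\<sigma> * e k) (j - l k))) + C * r ^ j"
        using xr[rule_format, OF \<sigma>, of j] j c
        by (auto simp: sum_negf abs_le_iff)
      obtain k0 where "k0 \<in> K" using p_sum by fastforce
      then have j1: "j \<ge> 1" using l_pos l_le j by fastforce
      have "A * r ^ j / r = A * r ^ (j - 1)" using r j1 by (simp add: power_diff)
      also have "\<dots> = (\<Sum>k\<in>K. p k * (A * r ^ (j - 1)))"
        by (simp only: sum_distrib_right[symmetric] p_sum mult_1)
      also have "\<dots> \<le> (\<Sum>k\<in>K. p k * (A * r ^ (j - l k)))"
      proof (rule sum_mono)
        fix k assume k: "k \<in> K"
        show "p k * (A * r ^ (j - 1)) \<le> p k * (A * r ^ (j - l k))"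
          using p_pos[OF k] A r l_pos[OF k]
          by (intro mult_left_mono power_decreasing) auto
      qed
      finally have "A * r ^ j / r \<le> (\<Sum>k\<in>K. p k * (A * r ^ (j - l k)))" .
      moreover have "C * r ^ j + A * r ^ j \<le> A * r ^ j / r"
        using mult_right_mono[OF A(2), of "r ^ j"] r by (simp add: algebra_simps)
      ultimately show "c * x \<sigma> j + A * r ^ j \<le> (\<Sum>k\<in>K. p k * (c * x (\<sigma> * e k) (j - l k) + A * r ^ (j - l k)))"
        using le by (simp add: distrib_left sum.distrib)
    qed
    define z where "z = (\<lambda>\<sigma> j. x \<sigma> j + A * r ^ j)"
    define y where "y = (\<lambda>\<sigma> j. - x \<sigma> j + A * r ^ j)"
    have subz: "subsol i z" and suby: "subsol i y" for i
      using sub[of 1] sub[of "-1"] unfolding z_def y_def by (auto intro: subsol_mono[of 0])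
    have "\<exists>M m. M + m \<le> \<epsilon> / 2 + (1 - \<pi>) ^ n * \<Delta> \<and>
      (\<forall>\<sigma>\<in>T. \<forall>j\<ge>i0 + n * Q. z \<sigma> j \<le> M) \<and> (\<forall>\<sigma>\<in>T. \<forall>j\<ge>i0 + n * Q. y \<sigma> j \<le> m)" for n
    proof (induction n)
      case 0
      have "A * r ^ j \<le> A" for j using A r by (simp add: mult_left_le power_le_one)
      then have "z \<sigma> j \<le> \<bar>B\<bar> + A" "y \<sigma> j \<le> \<bar>B\<bar> + A" if "\<sigma> \<in> T" for \<sigma> j
        unfolding z_def y_def using xB that by (smt (verit))+
      then show ?case
        using \<epsilon> by (intro exI[of _ "\<bar>B\<bar> + A"]) (auto simp: \<Delta>_def)
    next
      case (Suc n)
      then obtain M m where Mm: "M + m \<le> \<epsilon> / 2 + (1 - \<pi>) ^ n * \<Delta>"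
        and M: "\<forall>\<sigma>\<in>T. \<forall>j\<ge>i0 + n * Q. z \<sigma> j \<le> M" and m: "\<forall>\<sigma>\<in>T. \<forall>j\<ge>i0 + n * Q. y \<sigma> j \<le> m"
        by blast
      define i where "i = i0 + n * Q"
      \<comment> \<open>Both bounds use the same sign \<open>\<tau>0\<close> at the same time: in
        \<open>M' + m'\<close> the unknown \<open>x\<close> cancels there and only
        \<open>2 * A * r ^ (i + L)\<close> remains.\<close>
      define M' where "M' = \<pi> * z \<tau>0 (i + L) + (1 - \<pi>) * M"
      define m' where "m' = \<pi> * y \<tau>0 (i + L) + (1 - \<pi>) * m"
      have i': "i0 + Suc n * Q = i + L + J" unfolding i_def Q_def by simp
      have "z \<sigma> j \<le> M'" "y \<sigma> j \<le> m'" if "\<sigma> \<in> T" "j \<ge> i + L + J" for \<sigma> j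
        unfolding M'_def m'_def using step[OF subz _ that(1) \<tau>0 that(2)] M
          step[OF suby _ that(1) \<tau>0 that(2)] m unfolding i_def by auto
      moreover have "M' + m' \<le> \<epsilon> / 2 + (1 - \<pi>) ^ Suc n * \<Delta>"
      proof -
        have "M' + m' = \<pi> * (2 * A * r ^ (i + L)) + (1 - \<pi>) * (M + m)"
          unfolding M'_def m'_def z_def y_def by (simp add: algebra_simps)
        also have "\<dots> \<le> \<pi> * (\<epsilon> / 2) + (1 - \<pi>) * (\<epsilon> / 2 + (1 - \<pi>) ^ n * \<Delta>)"
          by (rule add_mono; rule mult_left_mono) (use i0[of "i + L"] Mm \<pi> i_def in auto)
        also have "\<dots> = \<epsilon> / 2 + (1 - \<pi>) ^ Suc n * \<Delta>" by (simp add: field_simps)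
        finally show ?thesis .
      qed
      ultimately show ?case unfolding i' by blast
    qed
    then obtain M m where Mm: "M + m \<le> \<epsilon> / 2 + (1 - \<pi>) ^ n * \<Delta>"
        and M: "\<forall>\<sigma>\<in>T. \<forall>j\<ge>i0 + n * Q. z \<sigma> j \<le> M" and m: "\<forall>\<sigma>\<in>T. \<forall>j\<ge>i0 + n * Q. y \<sigma> j \<le> m"
      by blast
    have Mm': "M + m \<le> \<epsilon>" using Mm n by simp
    have xz: "x \<sigma> j \<le> z \<sigma> j" "- x \<sigma> j \<le> y \<sigma> j" for \<sigma> j using A r unfolding z_def y_def by auto
    show "\<forall>\<sigma>\<in>T. \<forall>\<tau>\<in>T. \<forall>i\<ge>i0 + n * Q. \<forall>j\<ge>i0 + n * Q. \<bar>x \<sigma> i - x \<tau> j\<bar> \<le> \<epsilon>"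
      using M m Mm' xz by (smt (verit))
  qed
qed

end

section \<open>Negative index of Hermitian forms\<close>

text \<open>Gaussian elimination: an unknown \<open>w\<close> with nonzero coefficient in equation
  \<open>i\<close> is eliminated from the other equations. Comparisons of indices below come down to
  this count of equations against unknowns.\<close>

lemma linear_system_nontrivial:
  fixes A :: "'j \<Rightarrow> 'v \<Rightarrow> complex"
  assumes "finite J" "finite V" "card J < card V"
  shows "\<exists>c. (\<exists>v\<in>V. c v \<noteq> 0) \<and> (\<forall>j\<in>J. (\<Sum>v\<in>V. c v * A j v) = 0)"
  using assms
proof (induction J arbitrary: V A rule: finite_induct)
  case empty
  then have "V \<noteq> {}" by auto
  then show ?case by (intro exI[of _ "\<lambda>_. 1"]) auto
next
  case (insert i J)
  show ?case
  proof (cases "\<forall>v\<in>V. A i v = 0")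
    case True
    have "card J < card V" using insert by simp
    then obtain c where "\<exists>v\<in>V. c v \<noteq> 0" "\<forall>j\<in>J. (\<Sum>v\<in>V. c v * A j v) = 0"
      using insert.IH[OF insert.prems(1)] by blast
    then show ?thesis using True by (intro exI[of _ c]) auto
  next
    case False
    then obtain w where w: "w \<in> V" "A i w \<noteq> 0" by blast
    have "card J < card (V - {w})" using insert w by simp
    then obtain c where c: "\<exists>v\<in>V - {w}. c v \<noteq> 0"
      "\<forall>j\<in>J. (\<Sum>v\<in>V - {w}. c v * (A j v - A j w * A i v / A i w)) = 0"
      using insert.IH[of "V - {w}" "\<lambda>j v. A j v - A j w * A i v / A i w"] insert.prems(1) by blast
    define s where "s = (\<Sum>v\<in>V - {w}. c v * A i v)"
    define c' where "c' = c(w := - s / A i w)"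
    have c'_sum: "(\<Sum>v\<in>V. c' v * A j v) = - s / A i w * A j w + (\<Sum>v\<in>V - {w}. c v * A j v)" for j
      using w insert.prems(1) by (simp add: sum.remove[OF _ w(1)] c'_def)
    have "(\<Sum>v\<in>V. c' v * A i v) = 0" unfolding c'_sum using w(2) by (simp add: s_def)
    moreover have "(\<Sum>v\<in>V. c' v * A j v) = 0" if "j \<in> J" for j
    proof -
      have "(\<Sum>v\<in>V - {w}. c v * (A j v - A j w * A i v / A i w)) =
        (\<Sum>v\<in>V - {w}. c v * A j v) - A j w / A i w * s"
        unfolding s_def sum_distrib_left sum_subtractf[symmetric]
        by (intro sum.cong) (simp_all add: algebra_simps)
      then have "(\<Sum>v\<in>V - {w}. c v * A j v) = A j w / A i w * s" using c(2) that by simp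
      then show ?thesis unfolding c'_sum by simp
    qed
    moreover have "\<exists>v\<in>V. c' v \<noteq> 0" using c(1) by (auto simp: c'_def)
    ultimately show ?thesis by (intro exI[of _ c']) auto
  qed
qed

section \<open>Linear functionals and Hermitian forms on sets of functions\<close>

type_synonym cfn = "real \<Rightarrow> complex"

definition lincl :: "cfn set \<Rightarrow> bool" where
  "lincl X \<longleftrightarrow> (\<lambda>x. 0) \<in> X \<and> (\<forall>c. \<forall>u\<in>X. \<forall>v\<in>X. (\<lambda>x. c * u x + v x) \<in> X)"

text \<open>Linearity is relative to \<open>X\<close>, since integrals and values of primitives are
  linear only on integrable functions.\<close>

definition linf :: "cfn set \<Rightarrow> (cfn \<Rightarrow> complex) \<Rightarrow> bool" where
  "linf X \<phi> \<longleftrightarrow> (\<forall>c. \<forall>u\<in>X. \<forall>v\<in>X. \<phi> (\<lambda>x. c * u x + v x) = c * \<phi> u + \<phi> v)"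

definition comb :: "cfn set \<Rightarrow> (cfn \<Rightarrow> complex) \<Rightarrow> cfn" where
  "comb V c = (\<lambda>x. \<Sum>v\<in>V. c v * v x)"

lemma comb_mem_and_linf:
  assumes "lincl X" "finite V" "V \<subseteq> X"
  shows "comb V c \<in> X \<and> (\<forall>\<phi>. linf X \<phi> \<longrightarrow> \<phi> (comb V c) = (\<Sum>v\<in>V. c v * \<phi> v))"
  using assms(2,3)
proof (induction V rule: finite_induct)
  case empty
  have "\<phi> (\<lambda>x. 0) = 0" if "linf X \<phi>" for \<phi>
  proof -
    have "(\<lambda>x. 0) \<in> X" using assms(1) unfolding lincl_def by blast
    then have "\<phi> (\<lambda>x. 1 * (\<lambda>x. 0) x + (\<lambda>x. 0) x) = 1 * \<phi> (\<lambda>x. 0) + \<phi> (\<lambda>x. 0)"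
      using that[unfolded linf_def, rule_format, of "\<lambda>x. 0" "\<lambda>x. 0" 1] by simp
    then show ?thesis by simp
  qed
  then show ?case using assms(1) by (auto simp: comb_def lincl_def)
next
  case (insert w V)
  have eq: "comb (insert w V) c = (\<lambda>x. c w * w x + comb V c x)"
    using insert by (simp add: comb_def)
  have "w \<in> X" using insert by simp
  then show ?case using insert assms(1) unfolding eq by (simp add: lincl_def linf_def)
qed

lemmas comb_mem = comb_mem_and_linf[THEN conjunct1]
lemmas linf_comb = comb_mem_and_linf[THEN conjunct2, rule_format]

definition herm :: "cfn set \<Rightarrow> (cfn \<Rightarrow> cfn \<Rightarrow> complex) \<Rightarrow> bool" where
  "herm X q \<longleftrightarrow> lincl X \<and> (\<forall>z\<in>X. linf X (\<lambda>u. q u z)) \<and> (\<forall>u\<in>X. \<forall>v\<in>X. q v u = cnj (q u v))"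

lemma herm_lincl: "herm X q \<Longrightarrow> lincl X"
  unfolding herm_def by blast

lemma herm_linf: "herm X q \<Longrightarrow> z \<in> X \<Longrightarrow> linf X (\<lambda>u. q u z)"
  unfolding herm_def by blast

lemma herm_sym: "herm X q \<Longrightarrow> u \<in> X \<Longrightarrow> v \<in> X \<Longrightarrow> q v u = cnj (q u v)"
  unfolding herm_def by blast

lemma herm_left: "herm X q \<Longrightarrow> u \<in> X \<Longrightarrow> v \<in> X \<Longrightarrow> z \<in> X \<Longrightarrow> q (\<lambda>x. c * u x + v x) z = c * q u z + q v z"
  unfolding herm_def linf_def by blast

lemma herm_right:
  assumes h: "herm X q" and "u \<in> X" "v \<in> X" "z \<in> X"
  shows "q z (\<lambda>x. c * u x + v x) = cnj c * q z u + q z v"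
proof -
  have "(\<lambda>x. c * u x + v x) \<in> X" using herm_lincl[OF h] assms by (simp add: lincl_def)
  then show ?thesis
    using herm_sym[OF h, of "\<lambda>x. c * u x + v x" z] herm_left[OF h, of u v z c]
      herm_sym[OF h \<open>u \<in> X\<close> \<open>z \<in> X\<close>] herm_sym[OF h \<open>v \<in> X\<close> \<open>z \<in> X\<close>] assms by simp
qed

lemma herm_comb_left:
  "herm X q \<Longrightarrow> finite V \<Longrightarrow> V \<subseteq> X \<Longrightarrow> z \<in> X \<Longrightarrow> q (comb V c) z = (\<Sum>v\<in>V. c v * q v z)"
  using linf_comb[OF herm_lincl] herm_linf by metis

lemma herm_comb_right:
  assumes h: "herm X q" and V: "finite V" "V \<subseteq> X" and z: "z \<in> X"
  shows "q z (comb V c) = (\<Sum>v\<in>V. cnj (c v) * q z v)"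
proof -
  have "comb V c \<in> X" using comb_mem[OF herm_lincl[OF h] V] .
  then have "q z (comb V c) = cnj (q (comb V c) z)" using herm_sym[OF h] z by blast
  also have "\<dots> = (\<Sum>v\<in>V. cnj (c v) * cnj (q v z))"
    unfolding herm_comb_left[OF h V z] by simp
  also have "\<dots> = (\<Sum>v\<in>V. cnj (c v) * q z v)"
  proof (intro sum.cong refl arg_cong2[of _ _ _ _ "(*)"])
    fix v assume "v \<in> V"
    then show "cnj (q v z) = q z v" using herm_sym[OF h, of v z] V(2) z by auto
  qed
  finally show ?thesis .
qed

lemma herm_subset: "herm X q \<Longrightarrow> lincl Y \<Longrightarrow> Y \<subseteq> X \<Longrightarrow> herm Y q"
  unfolding herm_def linf_def subset_eq by blast

lemma quadratic_discriminant_le: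
  fixes A B C :: real
  assumes "\<And>s t. 2 * s * t * C \<le> s\<^sup>2 * A + t\<^sup>2 * B" "A \<ge> 0" "B \<ge> 0"
  shows "C\<^sup>2 \<le> A * B"
proof (cases "B = 0")
  case True
  \<comment> \<open>Degenerate case: if \<open>C \<noteq> 0\<close>, this \<open>t\<close> makes the
    left side \<open>A + 1\<close> while the right side is \<open>A\<close>.\<close>
  have "2 * 1 * ((A + 1) / (2 * C)) * C \<le> 1\<^sup>2 * A + ((A + 1) / (2 * C))\<^sup>2 * B"
    by (rule assms(1))
  then have "C \<noteq> 0 \<Longrightarrow> A + 1 \<le> A" using True by simp
  then have "C = 0" by linarith
  then show ?thesis using assms by simp
next
  case False
  then have "B > 0" using assms(3) by simp
  have "2 * B * C * C \<le> B\<^sup>2 * A + C\<^sup>2 * B" by (rule assms(1))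
  then have "B * C\<^sup>2 \<le> B * (A * B)" by (simp add: power2_eq_square algebra_simps)
  then show ?thesis using \<open>B > 0\<close> by simp
qed

lemma herm_expand:
  assumes h: "herm X q" and "u \<in> X" "z \<in> X"
  shows "Re (q (\<lambda>x. c * u x + z x) (\<lambda>x. c * u x + z x)) =
    (norm c)\<^sup>2 * Re (q u u) + 2 * Re (c * q u z) + Re (q z z)"
proof -
  have m: "(\<lambda>x. c * u x + z x) \<in> X" using herm_lincl[OF h] assms by (simp add: lincl_def)
  have "q (\<lambda>x. c * u x + z x) (\<lambda>x. c * u x + z x) =
    c * (cnj c * q u u + q u z) + (cnj c * cnj (q u z) + q z z)"
    using herm_left[OF h assms(2,3) m] herm_right[OF h assms(2,3)] assms herm_sym[OF h assms(2,3)] by simp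
  also have "\<dots> = of_real ((norm c)\<^sup>2) * q u u + (c * q u z + cnj (c * q u z)) + q z z"
    unfolding complex_norm_square by (simp add: algebra_simps)
  finally show ?thesis by simp
qed

text \<open>Positivity is asked on the span of \<open>u\<close> and \<open>z\<close> alone, because
  the forms of the pencil are indefinite on the whole space.\<close>

lemma herm_Cauchy_Schwarz:
  assumes h: "herm X q" and u: "u \<in> X" and z: "z \<in> X"
    and nonneg: "\<And>c d. Re (q (\<lambda>x. c * u x + d * z x) (\<lambda>x. c * u x + d * z x)) \<ge> 0"
  shows "(norm (q u z))\<^sup>2 \<le> Re (q u u) * Re (q z z)"
proof (rule quadratic_discriminant_le)
  show "Re (q u u) \<ge> 0" using nonneg[of 1 0] by simp
  show "Re (q z z) \<ge> 0" using nonneg[of 0 1] by simp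
  fix s t :: real
  \<comment> \<open>A unimodular factor turning \<open>q u z\<close> into minus its modulus, so that
    the real part in the expansion loses nothing; 1 is the default when
    \<open>q u z = 0\<close>.\<close>
  define \<omega> where "\<omega> = (if q u z = 0 then 1 else - cnj (q u z) / norm (q u z))"
  have \<omega>: "norm \<omega> = 1" "\<omega> * q u z = - of_real (norm (q u z))"
    by (auto simp: \<omega>_def norm_divide complex_norm_square[symmetric] power2_eq_square mult.commute)
  have tz: "(\<lambda>x. of_real t * z x) \<in> X"
    using herm_lincl[OF h] z unfolding lincl_def by (metis (no_types, lifting) add.right_neutral ext)
  have zz: "q (\<lambda>x. of_real t * z x) (\<lambda>x. of_real t * z x) = of_real (t\<^sup>2) * q z z"
    and uz: "q u (\<lambda>x. of_real t * z x) = of_real t * q u z"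
  proof -
    have "(\<lambda>x. 0::complex) \<in> X" using herm_lincl[OF h] by (simp add: lincl_def)
    moreover have q0: "q v (\<lambda>x. 0) = 0" if "v \<in> X" for v
      using herm_right[OF h \<open>(\<lambda>x. 0) \<in> X\<close> \<open>(\<lambda>x. 0) \<in> X\<close> that, of 1] by simp
    moreover have "q (\<lambda>x. 0) v = 0" if "v \<in> X" for v
      using herm_sym[OF h that \<open>(\<lambda>x. 0) \<in> X\<close>] q0[OF that] by simp
    ultimately have r: "q v (\<lambda>x. of_real t * z x) = of_real t * q v z"
      and l: "q (\<lambda>x. of_real t * z x) v = of_real t * q z v" if "v \<in> X" for v
      using herm_right[OF h z \<open>(\<lambda>x. 0) \<in> X\<close> that, of "of_real t"]
        herm_left[OF h z \<open>(\<lambda>x. 0) \<in> X\<close> that, of "of_real t"] that by simp_all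
    show "q u (\<lambda>x. of_real t * z x) = of_real t * q u z" using r u .
    show "q (\<lambda>x. of_real t * z x) (\<lambda>x. of_real t * z x) = of_real (t\<^sup>2) * q z z"
      using l[OF tz] r[OF z] by (simp add: power2_eq_square)
  qed
  have "0 \<le> Re (q (\<lambda>x. of_real s * \<omega> * u x + of_real t * z x) (\<lambda>x. of_real s * \<omega> * u x + of_real t * z x))"
    by (rule nonneg)
  also have "\<dots> = s\<^sup>2 * Re (q u u) + 2 * (s * t * Re (\<omega> * q u z)) + t\<^sup>2 * Re (q z z)"
    unfolding herm_expand[OF h u tz] zz uz using \<omega>(1)
    by (simp add: norm_mult algebra_simps)
  finally show "2 * s * t * norm (q u z) \<le> s\<^sup>2 * Re (q u u) + t\<^sup>2 * Re (q z z)"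
    unfolding \<omega>(2) by simp
qed

text \<open>A negative subspace is encoded by an orthogonal basis. Orthogonality and strict
  negativity make every nontrivial combination negative, hence the family independent, so its
  cardinality is a dimension.\<close>

definition negset :: "cfn set \<Rightarrow> (cfn \<Rightarrow> cfn \<Rightarrow> complex) \<Rightarrow> cfn set \<Rightarrow> bool" where
  "negset X q V \<longleftrightarrow> finite V \<and> V \<subseteq> X \<and> (\<forall>v\<in>V. Re (q v v) < 0) \<and> (\<forall>v\<in>V. \<forall>w\<in>V. v \<noteq> w \<longrightarrow> q v w = 0)"

lemma negset_comb:
  assumes h: "herm X q" and V: "negset X q V"
  shows "Re (q (comb V c) (comb V c)) = (\<Sum>v\<in>V. (norm (c v))\<^sup>2 * Re (q v v))"
proof -
  have V': "finite V" "V \<subseteq> X" using V by (auto simp: negset_def)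
  have "q (comb V c) (comb V c) = (\<Sum>v\<in>V. c v * (\<Sum>w\<in>V. cnj (c w) * q v w))"
    using herm_comb_left[OF h V' comb_mem[OF herm_lincl[OF h] V']] herm_comb_right[OF h V'] V'
    by (simp add: subset_eq)
  also have "\<dots> = (\<Sum>v\<in>V. c v * (cnj (c v) * q v v))"
  proof (intro sum.cong refl arg_cong2[of _ _ _ _ "(*)"])
    fix v assume v: "v \<in> V"
    have "(\<Sum>w\<in>V. cnj (c w) * q v w) = (\<Sum>w\<in>{v}. cnj (c w) * q v w)"
      using V v by (intro sum.mono_neutral_right) (auto simp: negset_def)
    then show "(\<Sum>w\<in>V. cnj (c w) * q v w) = cnj (c v) * q v v" by simp
  qed
  also have "\<dots> = (\<Sum>v\<in>V. of_real ((norm (c v))\<^sup>2) * q v v)"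
    unfolding complex_norm_square by (simp add: mult.assoc)
  finally show ?thesis by simp
qed

lemma negset_comb_neg:
  assumes h: "herm X q" and V: "negset X q V" and c: "\<exists>v\<in>V. c v \<noteq> 0"
  shows "Re (q (comb V c) (comb V c)) < 0"
proof -
  have "finite V" "\<forall>v\<in>V. Re (q v v) < 0" using V by (auto simp: negset_def)
  moreover have "(\<Sum>v\<in>V. (norm (c v))\<^sup>2 * - Re (q v v)) > 0"
  proof -
    obtain v where "v \<in> V" "c v \<noteq> 0" using c by blast
    then show ?thesis
      using calculation by (intro sum_pos2[of V v] mult_pos_pos mult_nonneg_nonneg) (auto simp: less_imp_le)
  qed
  ultimately show ?thesis unfolding negset_comb[OF h V] by (simp add: sum_negf)
qed

text \<open>With fewer conditions than vectors some nontrivial combination satisfies them all, and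
  every such combination is negative.\<close>

lemma negset_test:
  assumes h: "herm X q" and V: "negset X q V" and J: "finite J" "\<And>\<phi>. \<phi> \<in> J \<Longrightarrow> linf X \<phi>"
    and card: "card J < card V"
  shows "\<exists>u\<in>X. Re (q u u) < 0 \<and> (\<forall>\<phi>\<in>J. \<phi> u = 0)"
proof -
  have V': "finite V" "V \<subseteq> X" using V by (auto simp: negset_def)
  obtain c where c: "\<exists>v\<in>V. c v \<noteq> 0" "\<forall>\<phi>\<in>J. (\<Sum>v\<in>V. c v * \<phi> v) = 0"
    using linear_system_nontrivial[OF J(1) V'(1) card, of "\<lambda>\<phi> v. \<phi> v"] by blast
  show ?thesis
    using comb_mem[OF herm_lincl[OF h] V', of c] negset_comb_neg[OF h V c(1)] c(2)
      linf_comb[OF herm_lincl[OF h] V', of _ c] J(2)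
    by (intro bexI[of _ "comb V c"]) auto
qed

lemma negset_insert:
  assumes h: "herm X q" and V: "negset X q V" and g: "g \<in> X" "Re (q g g) < 0" "\<And>v. v \<in> V \<Longrightarrow> q g v = 0"
  shows "negset X q (insert g V)" "g \<notin> V"
proof -
  show "g \<notin> V" using g(2) g(3)[of g] by auto
  have "q v g = 0" if "v \<in> V" for v
    using herm_sym[OF h g(1), of v] g(3)[OF that] V that by (auto simp: negset_def subset_eq)
  then show "negset X q (insert g V)"
    using V g unfolding negset_def by auto
qed

section \<open>The index as the largest size of a negative orthogonal family\<close>

definition negbound :: "cfn set \<Rightarrow> (cfn \<Rightarrow> cfn \<Rightarrow> complex) \<Rightarrow> nat \<Rightarrow> bool" where
  "negbound X q m \<longleftrightarrow> (\<forall>V. negset X q V \<longrightarrow> card V \<le> m)"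

text \<open>\<open>GREATEST\<close> has the intended meaning only for bounded cardinalities, so the
  facts about \<open>nind\<close> carry a \<open>negbound\<close> hypothesis.\<close>

definition nind :: "cfn set \<Rightarrow> (cfn \<Rightarrow> cfn \<Rightarrow> complex) \<Rightarrow> nat" where
  "nind X q = (GREATEST m. \<exists>V. negset X q V \<and> card V = m)"

lemma card_le_nind: "negbound X q m \<Longrightarrow> negset X q V \<Longrightarrow> card V \<le> nind X q"
  unfolding nind_def by (rule Greatest_le_nat[where b = m]) (auto simp: negbound_def)

lemma nind_attained:
  assumes "negbound X q m"
  obtains V where "negset X q V" "card V = nind X q"
proof -
  have "\<exists>V. negset X q V \<and> card V = nind X q"
    unfolding nind_def
  proof (rule GreatestI_nat[where k = 0 and b = m])
    have "negset X q {}" by (simp add: negset_def)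
    then show "\<exists>V. negset X q V \<and> card V = 0" by force
    show "k \<le> m" if "\<exists>V. negset X q V \<and> card V = k" for k using assms that by (auto simp: negbound_def)
  qed
  then show ?thesis using that by blast
qed

text \<open>A negative vector orthogonal to a family of maximal size would enlarge it. The
  orthogonal complement is cut out by \<open>nind X q\<close> functionals, which then serve to bound
  the index of related forms.\<close>

lemma nind_maximal:
  assumes h: "herm X q" and b: "negbound X q m"
  obtains V where "negset X q V" "card V = nind X q"
    "\<And>g. g \<in> X \<Longrightarrow> (\<And>v. v \<in> V \<Longrightarrow> q g v = 0) \<Longrightarrow> Re (q g g) \<ge> 0"
proof -
  obtain V where V: "negset X q V" "card V = nind X q" using nind_attained[OF b] .
  have "Re (q g g) \<ge> 0" if g: "g \<in> X" "\<And>v. v \<in> V \<Longrightarrow> q g v = 0" for g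
  proof (rule ccontr)
    assume "\<not> 0 \<le> Re (q g g)"
    then have "negset X q (insert g V)" "g \<notin> V" using negset_insert[OF h V(1) g(1) _ g(2)] by auto
    moreover have "finite V" using V(1) by (simp add: negset_def)
    ultimately have "Suc (card V) \<le> nind X q" using card_le_nind[OF b, of "insert g V"] by simp
    then show False using V(2) by simp
  qed
  then show ?thesis using that V by blast
qed

text \<open>The source of upper bounds: a family larger than \<open>J\<close> would span a negative
  vector in the common kernel of \<open>J\<close>.\<close>

lemma negbound_functionals:
  assumes h: "herm X q" and J: "finite J" "\<And>\<phi>. \<phi> \<in> J \<Longrightarrow> linf X \<phi>"
    and nn: "\<And>u. u \<in> X \<Longrightarrow> (\<And>\<phi>. \<phi> \<in> J \<Longrightarrow> \<phi> u = 0) \<Longrightarrow> Re (q u u) \<ge> 0"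
  shows "negbound X q (card J)"
  unfolding negbound_def
proof (intro allI impI, rule ccontr)
  fix V assume "negset X q V" "\<not> card V \<le> card J"
  then obtain u where "u \<in> X" "Re (q u u) < 0" "\<forall>\<phi>\<in>J. \<phi> u = 0"
    using negset_test[OF h _ J, of V] by auto
  then show False using nn[of u] by auto
qed

lemma nind_le: "negbound X q m \<Longrightarrow> nind X q \<le> m"
  by (metis nind_attained negbound_def)

section \<open>Square-integrable functions and primitives\<close>

text \<open>Borel functions on the whole line stand in for elements of \<open>L2\<close>, so that
  affine substitution and Fubini apply directly.\<close>

definition l2 :: "cfn set" where
  "l2 = {f. f \<in> borel_measurable borel \<and> integrable lborel (\<lambda>x. (norm (f x))\<^sup>2)}"

definition n2 :: "cfn \<Rightarrow> real" where
  "n2 f = sqrt (LINT x|lborel. (norm (f x))\<^sup>2)"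

lemma l2_measurable: "f \<in> l2 \<Longrightarrow> f \<in> borel_measurable borel"
  by (simp add: l2_def)

lemma l2_integrable: "f \<in> l2 \<Longrightarrow> integrable lborel (\<lambda>x. (norm (f x))\<^sup>2)"
  by (simp add: l2_def)

lemma n2_nonneg: "n2 f \<ge> 0"
  by (simp add: n2_def)

lemma n2_sq: "(n2 f)\<^sup>2 = (LINT x|lborel. (norm (f x))\<^sup>2)"
  by (simp add: n2_def)

lemma l2_mult_norm_integrable:
  assumes f: "f \<in> l2" and g: "g \<in> l2"
  shows "integrable lborel (\<lambda>x. norm (f x) * norm (g x))"
proof (rule Bochner_Integration.integrable_bound)
  show "integrable lborel (\<lambda>x. (norm (f x))\<^sup>2 + (norm (g x))\<^sup>2)"
    using l2_integrable[OF f] l2_integrable[OF g] by simp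
  show "(\<lambda>x. norm (f x) * norm (g x)) \<in> borel_measurable lborel"
    using l2_measurable[OF f] l2_measurable[OF g] by simp
  have "a * b \<le> a\<^sup>2 + b\<^sup>2" if "a \<ge> 0" "b \<ge> 0" for a b :: real
    using sum_squares_bound[of a b] that mult_nonneg_nonneg[of a b] by linarith
  then show "AE x in lborel. norm (norm (f x) * norm (g x)) \<le> norm ((norm (f x))\<^sup>2 + (norm (g x))\<^sup>2)"
    by simp
qed

lemma l2_mult_integrable: "f \<in> l2 \<Longrightarrow> g \<in> l2 \<Longrightarrow> integrable lborel (\<lambda>x. f x * g x)"
  by (rule Bochner_Integration.integrable_bound[OF l2_mult_norm_integrable[of f g]])
    (auto dest!: l2_measurable simp: norm_mult)

lemma l2_Cauchy_Schwarz:
  assumes f: "f \<in> l2" and g: "g \<in> l2"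
  shows "(LINT x|lborel. norm (f x) * norm (g x)) \<le> n2 f * n2 g"
proof (rule power2_le_imp_le)
  show "0 \<le> n2 f * n2 g" by (simp add: n2_nonneg)
  have "(LINT x|lborel. norm (f x) * norm (g x))\<^sup>2 \<le> (n2 f)\<^sup>2 * (n2 g)\<^sup>2"
  proof (rule quadratic_discriminant_le)
    fix s t :: real
    have "2 * s * t * (LINT x|lborel. norm (f x) * norm (g x)) =
      (LINT x|lborel. 2 * s * t * (norm (f x) * norm (g x)))"
      by simp
    also have "\<dots> \<le> (LINT x|lborel. s\<^sup>2 * (norm (f x))\<^sup>2 + t\<^sup>2 * (norm (g x))\<^sup>2)"
    proof (rule integral_mono)
      show "2 * s * t * (norm (f x) * norm (g x)) \<le> s\<^sup>2 * (norm (f x))\<^sup>2 + t\<^sup>2 * (norm (g x))\<^sup>2" for x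
        using sum_squares_bound[of "s * norm (f x)" "t * norm (g x)"]
        by (simp add: power_mult_distrib algebra_simps)
    qed (use l2_mult_norm_integrable[OF f g] l2_integrable[OF f] l2_integrable[OF g] in auto)
    also have "\<dots> = s\<^sup>2 * (n2 f)\<^sup>2 + t\<^sup>2 * (n2 g)\<^sup>2"
      unfolding n2_sq using l2_integrable[OF f] l2_integrable[OF g] by simp
    finally show "2 * s * t * (LINT x|lborel. norm (f x) * norm (g x)) \<le> s\<^sup>2 * (n2 f)\<^sup>2 + t\<^sup>2 * (n2 g)\<^sup>2" .
  qed auto
  then show "(LINT x|lborel. norm (f x) * norm (g x))\<^sup>2 \<le> (n2 f * n2 g)\<^sup>2"
    by (simp add: power_mult_distrib)
qed

lemma l2_dominated:
  assumes "f \<in> l2" "g \<in> borel_measurable borel" "\<And>x. norm (g x) \<le> C * norm (f x)"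
  shows "g \<in> l2"
  unfolding l2_def mem_Collect_eq
proof
  show "integrable lborel (\<lambda>x. (norm (g x))\<^sup>2)"
  proof (rule Bochner_Integration.integrable_bound)
    show "integrable lborel (\<lambda>x. C\<^sup>2 * (norm (f x))\<^sup>2)" using l2_integrable[OF assms(1)] by simp
    have "(norm (g x))\<^sup>2 \<le> C\<^sup>2 * (norm (f x))\<^sup>2" for x
      using power_mono[OF assms(3)[of x], of 2] by (simp add: power_mult_distrib)
    then show "AE x in lborel. norm ((norm (g x))\<^sup>2) \<le> norm (C\<^sup>2 * (norm (f x))\<^sup>2)" by simp
  qed (use assms(2) in simp)
qed (rule assms(2))

lemma l2_lincl: "lincl l2"
  unfolding lincl_def
proof (intro conjI allI ballI)
  show "(\<lambda>x. 0) \<in> l2" by (simp add: l2_def)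
  fix c u v assume u: "u \<in> l2" and v: "v \<in> l2"
  have [measurable]: "u \<in> borel_measurable borel" "v \<in> borel_measurable borel"
    using u v by (auto dest: l2_measurable)
  show "(\<lambda>x. c * u x + v x) \<in> l2"
    unfolding l2_def mem_Collect_eq
  proof
    show "integrable lborel (\<lambda>x. (norm (c * u x + v x))\<^sup>2)"
    proof (rule Bochner_Integration.integrable_bound)
      show "integrable lborel (\<lambda>x. 2 * (norm c)\<^sup>2 * (norm (u x))\<^sup>2 + 2 * (norm (v x))\<^sup>2)"
        using l2_integrable[OF u] l2_integrable[OF v] by simp
      have "(norm (c * u x + v x))\<^sup>2 \<le> 2 * (norm c)\<^sup>2 * (norm (u x))\<^sup>2 + 2 * (norm (v x))\<^sup>2" for x
      proof -
        have "(norm (c * u x + v x))\<^sup>2 \<le> (norm c * norm (u x) + norm (v x))\<^sup>2"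
          using norm_triangle_ineq[of "c * u x" "v x"] by (intro power_mono) (auto simp: norm_mult)
        also have "\<dots> \<le> 2 * (norm c * norm (u x))\<^sup>2 + 2 * (norm (v x))\<^sup>2"
          using sum_squares_bound[of "norm c * norm (u x)" "norm (v x)"] by (simp add: power2_sum)
        finally show ?thesis by (simp add: power_mult_distrib)
      qed
      then show "AE x in lborel. norm ((norm (c * u x + v x))\<^sup>2) \<le> norm (2 * (norm c)\<^sup>2 * (norm (u x))\<^sup>2 + 2 * (norm (v x))\<^sup>2)"
        by simp
    qed measurable
  qed measurable
qed

text \<open>The half-open support lets the cells tile it exactly, point by point.\<close>

definition X1 :: "cfn set" where
  "X1 = {g\<in>l2. \<forall>x. x \<notin> {0<..1} \<longrightarrow> g x = 0}"

lemma X1_l2: "g \<in> X1 \<Longrightarrow> g \<in> l2"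
  by (simp add: X1_def)

lemma X1_measurable: "g \<in> X1 \<Longrightarrow> g \<in> borel_measurable borel"
  by (simp add: X1_def l2_def)

lemma X1_outside: "g \<in> X1 \<Longrightarrow> x \<notin> {0<..1} \<Longrightarrow> g x = 0"
  unfolding X1_def by blast

lemma X1_lincl: "lincl X1"
  using l2_lincl unfolding lincl_def X1_def by simp

lemma indicator_l2:
  assumes "a \<le> b"
  shows "(\<lambda>x. indicator {a<..b} x :: complex) \<in> l2" "n2 (indicator {a<..b}) = sqrt (b - a)"
proof -
  have eq: "(\<lambda>x. (norm (indicator {a<..b} x :: complex))\<^sup>2) = (\<lambda>x. indicator {a<..b} x :: real)"
    by (auto simp: indicator_def)
  show "(\<lambda>x. indicator {a<..b} x :: complex) \<in> l2" unfolding l2_def mem_Collect_eq eq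
    using assms by (auto simp: integrable_indicator_iff)
  show "n2 (indicator {a<..b}) = sqrt (b - a)" unfolding n2_def eq using assms by simp
qed

section \<open>Truncations, primitives and integration by parts\<close>

definition cut :: "real \<Rightarrow> real \<Rightarrow> cfn \<Rightarrow> cfn" where
  "cut a b g = (\<lambda>x. if a < x \<and> x \<le> b then g x else 0)"

lemma cut_l2: "g \<in> l2 \<Longrightarrow> cut a b g \<in> l2"
  by (rule l2_dominated[of g _ 1]) (auto simp: cut_def dest: l2_measurable)

lemma cut_X1: "g \<in> X1 \<Longrightarrow> cut a b g \<in> X1"
  using cut_l2[of g] unfolding X1_def by (auto simp: cut_def)

lemma cut_integral:
  assumes g: "g \<in> l2" and ab: "a \<le> b"
  shows "integrable lborel (cut a b g)" "(LINT x|lborel. norm (cut a b g x)) \<le> sqrt (b - a) * n2 (cut a b g)"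
proof -
  have "cut a b g = (\<lambda>x. indicator {a<..b} x * cut a b g x)" by (auto simp: cut_def fun_eq_iff)
  then show "integrable lborel (cut a b g)"
    using l2_mult_integrable[OF indicator_l2(1)[OF ab] cut_l2[OF g], of a b] by simp
  have "(LINT x|lborel. norm (cut a b g x)) =
    (LINT x|lborel. norm (indicator {a<..b} x :: complex) * norm (cut a b g x))"
    by (intro Bochner_Integration.integral_cong) (auto simp: cut_def)
  also have "\<dots> \<le> sqrt (b - a) * n2 (cut a b g)"
    using l2_Cauchy_Schwarz[OF indicator_l2(1)[OF ab] cut_l2[OF g], of a b] indicator_l2(2)[OF ab] by simp
  finally show "(LINT x|lborel. norm (cut a b g x)) \<le> sqrt (b - a) * n2 (cut a b g)" .
qed

lemma X1_cut_01: "g \<in> X1 \<Longrightarrow> cut 0 1 g = g"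
  unfolding cut_def by (auto simp: fun_eq_iff X1_outside)

lemma X1_integrable: "g \<in> X1 \<Longrightarrow> integrable lborel g"
  using cut_integral(1)[OF X1_l2, of g 0 1] X1_cut_01 by fastforce

definition prim :: "cfn \<Rightarrow> cfn" where
  "prim g x = (LINT t|lborel. (if t \<le> x then g t else 0))"

lemma integrable_restrict:
  fixes g :: cfn
  assumes "integrable lborel g" and [measurable]: "Measurable.pred borel Q"
  shows "integrable lborel (\<lambda>t. if Q t then g t else 0)"
  by (rule Bochner_Integration.integrable_bound[OF assms(1)])
    (use borel_measurable_integrable[OF assms(1)] in auto)

lemma prim_lin:
  assumes "integrable lborel g" "integrable lborel h"
  shows "prim (\<lambda>x. c * g x + h x) x = c * prim g x + prim h x"
proof -
  have "prim (\<lambda>x. c * g x + h x) x =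
    (LINT t|lborel. c * (if t \<le> x then g t else 0) + (if t \<le> x then h t else 0))"
    unfolding prim_def by (intro Bochner_Integration.integral_cong) auto
  also have "\<dots> = c * prim g x + prim h x"
    unfolding prim_def using integrable_restrict[OF assms(1), of "\<lambda>t. t \<le> x"]
      integrable_restrict[OF assms(2), of "\<lambda>t. t \<le> x"] by simp
  finally show ?thesis .
qed

lemma prim_measurable:
  assumes [measurable]: "g \<in> borel_measurable borel"
  shows "prim g \<in> borel_measurable borel"
  unfolding prim_def[abs_def]
proof (rule lborel.borel_measurable_lebesgue_integral)
  have "(\<lambda>(x, t). if t \<le> x then g t else 0) \<in> borel_measurable (borel \<Otimes>\<^sub>M borel)"
    by measurable
  then show "(\<lambda>(x, t). if t \<le> x then g t else 0) \<in> borel_measurable (borel \<Otimes>\<^sub>M lborel)"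
    by (simp cong: measurable_cong_sets sets_pair_measure_cong)
qed

lemma prim_le_0:
  assumes "g \<in> X1" "x \<le> 0" shows "prim g x = 0"
proof -
  have "(\<lambda>t. if t \<le> x then g t else 0) = (\<lambda>t. 0)" using assms by (auto simp: X1_outside)
  then show ?thesis by (simp add: prim_def)
qed

lemma prim_ge_1:
  assumes "g \<in> X1" "x \<ge> 1" shows "prim g x = (LINT t|lborel. g t)"
proof -
  have "(\<lambda>t. if t \<le> x then g t else 0) = g" using assms by (auto simp: X1_outside)
  then show ?thesis by (simp add: prim_def)
qed

lemma prim_diff:
  assumes g: "g \<in> X1" and xy: "x \<le> y"
  shows "prim g y - prim g x = (LINT t|lborel. cut x y g t)"
proof -
  have "prim g y - prim g x = (LINT t|lborel. (if t \<le> y then g t else 0) - (if t \<le> x then g t else 0))"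
    unfolding prim_def
    using integrable_restrict[OF X1_integrable[OF g], of "\<lambda>t. t \<le> x"]
      integrable_restrict[OF X1_integrable[OF g], of "\<lambda>t. t \<le> y"] by simp
  also have "\<dots> = (LINT t|lborel. cut x y g t)"
    using xy by (intro Bochner_Integration.integral_cong) (auto simp: cut_def)
  finally show ?thesis .
qed

text \<open>Cauchy-Schwarz against the indicator of the interval. The factor
  \<open>sqrt (y - x)\<close> is the smallness that later absorbs the weight on short
  intervals.\<close>

lemma prim_Holder:
  assumes g: "g \<in> X1" and xy: "x \<le> y"
  shows "norm (prim g y - prim g x) \<le> sqrt (y - x) * n2 (cut x y g)"
  unfolding prim_diff[OF assms]
  using integral_norm_bound[of lborel "cut x y g"] cut_integral(2)[OF X1_l2[OF g] xy] by linarith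

lemma n2_mono:
  assumes "g \<in> l2" "f \<in> borel_measurable borel" "\<And>x. norm (f x) \<le> norm (g x)"
  shows "n2 f \<le> n2 g"
proof -
  have f: "f \<in> l2" by (rule l2_dominated[of g _ 1]) (use assms in auto)
  show ?thesis unfolding n2_def
    by (intro real_sqrt_le_mono integral_mono) (use assms l2_integrable f in \<open>auto intro: power_mono\<close>)
qed

lemma n2_cut_le: "g \<in> l2 \<Longrightarrow> n2 (cut a b g) \<le> n2 g"
  by (rule n2_mono) (auto simp: cut_def dest: l2_measurable)

lemma prim_bound:
  assumes g: "g \<in> X1" shows "norm (prim g x) \<le> n2 g"
proof -
  consider "x \<le> 0" | "0 \<le> x" "x \<le> 1" | "1 \<le> x" by linarith
  then show ?thesis
  proof cases
    case 1 then show ?thesis using prim_le_0[OF g] n2_nonneg by simp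
  next
    case 2
    have "norm (prim g x) \<le> sqrt x * n2 (cut 0 x g)"
      using prim_Holder[OF g 2(1)] prim_le_0[OF g, of 0] by simp
    also have "\<dots> \<le> 1 * n2 g"
      using 2 n2_cut_le[OF X1_l2[OF g]] by (intro mult_mono) (auto simp: n2_nonneg)
    finally show ?thesis by simp
  next
    case 3
    have "norm (prim g x) \<le> sqrt 1 * n2 (cut 0 1 g)"
      using prim_Holder[OF g, of 0 1] prim_le_0[OF g, of 0] prim_ge_1[OF g] 3 by simp
    then show ?thesis using X1_cut_01[OF g] by simp
  qed
qed

lemma bounded_mult_integrable:
  fixes f b :: cfn
  assumes "integrable lborel f" "b \<in> borel_measurable borel" "\<And>x. norm (b x) \<le> C"
  shows "integrable lborel (\<lambda>x. f x * b x)"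
proof (rule Bochner_Integration.integrable_bound)
  show "integrable lborel (\<lambda>x. C * norm (f x))" using assms(1) by simp
  show "(\<lambda>x. f x * b x) \<in> borel_measurable lborel"
    using borel_measurable_integrable[OF assms(1)] assms(2) by simp
  have "C \<ge> 0" using norm_ge_zero assms(3) order_trans by blast
  then show "AE x in lborel. norm (f x * b x) \<le> norm (C * norm (f x))"
    using assms(3) by (simp add: norm_mult mult.commute[of C] mult_left_mono)
qed

text \<open>Integration by parts: the product of the two integrals is an integral over the plane,
  split along the diagonal and evaluated by Fubini.\<close>

lemma integral_product_rule:
  assumes g: "g \<in> X1" and h: "h \<in> X1"
  shows "(LINT x|lborel. g x * prim h x + prim g x * h x) = (LINT x|lborel. g x) * (LINT x|lborel. h x)"
proof -
  have [measurable]: "g \<in> borel_measurable borel" "h \<in> borel_measurable borel"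
    using g h by (auto dest: X1_measurable)
  have ig: "integrable lborel g" and ih: "integrable lborel h" using g h by (auto intro: X1_integrable)
  have gh: "integrable (lborel \<Otimes>\<^sub>M lborel) (\<lambda>(s, t). g s * h t)"
    by (rule lborel_pair.Fubini_integrable) (use ig ih in \<open>auto simp: norm_mult\<close>)
  have low: "integrable (lborel \<Otimes>\<^sub>M lborel) (\<lambda>(s, t). if s < t then g s * h t else 0)"
    by (rule Bochner_Integration.integrable_bound[OF gh]) auto
  have "(LINT x|lborel. g x) * (LINT x|lborel. h x) = (LINT s|lborel. g s * (LINT t|lborel. h t))"
    by simp
  also have "\<dots> = (LINT s|lborel. g s * prim h s + (LINT t|lborel. (if s < t then g s * h t else 0)))"
  proof (intro Bochner_Integration.integral_cong refl)
    fix s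
    have "(LINT t|lborel. h t) = (LINT t|lborel. (if t \<le> s then h t else 0) + (if s < t then h t else 0))"
      by (intro Bochner_Integration.integral_cong) auto
    also have "\<dots> = prim h s + (LINT t|lborel. (if s < t then h t else 0))"
      unfolding prim_def using integrable_restrict[OF ih, of "\<lambda>t. t \<le> s"] integrable_restrict[OF ih, of "\<lambda>t. s < t"]
      by simp
    finally have "g s * (LINT t|lborel. h t) = g s * prim h s + g s * (LINT t|lborel. (if s < t then h t else 0))"
      by (simp add: distrib_left)
    also have "g s * (LINT t|lborel. (if s < t then h t else 0)) = (LINT t|lborel. g s * (if s < t then h t else 0))"
      by simp
    also have "\<dots> = (LINT t|lborel. (if s < t then g s * h t else 0))"
      by (intro Bochner_Integration.integral_cong) auto
    finally show "g s * (LINT t|lborel. h t) = g s * prim h s + (LINT t|lborel. (if s < t then g s * h t else 0))" .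
  qed
  also have "\<dots> = (LINT s|lborel. g s * prim h s) + (LINT s|lborel. LINT t|lborel. (if s < t then g s * h t else 0))"
    using bounded_mult_integrable[OF ig prim_measurable prim_bound[OF h]] lborel_pair.integrable_fst[OF low]
    by (intro Bochner_Integration.integral_add) auto
  also have "(LINT s|lborel. LINT t|lborel. (if s < t then g s * h t else 0)) =
    (LINT t|lborel. LINT s|lborel. (if s < t then g s * h t else 0))"
    by (rule lborel_pair.Fubini_integral[OF low, symmetric])
  also have "\<dots> = (LINT t|lborel. prim g t * h t)"
  proof (intro Bochner_Integration.integral_cong refl)
    fix t
    have "(LINT s|lborel. (if s < t then g s * h t else 0)) = (LINT s|lborel. (if s \<le> t then g s else 0) * h t)"
    proof (intro integral_cong_AE)
      \<comment> \<open>The strict inequality from the split and the weak one in \<open>prim\<close>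
        differ only at the point \<open>t\<close>.\<close>
      show "AE s in lborel. (if s < t then g s * h t else 0) = (if s \<le> t then g s else 0) * h t"
        using AE_lborel_singleton[of t] by eventually_elim auto
    qed auto
    then show "(LINT s|lborel. (if s < t then g s * h t else 0)) = prim g t * h t"
      using integrable_restrict[OF ig, of "\<lambda>s. s \<le> t"] by (simp add: prim_def)
  qed
  also have "(LINT s|lborel. g s * prim h s) + (LINT t|lborel. prim g t * h t) =
    (LINT x|lborel. g x * prim h x + prim g x * h x)"
    using bounded_mult_integrable[OF ig prim_measurable prim_bound[OF h]]
      bounded_mult_integrable[OF ih prim_measurable prim_bound[OF g]]
    by (subst Bochner_Integration.integral_add) (auto simp: mult.commute)
  finally show ?thesis by simp
qed

text \<open>Equal primitives mean equal integrals over all half-lines. These form an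
  intersection-stable generator of the Borel sets, so the integrals over all Borel sets agree and
  the densities coincide.\<close>

lemma prim_inject_AE:
  assumes g: "g \<in> X1" and h: "h \<in> X1" and eq: "\<And>x. prim g x = prim h x"
  shows "AE x in lborel. g x = h x"
proof -
  have ig: "integrable lborel g" and ih: "integrable lborel h" using g h by (auto intro: X1_integrable)
  have [measurable]: "g \<in> borel_measurable borel" "h \<in> borel_measurable borel"
    using g h by (auto dest: X1_measurable)
  have iA: "integrable lborel (\<lambda>x. indicator A x *\<^sub>R f x)" if "A \<in> sets borel" "integrable lborel f" for A and f :: cfn
    using that by (intro integrable_mult_indicator) auto
  have "(LINT x|lborel. indicator A x *\<^sub>R g x) = (LINT x|lborel. indicator A x *\<^sub>R h x)"
    if A: "A \<in> sets borel" for A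
  proof -
    have "Int_stable (range (\<lambda>a::real. {..a}))" by (auto simp: Int_stable_def)
    moreover have "range (\<lambda>a::real. {..a}) \<subseteq> Pow UNIV" by auto
    moreover have "A \<in> sigma_sets UNIV (range (\<lambda>a::real. {..a}))"
      using A unfolding borel_eq_atMost by simp
    ultimately show ?thesis
    proof (induction rule: sigma_sets_induct_disjoint)
      case (basic A)
      then obtain a where A: "A = {..a}" by blast
      have "(LINT x|lborel. indicator {..a} x *\<^sub>R f x) = prim f a" for f :: cfn
        unfolding prim_def by (intro Bochner_Integration.integral_cong) auto
      then show ?case using eq A by simp
    next
      case (compl A)
      then have A: "A \<in> sets borel" unfolding borel_eq_atMost by simp
      have "(LINT x|lborel. indicator (UNIV - A) x *\<^sub>R f x) = (LINT x|lborel. f x) - (LINT x|lborel. indicator A x *\<^sub>R f x)"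
        if "integrable lborel f" for f :: cfn
      proof -
        have "(LINT x|lborel. indicator (UNIV - A) x *\<^sub>R f x) = (LINT x|lborel. f x - indicator A x *\<^sub>R f x)"
          by (intro Bochner_Integration.integral_cong) (auto simp: indicator_def)
        then show ?thesis using that iA[OF A that] by simp
      qed
      \<comment> \<open>Complements need equal total integrals, which are the values of the
        primitives at 1.\<close>
      then show ?case using compl ig ih eq[of 1] prim_ge_1[OF g, of 1] prim_ge_1[OF h, of 1] by simp
    next
      case (union A)
      have "A i \<in> sets borel" for i using union(2) unfolding borel_eq_atMost by (auto simp: image_subset_iff)
      then have A: "\<And>i. A i \<in> sets lborel" "(\<Union>i. A i) \<in> sets borel" by auto
      have "(LINT x|lborel. indicator (\<Union>i. A i) x *\<^sub>R f x) = (\<Sum>i. LINT x|lborel. indicator (A i) x *\<^sub>R f x)"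
        if "integrable lborel f" for f :: cfn
        using lebesgue_integral_countable_add[of A lborel f] A union(1) iA[OF A(2) that]
        by (auto simp: set_integrable_def set_lebesgue_integral_def disjoint_family_on_def)
      then show ?case using union ig ih by simp
    qed simp
  qed
  then show ?thesis
    by (intro sigma_finite_measure.density_unique_banach[OF _ ig ih])
      (auto simp: set_lebesgue_integral_def sigma_finite_lborel)
qed

section \<open>The quadratic forms of the pencil\<close>

definition ip :: "cfn \<Rightarrow> cfn \<Rightarrow> complex" where
  "ip g h = (LINT x|lborel. g x * cnj (h x))"

text \<open>With \<open>y = prim g\<close> and \<open>z = prim h\<close> this is the integral of
  \<open>p\<close> against the derivative of \<open>y * cnj z\<close>, hence minus the pairing of
  the derivative of \<open>p\<close> with \<open>cnj y * z\<close>.\<close>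

definition bf :: "cfn \<Rightarrow> cfn \<Rightarrow> cfn \<Rightarrow> complex" where
  "bf p g h = (LINT x|lborel. p x * (g x * cnj (prim h x) + prim g x * cnj (h x)))"

text \<open>The form of the pencil at \<open>prim g\<close>, \<open>prim h\<close>: functions in \<open>H\<close> are represented by
  their derivatives.\<close>

definition frm :: "cfn \<Rightarrow> real \<Rightarrow> cfn \<Rightarrow> cfn \<Rightarrow> complex" where
  "frm p lam g h = ip g h + of_real lam * bf p g h"

text \<open>Zero mean says that the primitive vanishes at 1: up to null sets these are the
  derivatives of the elements of \<open>H\<close>.\<close>

definition X0 :: "cfn set" where
  "X0 = {g\<in>X1. (LINT x|lborel. g x) = 0}"

lemma X0_X1: "g \<in> X0 \<Longrightarrow> g \<in> X1"
  by (simp add: X0_def)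

lemma X0_lincl: "lincl X0"
  unfolding lincl_def X0_def
proof (intro conjI allI ballI)
  show "(\<lambda>x. 0) \<in> {g \<in> X1. (LINT x|lborel. g x) = 0}" using X1_lincl by (simp add: lincl_def)
  fix c u v assume "u \<in> {g \<in> X1. (LINT x|lborel. g x) = 0}" "v \<in> {g \<in> X1. (LINT x|lborel. g x) = 0}"
  then show "(\<lambda>x. c * u x + v x) \<in> {g \<in> X1. (LINT x|lborel. g x) = 0}"
    using X1_lincl by (auto simp: lincl_def X1_integrable)
qed

lemma prim_X0_ge_1: "g \<in> X0 \<Longrightarrow> x \<ge> 1 \<Longrightarrow> prim g x = 0"
  by (simp add: X0_def prim_ge_1)

lemma borel_measurable_cnj [measurable (raw)]:
  "f \<in> borel_measurable M \<Longrightarrow> (\<lambda>x. cnj (f x)) \<in> borel_measurable M"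
  by (rule borel_measurable_continuous_on[of cnj]) (intro continuous_intros)

lemma cnj_l2: "g \<in> l2 \<Longrightarrow> (\<lambda>x. cnj (g x)) \<in> l2"
  by (rule l2_dominated[of g _ 1]) (auto dest: l2_measurable)

lemma cnj_X1: "g \<in> X1 \<Longrightarrow> (\<lambda>x. cnj (g x)) \<in> X1"
  using cnj_l2 by (auto simp: X1_def)

lemma prim_cnj: "prim (\<lambda>x. cnj (g x)) x = cnj (prim g x)"
  unfolding prim_def Bochner_Integration.integral_cnj[symmetric]
  by (intro Bochner_Integration.integral_cong) auto

lemma n2_cnj: "n2 (\<lambda>x. cnj (g x)) = n2 g"
  by (simp add: n2_def)

text \<open>The bound on \<open>b\<close> is asked only where \<open>g\<close> is nonzero, which
  makes the estimate local when \<open>g\<close> is a truncation.\<close>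

lemma l2_triple:
  assumes p: "p \<in> l2" and g: "g \<in> l2" and b: "b \<in> borel_measurable borel" and C: "C \<ge> 0"
    and le: "\<And>x. g x \<noteq> 0 \<Longrightarrow> norm (b x) \<le> C"
  shows "integrable lborel (\<lambda>x. p x * (g x * b x))" "norm (LINT x|lborel. p x * (g x * b x)) \<le> C * (n2 p * n2 g)"
proof -
  have [measurable]: "p \<in> borel_measurable borel" "g \<in> borel_measurable borel" "b \<in> borel_measurable borel"
    using p g b by (auto dest: l2_measurable)
  have pt: "norm (p x * (g x * b x)) \<le> C * (norm (p x) * norm (g x))" for x
    using le[of x] mult_right_mono[of "norm (b x)" C "norm (p x) * norm (g x)"]
    by (cases "g x = 0") (auto simp: norm_mult mult_ac)
  show int: "integrable lborel (\<lambda>x. p x * (g x * b x))"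
  proof (rule Bochner_Integration.integrable_bound)
    show "integrable lborel (\<lambda>x. C * (norm (p x) * norm (g x)))"
      using l2_mult_norm_integrable[OF p g] by simp
    show "AE x in lborel. norm (p x * (g x * b x)) \<le> norm (C * (norm (p x) * norm (g x)))"
      using pt C by (auto simp: abs_mult)
  qed measurable
  have "norm (LINT x|lborel. p x * (g x * b x)) \<le> (LINT x|lborel. norm (p x * (g x * b x)))"
    by simp
  also have "\<dots> \<le> (LINT x|lborel. C * (norm (p x) * norm (g x)))"
    using int l2_mult_norm_integrable[OF p g] pt by (intro integral_mono) auto
  also have "\<dots> \<le> C * (n2 p * n2 g)"
    using l2_Cauchy_Schwarz[OF p g] C by (simp add: mult_left_mono)
  finally show "norm (LINT x|lborel. p x * (g x * b x)) \<le> C * (n2 p * n2 g)" .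
qed

lemma ip_bound: "g \<in> l2 \<Longrightarrow> h \<in> l2 \<Longrightarrow> norm (ip g h) \<le> n2 g * n2 h"
  unfolding ip_def
  using integral_norm_bound[of lborel "\<lambda>x. g x * cnj (h x)"] l2_Cauchy_Schwarz[of g h]
  by (simp add: norm_mult)

lemma ip_self: "ip g g = of_real ((n2 g)\<^sup>2)"
  unfolding ip_def n2_sq complex_norm_square[symmetric] by (simp flip: integral_complex_of_real)

text \<open>Real values of \<open>p\<close> make the forms Hermitian; for a self-similar function
  they are obtained in \<open>real_representative\<close>.\<close>

locale weight =
  fixes p :: cfn
  assumes p_l2: "p \<in> l2" and p_real: "\<And>x. cnj (p x) = p x"
begin

lemma bf_parts:
  assumes g: "g \<in> X1" and h: "h \<in> X1"
  shows "integrable lborel (\<lambda>x. p x * (g x * cnj (prim h x)))"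
    "integrable lborel (\<lambda>x. p x * (prim g x * cnj (h x)))"
    "bf p g h = (LINT x|lborel. p x * (g x * cnj (prim h x))) + (LINT x|lborel. p x * (prim g x * cnj (h x)))"
proof -
  have m: "prim g \<in> borel_measurable borel" "(\<lambda>x. cnj (prim h x)) \<in> borel_measurable borel"
    using prim_measurable X1_measurable g h by auto
  show 1: "integrable lborel (\<lambda>x. p x * (g x * cnj (prim h x)))"
    by (rule l2_triple(1)[OF p_l2 X1_l2[OF g] m(2) n2_nonneg[of h]]) (use prim_bound[OF h] in simp)
  show 2: "integrable lborel (\<lambda>x. p x * (prim g x * cnj (h x)))"
    using l2_triple(1)[OF p_l2 cnj_l2[OF X1_l2[OF h]] m(1) n2_nonneg[of g]] prim_bound[OF g]
    by (simp add: mult.commute)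
  show "bf p g h = (LINT x|lborel. p x * (g x * cnj (prim h x))) + (LINT x|lborel. p x * (prim g x * cnj (h x)))"
    unfolding bf_def distrib_left by (rule Bochner_Integration.integral_add[OF 1 2])
qed

lemma bf_bound:
  assumes g: "g \<in> X1" and h: "h \<in> X1"
  shows "norm (bf p g h) \<le> 2 * n2 p * n2 g * n2 h"
proof -
  have m: "prim g \<in> borel_measurable borel" "(\<lambda>x. cnj (prim h x)) \<in> borel_measurable borel"
    using prim_measurable X1_measurable g h by auto
  have "norm (LINT x|lborel. p x * (g x * cnj (prim h x))) \<le> n2 h * (n2 p * n2 g)"
    by (rule l2_triple(2)[OF p_l2 X1_l2[OF g] m(2) n2_nonneg[of h]]) (use prim_bound[OF h] in simp)
  moreover have "norm (LINT x|lborel. p x * (prim g x * cnj (h x))) \<le> n2 g * (n2 p * n2 h)"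
    using l2_triple(2)[OF p_l2 cnj_l2[OF X1_l2[OF h]] m(1) n2_nonneg[of g]] prim_bound[OF g]
    by (simp add: mult.commute n2_cnj)
  ultimately show ?thesis
    unfolding bf_parts(3)[OF g h]
    using norm_triangle_ineq[of "LINT x|lborel. p x * (g x * cnj (prim h x))" "LINT x|lborel. p x * (prim g x * cnj (h x))"]
    by (simp add: algebra_simps)
qed

lemma frm_bound:
  assumes g: "g \<in> X1" and h: "h \<in> X1"
  shows "norm (frm p lam g h) \<le> (1 + 2 * \<bar>lam\<bar> * n2 p) * n2 g * n2 h"
proof -
  have "norm (frm p lam g h) \<le> norm (ip g h) + \<bar>lam\<bar> * norm (bf p g h)"
    unfolding frm_def using norm_triangle_ineq[of "ip g h" "of_real lam * bf p g h"] by (simp add: norm_mult)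
  also have "\<dots> \<le> n2 g * n2 h + \<bar>lam\<bar> * (2 * n2 p * n2 g * n2 h)"
    by (intro add_mono mult_left_mono ip_bound bf_bound X1_l2 g h) auto
  finally show ?thesis by (simp add: algebra_simps)
qed

lemma frm_self: "Re (frm p lam g g) = (n2 g)\<^sup>2 + lam * Re (bf p g g)"
  unfolding frm_def ip_self by simp

lemma herm_frm_X1: "herm X1 (frm p lam)"
  unfolding herm_def linf_def
proof (intro conjI ballI allI X1_lincl)
  fix z c u v assume z: "z \<in> X1" and u: "u \<in> X1" and v: "v \<in> X1"
  have cuv: "(\<lambda>x. c * u x + v x) \<in> X1" using X1_lincl u v by (simp add: lincl_def)
  have "ip (\<lambda>x. c * u x + v x) z = (LINT x|lborel. c * (u x * cnj (z x)) + v x * cnj (z x))"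
    unfolding ip_def by (simp add: algebra_simps)
  also have "\<dots> = c * ip u z + ip v z"
    unfolding ip_def using l2_mult_integrable[OF _ cnj_l2] u v z by (simp add: X1_l2)
  finally have ip: "ip (\<lambda>x. c * u x + v x) z = c * ip u z + ip v z" .
  have "bf p (\<lambda>x. c * u x + v x) z =
    (LINT x|lborel. c * (p x * (u x * cnj (prim z x))) + p x * (v x * cnj (prim z x))) +
    (LINT x|lborel. c * (p x * (prim u x * cnj (z x))) + p x * (prim v x * cnj (z x)))"
    unfolding bf_parts(3)[OF cuv z] prim_lin[OF X1_integrable[OF u] X1_integrable[OF v]]
    by (simp add: algebra_simps)
  also have "\<dots> = c * bf p u z + bf p v z"
    using bf_parts[OF u z] bf_parts[OF v z] by (simp add: algebra_simps)
  finally show "frm p lam (\<lambda>x. c * u x + v x) z = c * frm p lam u z + frm p lam v z"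
    unfolding frm_def ip by (simp add: algebra_simps)
next
  fix u v assume u: "u \<in> X1" and v: "v \<in> X1"
  have "ip v u = cnj (ip u v)" unfolding ip_def Bochner_Integration.integral_cnj[symmetric]
    by (simp add: mult.commute del: Bochner_Integration.integral_cnj)
  moreover have "bf p v u = cnj (bf p u v)"
    unfolding bf_def Bochner_Integration.integral_cnj[symmetric]
    by (simp add: p_real algebra_simps del: Bochner_Integration.integral_cnj)
  ultimately show "frm p lam v u = cnj (frm p lam u v)" unfolding frm_def by simp
qed

lemma herm_frm: "herm X0 (frm p lam)"
  by (rule herm_subset[OF herm_frm_X1 X0_lincl]) (auto simp: X0_def)

definition Nf :: "real \<Rightarrow> nat" where
  "Nf lam = nind X0 (frm p lam)"

text \<open>For small \<open>lam\<close> the Dirichlet term dominates the weight term; the factor 2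
  is that of \<open>bf_bound\<close>.\<close>

lemma negbound_small:
  assumes "2 * \<bar>lam\<bar> * n2 p \<le> 1"
  shows "negbound X0 (frm p lam) 0"
proof -
  have "Re (frm p lam u u) \<ge> 0" if u: "u \<in> X0" for u
  proof -
    have "\<bar>lam * Re (bf p u u)\<bar> \<le> \<bar>lam\<bar> * norm (bf p u u)"
      by (simp add: abs_mult mult_left_mono abs_Re_le_cmod)
    also have "\<dots> \<le> \<bar>lam\<bar> * (2 * n2 p * n2 u * n2 u)"
      using bf_bound[OF X0_X1[OF u] X0_X1[OF u]] by (intro mult_left_mono) auto
    also have "\<dots> = (2 * \<bar>lam\<bar> * n2 p) * (n2 u)\<^sup>2" by (simp add: power2_eq_square)
    also have "\<dots> \<le> 1 * (n2 u)\<^sup>2" using assms by (intro mult_right_mono) auto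
    finally show ?thesis unfolding frm_self by linarith
  qed
  then show ?thesis
    using negbound_functionals[OF herm_frm, of "{}"] by simp
qed

text \<open>\<open>s\<close> times the form at \<open>lam\<close> is the form at
  \<open>s * lam\<close> plus \<open>(s - 1) * (n2 u)\<^sup>2\<close>. So the form at
  \<open>lam\<close> is nonnegative wherever the form at \<open>s * lam\<close> is, and the
  functionals of a maximal family at \<open>s * lam\<close> bound the index at
  \<open>lam\<close>.\<close>

lemma Nf_scale_mono:
  assumes b: "negbound X0 (frm p (s * lam)) m" and s: "s \<ge> 1"
  shows "Nf lam \<le> Nf (s * lam)"
proof -
  obtain V where V: "negset X0 (frm p (s * lam)) V" "card V = Nf (s * lam)"
    and max: "\<And>g. g \<in> X0 \<Longrightarrow> (\<And>v. v \<in> V \<Longrightarrow> frm p (s * lam) g v = 0) \<Longrightarrow> Re (frm p (s * lam) g g) \<ge> 0"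
    using nind_maximal[OF herm_frm b] unfolding Nf_def by metis
  have fV: "finite V" "V \<subseteq> X0" using V(1) by (auto simp: negset_def)
  define J where "J = (\<lambda>v u. frm p (s * lam) u v) ` V"
  have "negbound X0 (frm p lam) (card J)"
  proof (rule negbound_functionals[OF herm_frm])
    show "finite J" using fV by (simp add: J_def)
    show "linf X0 \<phi>" if "\<phi> \<in> J" for \<phi> using that herm_linf[OF herm_frm] fV by (auto simp: J_def)
    fix u assume u: "u \<in> X0" "\<And>\<phi>. \<phi> \<in> J \<Longrightarrow> \<phi> u = 0"
    have "0 \<le> (n2 u)\<^sup>2 + s * (lam * Re (bf p u u))"
      using max[OF u(1)] u(2) unfolding J_def frm_self by (auto simp: mult.assoc)
    also have "\<dots> \<le> s * ((n2 u)\<^sup>2 + lam * Re (bf p u u))"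
      using s mult_right_mono[of 1 s "(n2 u)\<^sup>2"] by (simp add: algebra_simps)
    finally show "0 \<le> Re (frm p lam u u)" unfolding frm_self using s by (simp add: zero_le_mult_iff)
  qed
  then have "Nf lam \<le> card J" unfolding Nf_def by (rule nind_le)
  also have "\<dots> \<le> card V" unfolding J_def using fV by (rule_tac card_image_le)
  finally show ?thesis using V(2) by simp
qed

text \<open>\<open>neg_subspace\<close> and the continuity in \<open>lam\<close> ask for negativity
  relative to the norm. On the span of a finite family it follows from the least
  \<open>- Re (frm p lam v v)\<close> and a bound of the norm of a combination by its
  coefficients.\<close>

lemma negset_uniform:
  assumes V: "negset X0 (frm p lam) V"
  shows "\<exists>\<epsilon>>0. \<forall>c. Re (frm p lam (comb V c) (comb V c)) \<le> - \<epsilon> * (n2 (comb V c))\<^sup>2"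
proof (cases "V = {}")
  case True
  have "frm p lam (\<lambda>x. 0) (\<lambda>x. 0) = 0" "n2 (\<lambda>x. 0) = 0"
    by (simp_all add: frm_def ip_def bf_def n2_def)
  then show ?thesis using True by (intro exI[of _ 1]) (simp add: comb_def)
next
  case False
  have fV: "finite V" "V \<subseteq> X0" and neg: "\<forall>v\<in>V. Re (frm p lam v v) < 0"
    using V by (auto simp: negset_def)
  have "finite ((\<lambda>v. - Re (frm p lam v v)) ` V)" "(\<lambda>v. - Re (frm p lam v v)) ` V \<noteq> {}"
    using fV False by auto
  then obtain \<mu> where \<mu>: "\<mu> > 0" "\<And>v. v \<in> V \<Longrightarrow> \<mu> \<le> - Re (frm p lam v v)"
    using neg by (metis (no_types, lifting) Min_in Min_le imageE imageI neg_0_less_iff_less)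
  define C where "C = (\<Sum>v\<in>V. (n2 v)\<^sup>2) + 1"
  have "(\<Sum>v\<in>V. (n2 v)\<^sup>2) \<ge> 0" by (intro sum_nonneg) auto
  then have C: "C > 0" by (simp add: C_def)
  show ?thesis
  proof (intro exI[of _ "\<mu> / C"] conjI allI)
    show "0 < \<mu> / C" using \<mu> C by simp
    fix c
    define u where "u = comb V c"
    define S where "S = (\<Sum>v\<in>V. (norm (c v))\<^sup>2)"
    have u: "u \<in> X0" unfolding u_def by (rule comb_mem[OF X0_lincl fV])
    \<comment> \<open>At parameter 0 the form is \<open>ip\<close> itself, so
      \<open>herm_comb_left\<close> expands the inner product.\<close>
    have "of_real ((n2 u)\<^sup>2) = (\<Sum>v\<in>V. c v * ip v u)"
      using herm_comb_left[OF herm_frm[of 0] fV u, of c] unfolding u_def[symmetric] frm_def ip_self by simp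
    then have "(n2 u)\<^sup>2 = norm (\<Sum>v\<in>V. c v * ip v u)" by (metis norm_of_real abs_power2)
    also have "\<dots> \<le> (\<Sum>v\<in>V. norm (c v) * (n2 v * n2 u))"
      using fV u by (intro sum_norm_le) (auto simp: norm_mult intro!: mult_left_mono ip_bound X1_l2 X0_X1)
    also have "\<dots> = (\<Sum>v\<in>V. norm (c v) * n2 v) * n2 u" by (simp add: sum_distrib_right mult.assoc)
    finally have "n2 u \<le> (\<Sum>v\<in>V. norm (c v) * n2 v)"
      by (cases "n2 u = 0") (auto simp: power2_eq_square sum_nonneg n2_nonneg less_le)
    then have "(n2 u)\<^sup>2 \<le> (\<Sum>v\<in>V. norm (c v) * n2 v)\<^sup>2" by (intro power_mono) (auto simp: n2_nonneg)
    also have "\<dots> \<le> S * (\<Sum>v\<in>V. (n2 v)\<^sup>2)" unfolding S_def by (rule Cauchy_Schwarz_ineq_sum)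
    also have "\<dots> \<le> S * C" unfolding C_def S_def by (intro mult_left_mono) (auto intro: sum_nonneg)
    finally have le: "(n2 u)\<^sup>2 \<le> S * C" .
    have "Re (frm p lam u u) = (\<Sum>v\<in>V. (norm (c v))\<^sup>2 * Re (frm p lam v v))"
      unfolding u_def by (rule negset_comb[OF herm_frm V])
    also have "\<dots> \<le> (\<Sum>v\<in>V. (norm (c v))\<^sup>2 * (- \<mu>))"
      using \<mu>(2) by (intro sum_mono mult_left_mono) force+
    also have "\<dots> = - \<mu> * S" unfolding S_def by (simp add: sum_distrib_left sum_negf mult.commute)
    also have "\<dots> \<le> - \<mu> / C * (n2 u)\<^sup>2"
      using le \<mu>(1) C by (simp add: field_simps)
    finally show "Re (frm p lam (comb V c) (comb V c)) \<le> - (\<mu> / C) * (n2 (comb V c))\<^sup>2"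
      unfolding u_def by simp
  qed
qed

text \<open>If a family is negative with margin \<open>\<epsilon>\<close> at \<open>lam\<close>, the
  weight term on its span is at most \<open>- (1 + \<epsilon>)\<close> times the squared norm. It
  therefore stays negative at \<open>s * lam\<close> for \<open>s > 1 / (1 + \<epsilon>)\<close>,
  and the index does not drop at once when \<open>\<bar>lam\<bar>\<close> decreases.\<close>

lemma Nf_left_continuous:
  assumes b: "\<And>lam. \<exists>m. negbound X0 (frm p lam) m"
  shows "\<exists>s0<1. \<forall>s. s0 < s \<longrightarrow> s \<le> 1 \<longrightarrow> Nf lam \<le> Nf (s * lam)"
proof -
  obtain m where m: "negbound X0 (frm p lam) m" using b by blast
  obtain V where V: "negset X0 (frm p lam) V" "card V = Nf lam"
    using nind_attained[OF m] unfolding Nf_def by metis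
  obtain \<epsilon> where \<epsilon>: "\<epsilon> > 0" "\<And>c. Re (frm p lam (comb V c) (comb V c)) \<le> - \<epsilon> * (n2 (comb V c))\<^sup>2"
    using negset_uniform[OF V(1)] by blast
  have fV: "finite V" "V \<subseteq> X0" using V(1) by (auto simp: negset_def)
  have "Nf lam \<le> Nf (s * lam)" if s: "1 / (1 + \<epsilon>) < s" "s \<le> 1" for s
  proof (rule ccontr)
    assume "\<not> Nf lam \<le> Nf (s * lam)"
    moreover obtain m' where m': "negbound X0 (frm p (s * lam)) m'" using b by blast
    then obtain W where W: "negset X0 (frm p (s * lam)) W" "card W = Nf (s * lam)"
      and max: "\<And>g. g \<in> X0 \<Longrightarrow> (\<And>v. v \<in> W \<Longrightarrow> frm p (s * lam) g v = 0) \<Longrightarrow> Re (frm p (s * lam) g g) \<ge> 0"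
      using nind_maximal[OF herm_frm m'] unfolding Nf_def by metis
    moreover have fW: "finite W" "W \<subseteq> X0" using W(1) by (auto simp: negset_def)
    ultimately have "card W < card V" using V(2) by simp
    then obtain c where c: "\<exists>v\<in>V. c v \<noteq> 0" "\<forall>w\<in>W. (\<Sum>v\<in>V. c v * frm p (s * lam) v w) = 0"
      using linear_system_nontrivial[OF fW(1) fV(1), of "\<lambda>w v. frm p (s * lam) v w"] by blast
    define u where "u = comb V c"
    have u: "u \<in> X0" unfolding u_def by (rule comb_mem[OF X0_lincl fV])
    have "0 \<le> Re (frm p (s * lam) u u)"
    proof (rule max[OF u])
      fix w assume "w \<in> W"
      then show "frm p (s * lam) u w = 0"
        using herm_comb_left[OF herm_frm fV, of w "s * lam" c] c(2) fW(2) unfolding u_def by auto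
    qed
    then have 1: "0 \<le> (n2 u)\<^sup>2 + s * (lam * Re (bf p u u))" unfolding frm_self by (simp add: mult.assoc)
    have 2: "(n2 u)\<^sup>2 + lam * Re (bf p u u) \<le> - \<epsilon> * (n2 u)\<^sup>2"
      using \<epsilon>(2)[of c] unfolding u_def frm_self .
    have 3: "(n2 u)\<^sup>2 + lam * Re (bf p u u) < 0"
      using negset_comb_neg[OF herm_frm V(1) c(1)] unfolding u_def frm_self .
    have "0 < 1 / (1 + \<epsilon>)" using \<epsilon>(1) by simp
    then have s0: "s > 0" "s * (1 + \<epsilon>) > 1" using s(1) \<epsilon>(1) by (linarith, simp add: field_simps)
    have "lam * Re (bf p u u) \<le> - (1 + \<epsilon>) * (n2 u)\<^sup>2" using 2 by (simp add: algebra_simps)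
    then have "s * (lam * Re (bf p u u)) \<le> s * (- (1 + \<epsilon>) * (n2 u)\<^sup>2)" using s0 by (intro mult_left_mono) auto
    then have "0 \<le> (1 - s * (1 + \<epsilon>)) * (n2 u)\<^sup>2" using 1 by (simp add: algebra_simps)
    then have "(n2 u)\<^sup>2 \<le> 0" using s0 by (simp add: zero_le_mult_iff)
    then have "n2 u = 0" by simp
    moreover have "norm (bf p u u) \<le> 0" using bf_bound[OF X0_X1[OF u] X0_X1[OF u]] \<open>n2 u = 0\<close> by simp
    ultimately show False using 3 by simp
  qed
  moreover have "1 / (1 + \<epsilon>) < 1" using \<epsilon> by simp
  ultimately show ?thesis by blast
qed

end

section \<open>Cells\<close>

text \<open>The factor is that of the chain rule: with it, \<open>prim (emb al a g)\<close> is
  \<open>prim g\<close> composed with the affine map. \<open>res\<close> goes the other way, from a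
  cell to the unit interval.\<close>

definition emb :: "real \<Rightarrow> real \<Rightarrow> cfn \<Rightarrow> cfn" where
  "emb al a g = (\<lambda>x. g ((x - al) / a) / of_real a)"

definition res :: "real \<Rightarrow> real \<Rightarrow> cfn \<Rightarrow> cfn" where
  "res al a u = (\<lambda>x. if 0 < x \<and> x \<le> 1 then of_real a * u (al + a * x) else 0)"

lemma affine_integral:
  fixes f :: cfn
  assumes "a > 0"
  shows "(LINT x|lborel. f x) = of_real a * (LINT x|lborel. f (al + a * x))"
  using lborel_integral_real_affine[of a f al] assms by (simp add: scaleR_conv_of_real)

lemma affine_l2:
  assumes u: "u \<in> l2" and a: "a \<noteq> 0"
  shows "(\<lambda>x. u (al + a * x)) \<in> l2"
  using lborel_integrable_real_affine[OF l2_integrable[OF u] a, of al] l2_measurable[OF u]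
  by (auto simp: l2_def)

lemma emb_X1:
  assumes g: "g \<in> X1" and a: "a > 0" "0 \<le> al" "al + a \<le> 1"
  shows "emb al a g \<in> X1"
proof -
  have "(\<lambda>x. g (- al / a + (1 / a) * x)) \<in> l2" by (rule affine_l2[OF X1_l2[OF g]]) (use a in simp)
  then have "(\<lambda>x. g ((x - al) / a)) \<in> l2" by (simp add: diff_divide_distrib add.commute)
  then have "emb al a g \<in> l2"
    by (rule l2_dominated[where C = "1 / a"])
      (use a X1_measurable[OF g] in \<open>auto simp: emb_def norm_divide\<close>)
  moreover have "emb al a g x = 0" if "x \<notin> {0<..1}" for x
  proof -
    have "(x - al) / a \<notin> {0<..1}" using that a by (auto simp: field_simps)
    then show ?thesis using X1_outside[OF g] unfolding emb_def by simp
  qed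
  ultimately show ?thesis by (simp add: X1_def)
qed

lemma emb_affine: "a > 0 \<Longrightarrow> emb al a g (al + a * x) = g x / of_real a"
  by (simp add: emb_def)

lemma prim_emb:
  assumes "a > 0"
  shows "prim (emb al a g) x = prim g ((x - al) / a)"
proof -
  have "prim (emb al a g) x = of_real a * (LINT s|lborel. (if al + a * s \<le> x then emb al a g (al + a * s) else 0))"
    unfolding prim_def by (rule affine_integral[OF assms])
  also have "\<dots> = (LINT s|lborel. of_real a * (if al + a * s \<le> x then emb al a g (al + a * s) else 0))"
    by simp
  also have "\<dots> = prim g ((x - al) / a)"
    unfolding prim_def
  proof (intro Bochner_Integration.integral_cong refl)
    fix s
    have "of_real a * emb al a g (al + a * s) = g s" using assms by (simp add: emb_affine)
    moreover have "al + a * s \<le> x \<longleftrightarrow> s \<le> (x - al) / a" using assms by (simp add: field_simps)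
    ultimately show "of_real a * (if al + a * s \<le> x then emb al a g (al + a * s) else 0) =
      (if s \<le> (x - al) / a then g s else 0)" by simp
  qed
  finally show ?thesis .
qed

lemma emb_X0:
  assumes g: "g \<in> X0" and a: "a > 0" "0 \<le> al" "al + a \<le> 1"
  shows "emb al a g \<in> X0"
proof -
  have 1: "emb al a g \<in> X1" by (rule emb_X1[OF X0_X1[OF g] a])
  have "(LINT x|lborel. emb al a g x) = prim (emb al a g) 1" by (rule prim_ge_1[OF 1, symmetric]) simp
  also have "\<dots> = 0" unfolding prim_emb[OF a(1)] by (rule prim_X0_ge_1[OF g]) (use a in \<open>simp add: field_simps\<close>)
  finally show ?thesis using 1 by (simp add: X0_def)
qed

lemma ip_emb: "a > 0 \<Longrightarrow> ip (emb al a g) (emb al a h) = ip g h / of_real a"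
  unfolding ip_def
  by (subst affine_integral[of a _ al]) (simp_all add: emb_affine)

lemma emb_support: "g \<in> X1 \<Longrightarrow> a > 0 \<Longrightarrow> \<not> (al < x \<and> x \<le> al + a) \<Longrightarrow> emb al a g x = 0"
  unfolding emb_def by (subst X1_outside) (auto simp: field_simps)

lemma prim_emb_support:
  assumes g: "g \<in> X0" and a: "a > 0" and x: "\<not> (al < x \<and> x < al + a)"
  shows "prim (emb al a g) x = 0"
proof -
  have "(x - al) / a \<le> 0 \<or> (x - al) / a \<ge> 1" using x a by (auto simp: field_simps)
  then show ?thesis unfolding prim_emb[OF a] using prim_le_0[OF X0_X1[OF g]] prim_X0_ge_1[OF g] by blast
qed

text \<open>Locality: an embedded element and its primitive both vanish off its cell, the primitive
  because elements of \<open>X0\<close> have zero mean.\<close>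

lemma frm_emb_disjoint:
  assumes g: "g \<in> X0" and h: "h \<in> X0" and a: "a > 0" and a': "a' > 0"
    and disj: "al + a \<le> al' \<or> al' + a' \<le> al"
  shows "frm p lam (emb al a g) (emb al' a' h) = 0"
proof -
  have sep: "\<not> (al < x \<and> x \<le> al + a) \<or> \<not> (al' < x \<and> x \<le> al' + a')" for x using disj by linarith
  have "emb al a g x = 0 \<or> (emb al' a' h x = 0 \<and> prim (emb al' a' h) x = 0)"
    "emb al' a' h x = 0 \<or> (emb al a g x = 0 \<and> prim (emb al a g) x = 0)" for x
    using emb_support[OF X0_X1[OF g] a, of al x] emb_support[OF X0_X1[OF h] a', of al' x]
      prim_emb_support[OF g a, of al x] prim_emb_support[OF h a', of al' x] sep[of x] by auto
  then have z: "emb al a g x * cnj (emb al' a' h x) = 0"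
    "emb al a g x * cnj (prim (emb al' a' h) x) + prim (emb al a g) x * cnj (emb al' a' h x) = 0" for x
    by (smt (verit) add.right_neutral complex_cnj_zero mult_zero_left mult_zero_right)+
  show ?thesis unfolding frm_def ip_def bf_def z by simp
qed

lemma res_X1:
  assumes u: "u \<in> l2" and a: "a > 0"
  shows "res al a u \<in> X1"
proof -
  have "(\<lambda>x. u (al + a * x)) \<in> l2" by (rule affine_l2[OF u]) (use a in simp)
  then have "res al a u \<in> l2"
    by (rule l2_dominated[where C = a]) (use a l2_measurable[OF u] in \<open>auto simp: res_def norm_mult\<close>)
  then show ?thesis by (auto simp: X1_def res_def)
qed

lemma emb_res: "a > 0 \<Longrightarrow> emb al a (res al a u) = cut al (al + a) u"
  by (auto simp: emb_def res_def cut_def fun_eq_iff field_simps)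

lemma res_X0:
  assumes u: "u \<in> X1" and a: "a > 0" and eq: "prim u (al + a) = prim u al"
  shows "res al a u \<in> X0"
proof -
  have 1: "res al a u \<in> X1" by (rule res_X1[OF X1_l2[OF u] a])
  have "(LINT x|lborel. res al a u x) = prim (res al a u) 1" by (rule prim_ge_1[OF 1, symmetric]) simp
  also have "\<dots> = prim (emb al a (res al a u)) (al + a)" unfolding prim_emb[OF a] using a by simp
  also have "\<dots> = (LINT x|lborel. cut al (al + a) u x)"
    unfolding emb_res[OF a] prim_def
    by (intro Bochner_Integration.integral_cong) (auto simp: cut_def)
  also have "\<dots> = 0" using prim_diff[OF u, of al "al + a"] a eq by simp
  finally show ?thesis using 1 by (simp add: X0_def)
qed

lemma linf_sum:
  assumes "lincl X" "linf X \<phi>" "finite K" "\<And>k. k \<in> K \<Longrightarrow> f k \<in> X"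
  shows "(\<lambda>x. \<Sum>k\<in>K. f k x) \<in> X \<and> \<phi> (\<lambda>x. \<Sum>k\<in>K. f k x) = (\<Sum>k\<in>K. \<phi> (f k))"
  using assms(3,4)
proof (induction K rule: finite_induct)
  case empty
  then show ?case using comb_mem_and_linf[OF assms(1), of "{}" "\<lambda>_. 0"] assms(2) by (simp add: comb_def)
next
  case (insert k K)
  have k: "f k \<in> X" and K: "(\<lambda>x. \<Sum>k\<in>K. f k x) \<in> X" using insert by auto
  have "(\<lambda>x. 1 * f k x + (\<Sum>k\<in>K. f k x)) \<in> X" 
    using assms(1)[unfolded lincl_def, THEN conjunct2, rule_format, OF k K, of 1] by simp
  moreover have "\<phi> (\<lambda>x. 1 * f k x + (\<Sum>k\<in>K. f k x)) = 1 * \<phi> (f k) + \<phi> (\<lambda>x. \<Sum>k\<in>K. f k x)"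
    using assms(2)[unfolded linf_def, rule_format, OF k K, of 1] by simp
  ultimately show ?case using insert by simp
qed

lemma herm_orthogonal_sum:
  assumes h: "herm X q" and K: "finite K" "\<And>k. k \<in> K \<Longrightarrow> f k \<in> X"
    and orth: "\<And>j k. j \<in> K \<Longrightarrow> k \<in> K \<Longrightarrow> j \<noteq> k \<Longrightarrow> q (f j) (f k) = 0"
  shows "q (\<lambda>x. \<Sum>k\<in>K. f k x) (\<lambda>x. \<Sum>k\<in>K. f k x) = (\<Sum>k\<in>K. q (f k) (f k))"
proof -
  define u where "u = (\<lambda>x. \<Sum>k\<in>K. f k x)"
  have sum: "q u z = (\<Sum>k\<in>K. q (f k) z)" if "z \<in> X" for z
    unfolding u_def using linf_sum[OF herm_lincl[OF h] herm_linf[OF h that] K] by simp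
  have u: "u \<in> X" if ne: "K \<noteq> {}"
  proof -
    obtain k where k: "k \<in> K" using ne by blast
    then show ?thesis
      unfolding u_def using linf_sum[OF herm_lincl[OF h] herm_linf[OF h K(2)[OF k]] K(1), of f] K(2) by blast
  qed
  have "q (f k) u = q (f k) (f k)" if k: "k \<in> K" for k
  proof -
    have "q u (f k) = (\<Sum>j\<in>{k}. q (f j) (f k))"
      unfolding sum[OF K(2)[OF k]] by (rule sum.mono_neutral_right) (use K k orth in auto)
    moreover have "q (f k) u = cnj (q u (f k))" using herm_sym[OF h _ K(2)[OF k], of u] u k by blast
    moreover have "q (f k) (f k) = cnj (q (f k) (f k))" by (rule herm_sym[OF h K(2)[OF k] K(2)[OF k]])
    ultimately show ?thesis by simp
  qed
  then have "q u u = (\<Sum>k\<in>K. q (f k) (f k))" if "K \<noteq> {}" using sum[OF u[OF that]] by simp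
  moreover have "q u u = 0" if "K = {}"
  proof -
    have "(\<lambda>x. 0) \<in> X" using herm_lincl[OF h] by (simp add: lincl_def)
    then have "linf X (\<lambda>v. q v (\<lambda>x. 0))" using herm_linf[OF h] by blast
    then show ?thesis using linf_sum[OF herm_lincl[OF h], of "\<lambda>v. q v (\<lambda>x. 0)" K f] that
      unfolding u_def by simp
  qed
  ultimately show ?thesis unfolding u_def by (cases "K = {}") auto
qed

section \<open>The partition into cells and the splitting of the form\<close>

locale cells =
  fixes n :: nat and a :: "nat \<Rightarrow> real"
  assumes n: "n \<ge> 1" and a_pos: "\<And>k. k \<in> {1..n} \<Longrightarrow> a k > 0" and a_sum: "(\<Sum>k=1..n. a k) = 1"
begin

lemma alpha_1: "alpha a (Suc 0) = 0"
  by (simp add: alpha_def)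

lemma alpha_Suc: "k \<ge> 1 \<Longrightarrow> alpha a (Suc k) = alpha a k + a k"
  by (simp add: alpha_def)

lemma alpha_mono: "1 \<le> j \<Longrightarrow> j \<le> k \<Longrightarrow> k \<le> Suc n \<Longrightarrow> alpha a j \<le> alpha a k"
  unfolding alpha_def using a_pos by (intro sum_mono2) (auto simp: less_imp_le)

lemma alpha_last: "alpha a (Suc n) = 1"
  using a_sum by (simp add: alpha_def atLeastLessThanSuc_atLeastAtMost)

lemma cell:
  assumes "k \<in> {1..n}"
  shows "a k > 0" "0 \<le> alpha a k" "alpha a k + a k \<le> 1"
  using a_pos[OF assms] alpha_mono[of 1 k] alpha_mono[of "Suc k" "Suc n"] alpha_1 alpha_last
    alpha_Suc[of k] assms by auto

lemma cells_disjoint: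
  assumes "j \<in> {1..n}" "k \<in> {1..n}" "j \<noteq> k"
  shows "alpha a j + a j \<le> alpha a k \<or> alpha a k + a k \<le> alpha a j"
proof (cases "j < k")
  case True
  then show ?thesis using alpha_mono[of "Suc j" k] alpha_Suc[of j] assms by auto
next
  case False
  then show ?thesis using alpha_mono[of "Suc k" j] alpha_Suc[of k] assms by auto
qed

lemma cut_cells:
  assumes u: "\<And>x. x \<notin> {0<..1} \<Longrightarrow> u x = 0"
  shows "(\<Sum>k=1..n. cut (alpha a k) (alpha a k + a k) u x) = u x"
proof -
  have "(\<Sum>k=1..m. cut (alpha a k) (alpha a k + a k) u x) = cut 0 (alpha a (Suc m)) u x" if "m \<le> n" for m
    using that
  proof (induction m)
    case 0
    then show ?case using alpha_1 by (auto simp: cut_def)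
  next
    case (Suc m)
    then show ?case
      using alpha_mono[of 1 "Suc m"] alpha_mono[of "Suc m" "Suc (Suc m)"] alpha_1 alpha_Suc[of "Suc m"]
      by (auto simp: cut_def)
  qed
  from this[of n] show ?thesis using u[of x] alpha_last by (auto simp: cut_def)
qed

end

text \<open>\<open>p_sim\<close> is the fixed-point equation of the similarity operator pulled back
  to one cell.\<close>

locale self_sim_weight = weight + cells +
  fixes d \<beta> :: "nat \<Rightarrow> real"
  assumes contract: "\<And>k. k \<in> {1..n} \<Longrightarrow> a k * \<bar>d k\<bar> < 1"
    and p_sim: "\<And>k. k \<in> {1..n} \<Longrightarrow>
      AE x in lborel. 0 < x \<and> x < 1 \<longrightarrow> p (alpha a k + a k * x) = of_real (\<beta> k) + of_real (d k) * p x"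
begin

lemma bf_emb:
  assumes k: "k \<in> {1..n}" and g: "g \<in> X0" and h: "h \<in> X0"
  shows "bf p (emb (alpha a k) (a k) g) (emb (alpha a k) (a k) h) = of_real (d k) * bf p g h"
proof -
  note a = cell[OF k]
  have g1: "g \<in> X1" and h1: "h \<in> X1" using g h by (auto intro: X0_X1)
  have [measurable]: "p \<in> borel_measurable borel" "g \<in> borel_measurable borel" "h \<in> borel_measurable borel"
    "prim g \<in> borel_measurable borel" "prim h \<in> borel_measurable borel"
    using p_l2 g1 h1 by (auto intro: l2_measurable X1_measurable prim_measurable)
  define w where "w x = g x * cnj (prim h x) + prim g x * cnj (h x)" for x
  have [measurable]: "w \<in> borel_measurable borel" unfolding w_def[abs_def] by measurable
  have "bf p (emb (alpha a k) (a k) g) (emb (alpha a k) (a k) h) = (LINT x|lborel. p (alpha a k + a k * x) * w x)"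
  proof -
    have eq: "p (alpha a k + a k * x) *
      (emb (alpha a k) (a k) g (alpha a k + a k * x) * cnj (prim (emb (alpha a k) (a k) h) (alpha a k + a k * x)) +
       prim (emb (alpha a k) (a k) g) (alpha a k + a k * x) * cnj (emb (alpha a k) (a k) h (alpha a k + a k * x))) =
      p (alpha a k + a k * x) * w x / of_real (a k)" for x
      using a(1) by (simp add: emb_affine prim_emb w_def distrib_left add_divide_distrib)
    show ?thesis unfolding bf_def
      by (rule trans[OF affine_integral[OF a(1), of _ "alpha a k"]]) (unfold eq, use a(1) in simp)
  qed
  also have "\<dots> = (LINT x|lborel. of_real (\<beta> k) * w x + of_real (d k) * (p x * w x))"
  proof (intro integral_cong_AE)
    show "AE x in lborel. p (alpha a k + a k * x) * w x = of_real (\<beta> k) * w x + of_real (d k) * (p x * w x)"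
      \<comment> \<open>The point 1 belongs to the half-open support but not to the range of
        \<open>p_sim\<close>, so it is removed as a null set.\<close>
      using p_sim[OF k] AE_lborel_singleton[of 1]
    proof eventually_elim
      case (elim x)
      show ?case
      proof (cases "0 < x \<and> x < 1")
        case True
        then show ?thesis using elim by (simp add: algebra_simps)
      next
        case False
        then have "w x = 0" using elim X1_outside[OF g1, of x] X1_outside[OF h1, of x] unfolding w_def by auto
        then show ?thesis by simp
      qed
    qed
  qed measurable
  also have "\<dots> = of_real (\<beta> k) * (LINT x|lborel. w x) + of_real (d k) * bf p g h"
  proof -
    have "integrable lborel (\<lambda>x. p x * w x)"
      unfolding w_def distrib_left using bf_parts(1,2)[OF g1 h1] by (rule Bochner_Integration.integrable_add)
    moreover have "integrable lborel w" unfolding w_def[abs_def]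
    proof (rule Bochner_Integration.integrable_add)
      show "integrable lborel (\<lambda>x. g x * cnj (prim h x))"
        by (rule bounded_mult_integrable[OF X1_integrable[OF g1], where C = "n2 h"])
          (use prim_bound[OF h1] in auto)
      show "integrable lborel (\<lambda>x. prim g x * cnj (h x))"
        using bounded_mult_integrable[OF X1_integrable[OF cnj_X1[OF h1]], of "prim g" "n2 g"] prim_bound[OF g1]
        by (auto simp: mult.commute)
    qed
    ultimately show ?thesis unfolding bf_def w_def[symmetric] by simp
  qed
  also have "(LINT x|lborel. w x) = 0"
    using integral_product_rule[OF g1 cnj_X1[OF h1]] g unfolding w_def prim_cnj X0_def by simp
  finally show ?thesis by simp
qed

text \<open>The Dirichlet term scales by \<open>1 / a k\<close> and the weight term by
  \<open>d k\<close>; factoring out the positive number \<open>1 / a k\<close> leaves the form at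
  \<open>lam * (a k * d k)\<close>.\<close>

lemma frm_emb:
  assumes k: "k \<in> {1..n}" and g: "g \<in> X0" and h: "h \<in> X0"
  shows "frm p lam (emb (alpha a k) (a k) g) (emb (alpha a k) (a k) h) =
    of_real (1 / a k) * frm p (lam * (a k * d k)) g h"
  unfolding frm_def bf_emb[OF assms] ip_emb[OF cell(1)[OF k]] using cell(1)[OF k] by (simp add: field_simps)

lemma frm_cells:
  assumes u: "u \<in> X0" and nodes: "\<And>k. k \<in> {2..n} \<Longrightarrow> prim u (alpha a k) = 0"
  shows "\<And>k. k \<in> {1..n} \<Longrightarrow> res (alpha a k) (a k) u \<in> X0"
    "frm p lam u u = (\<Sum>k=1..n. of_real (1 / a k) *
      frm p (lam * (a k * d k)) (res (alpha a k) (a k) u) (res (alpha a k) (a k) u))"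
proof -
  have u1: "u \<in> X1" using u by (rule X0_X1)
  have node: "prim u (alpha a k) = 0" if k: "k \<in> {1..Suc n}" for k
  proof -
    consider "k = 1" | "k = Suc n" | "k \<in> {2..n}" using k by fastforce
    then show ?thesis
    proof cases
      case 1 then show ?thesis using alpha_1 prim_le_0[OF u1] by simp
    next
      case 2 then show ?thesis using alpha_last prim_X0_ge_1[OF u] by simp
    qed (use nodes in auto)
  qed
  show res: "res (alpha a k) (a k) u \<in> X0" if k: "k \<in> {1..n}" for k
  proof (rule res_X0[OF u1 cell(1)[OF k]])
    show "prim u (alpha a k + a k) = prim u (alpha a k)"
      using node[of k] node[of "Suc k"] alpha_Suc[of k] k by auto
  qed
  define f where "f k = emb (alpha a k) (a k) (res (alpha a k) (a k) u)" for k
  have "f k = cut (alpha a k) (alpha a k + a k) u" if "k \<in> {1..n}" for k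
    unfolding f_def by (rule emb_res[OF cell(1)[OF that]])
  then have "u = (\<lambda>x. \<Sum>k=1..n. f k x)" using cut_cells[of u, OF X1_outside[OF u1]] by (simp add: fun_eq_iff)
  then have "frm p lam u u = frm p lam (\<lambda>x. \<Sum>k=1..n. f k x) (\<lambda>x. \<Sum>k=1..n. f k x)" by simp
  also have "\<dots> = (\<Sum>k=1..n. frm p lam (f k) (f k))"
  proof (rule herm_orthogonal_sum[OF herm_frm])
    show "f k \<in> X0" if "k \<in> {1..n}" for k unfolding f_def by (rule emb_X0[OF res[OF that] cell[OF that]])
    show "frm p lam (f j) (f k) = 0" if "j \<in> {1..n}" "k \<in> {1..n}" "j \<noteq> k" for j k
      unfolding f_def
      by (rule frm_emb_disjoint[OF res[OF that(1)] res[OF that(2)] cell(1)[OF that(1)] cell(1)[OF that(2)] cells_disjoint[OF that]])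
  qed simp
  also have "\<dots> = (\<Sum>k=1..n. of_real (1 / a k) *
      frm p (lam * (a k * d k)) (res (alpha a k) (a k) u) (res (alpha a k) (a k) u))"
    unfolding f_def by (intro sum.cong refl frm_emb res)
  finally show "frm p lam u u = (\<Sum>k=1..n. of_real (1 / a k) *
      frm p (lam * (a k * d k)) (res (alpha a k) (a k) u) (res (alpha a k) (a k) u))" .
qed

text \<open>Vanishing at the inner nodes costs \<open>n - 1\<close> functionals. Orthogonality of
  each rescaled restriction to a maximal family of its cell costs the indices of the cells. On the
  common kernel every summand of the split form is nonnegative.\<close>

lemma negbound_cells:
  assumes b: "\<And>k. k \<in> {1..n} \<Longrightarrow> \<exists>m. negbound X0 (frm p (lam * (a k * d k))) m"
  shows "negbound X0 (frm p lam) ((\<Sum>k=1..n. Nf (lam * (a k * d k))) + (n - 1))"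
proof -
  have "\<forall>k\<in>{1..n}. \<exists>V. negset X0 (frm p (lam * (a k * d k))) V \<and> card V = Nf (lam * (a k * d k)) \<and>
    (\<forall>g\<in>X0. (\<forall>v\<in>V. frm p (lam * (a k * d k)) g v = 0) \<longrightarrow> Re (frm p (lam * (a k * d k)) g g) \<ge> 0)"
  proof
    fix k assume "k \<in> {1..n}"
    then obtain m where m: "negbound X0 (frm p (lam * (a k * d k))) m" using b by blast
    show "\<exists>V. negset X0 (frm p (lam * (a k * d k))) V \<and> card V = Nf (lam * (a k * d k)) \<and>
      (\<forall>g\<in>X0. (\<forall>v\<in>V. frm p (lam * (a k * d k)) g v = 0) \<longrightarrow> Re (frm p (lam * (a k * d k)) g g) \<ge> 0)"
      using nind_maximal[OF herm_frm m] unfolding Nf_def by metis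
  qed
  then obtain V where V: "\<And>k. k \<in> {1..n} \<Longrightarrow> negset X0 (frm p (lam * (a k * d k))) (V k)"
    "\<And>k. k \<in> {1..n} \<Longrightarrow> card (V k) = Nf (lam * (a k * d k))"
    and max: "\<And>k g. k \<in> {1..n} \<Longrightarrow> g \<in> X0 \<Longrightarrow> (\<And>v. v \<in> V k \<Longrightarrow> frm p (lam * (a k * d k)) g v = 0) \<Longrightarrow>
      Re (frm p (lam * (a k * d k)) g g) \<ge> 0"
    by metis
  have fV: "finite (V k)" "V k \<subseteq> X0" if "k \<in> {1..n}" for k using V(1)[OF that] by (auto simp: negset_def)
  define J1 where "J1 k = (\<lambda>v u. frm p (lam * (a k * d k)) (res (alpha a k) (a k) u) v) ` V k" for k
  define J2 where "J2 = (\<lambda>k u. prim u (alpha a k)) ` {2..n}"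
  define J where "J = (\<Union>k\<in>{1..n}. J1 k) \<union> J2"
  have fin: "finite J" using fV unfolding J_def J1_def J2_def by simp
  have "negbound X0 (frm p lam) (card J)"
  proof (rule negbound_functionals[OF herm_frm fin])
    fix \<phi> assume "\<phi> \<in> J"
    then consider (1) k v where "k \<in> {1..n}" "v \<in> V k" "\<phi> = (\<lambda>u. frm p (lam * (a k * d k)) (res (alpha a k) (a k) u) v)"
      | (2) k where "\<phi> = (\<lambda>u. prim u (alpha a k))"
      unfolding J_def J1_def J2_def by blast
    then show "linf X0 \<phi>"
    proof cases
      case 1
      have v: "v \<in> X1" using fV 1 X0_X1 by blast
      have lin: "res (alpha a k) (a k) (\<lambda>x. c * u x + w x) =
        (\<lambda>x. c * res (alpha a k) (a k) u x + res (alpha a k) (a k) w x)" for c u w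
        by (auto simp: res_def fun_eq_iff algebra_simps)
      \<comment> \<open>Without the node conditions a restriction need not have zero mean, so
        linearity of these functionals is taken from the form on \<open>X1\<close>.\<close>
      have "res (alpha a k) (a k) u \<in> X1" if "u \<in> X0" for u
        using res_X1[OF X1_l2[OF X0_X1[OF that]] cell(1)[OF 1(1)]] .
      then show ?thesis
        unfolding 1(3) linf_def lin using herm_left[OF herm_frm_X1 _ _ v] by blast
    next
      case 2
      then show ?thesis unfolding linf_def using prim_lin X1_integrable X0_X1 by blast
    qed
  next
    fix u assume u: "u \<in> X0" and z: "\<And>\<phi>. \<phi> \<in> J \<Longrightarrow> \<phi> u = 0"
    have nodes: "prim u (alpha a k) = 0" if "k \<in> {2..n}" for k
      using z[of "\<lambda>u. prim u (alpha a k)"] that unfolding J_def J2_def by blast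
    have orth: "frm p (lam * (a k * d k)) (res (alpha a k) (a k) u) v = 0" if "k \<in> {1..n}" "v \<in> V k" for k v
      using z[of "\<lambda>u. frm p (lam * (a k * d k)) (res (alpha a k) (a k) u) v"] that unfolding J_def J1_def by blast
    show "0 \<le> Re (frm p lam u u)"
    proof -
      have "Re (frm p lam u u) = (\<Sum>k=1..n. 1 / a k *
        Re (frm p (lam * (a k * d k)) (res (alpha a k) (a k) u) (res (alpha a k) (a k) u)))"
        unfolding frm_cells(2)[OF u, OF nodes, simplified] by simp
      also have "\<dots> \<ge> 0"
      proof (intro sum_nonneg mult_nonneg_nonneg)
        fix k assume k: "k \<in> {1..n}"
        show "0 \<le> 1 / a k" using a_pos[OF k] by simp
        have r: "res (alpha a k) (a k) u \<in> X0" using frm_cells(1)[OF u _ k] nodes by blast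
        show "0 \<le> Re (frm p (lam * (a k * d k)) (res (alpha a k) (a k) u) (res (alpha a k) (a k) u))"
          by (rule max[OF k r orth[OF k]])
      qed
      finally show ?thesis .
    qed
  qed
  moreover have "card J \<le> (\<Sum>k=1..n. Nf (lam * (a k * d k))) + (n - 1)"
  proof -
    have "card J \<le> card (\<Union>k\<in>{1..n}. J1 k) + card J2" unfolding J_def by (rule card_Un_le)
    also have "card (\<Union>k\<in>{1..n}. J1 k) \<le> (\<Sum>k=1..n. card (J1 k))" by (rule card_UN_le) simp
    also have "\<dots> \<le> (\<Sum>k=1..n. Nf (lam * (a k * d k)))"
      unfolding J1_def by (intro sum_mono) (metis card_image_le fV(1) V(2))
    also have "card J2 \<le> n - 1" unfolding J2_def using card_image_le[of "{2..n}"] by fastforce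
    finally show ?thesis by simp
  qed
  ultimately show ?thesis unfolding negbound_def by (meson order_trans)
qed

text \<open>Maximal families of the cells, embedded, stay orthogonal and negative within a cell by
  scaling and are orthogonal across cells by locality, so their union is admissible.\<close>

lemma Nf_cells_lower:
  assumes b: "\<And>lam. \<exists>m. negbound X0 (frm p lam) m"
  shows "(\<Sum>k=1..n. Nf (lam * (a k * d k))) \<le> Nf lam"
proof -
  have "\<exists>V. negset X0 (frm p (lam * (a k * d k))) V \<and> card V = Nf (lam * (a k * d k))" for k
    using nind_attained b unfolding Nf_def by metis
  then obtain V where V: "\<And>k. negset X0 (frm p (lam * (a k * d k))) (V k)"
    "\<And>k. card (V k) = Nf (lam * (a k * d k))" by metis
  have fV: "finite (V k)" "V k \<subseteq> X0" for k using V(1)[of k] by (auto simp: negset_def)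
  define E where "E k = emb (alpha a k) (a k)" for k
  define W where "W = (\<Union>k\<in>{1..n}. E k ` V k)"
  have scale: "frm p lam (E k v) (E k w) = of_real (1 / a k) * frm p (lam * (a k * d k)) v w"
    if "k \<in> {1..n}" "v \<in> V k" "w \<in> V k" for k v w
    unfolding E_def using frm_emb[OF that(1)] that fV by blast
  have cross: "frm p lam (E j v) (E k w) = 0" if "j \<in> {1..n}" "k \<in> {1..n}" "j \<noteq> k" "v \<in> V j" "w \<in> V k" for j k v w
    unfolding E_def using that fV cell(1)
    by (intro frm_emb_disjoint[OF _ _ _ _ cells_disjoint[OF that(1-3)]]) auto
  have neg: "Re (frm p lam (E k v) (E k v)) < 0" if "k \<in> {1..n}" "v \<in> V k" for k v
    using scale[OF that(1,2,2)] V(1)[of k] that(2) a_pos[OF that(1)]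
    by (simp add: negset_def divide_neg_pos)
  have W: "negset X0 (frm p lam) W"
    unfolding negset_def
  proof (intro conjI ballI impI)
    show "finite W" using fV by (simp add: W_def)
    show "W \<subseteq> X0" unfolding W_def E_def using emb_X0 cell fV by blast
    show "Re (frm p lam v v) < 0" if "v \<in> W" for v using that neg unfolding W_def by blast
    fix v w assume "v \<in> W" "w \<in> W" "v \<noteq> w"
    then obtain j v' k w' where jk: "j \<in> {1..n}" "v' \<in> V j" "v = E j v'" "k \<in> {1..n}" "w' \<in> V k" "w = E k w'"
      unfolding W_def by blast
    show "frm p lam v w = 0"
    proof (cases "j = k")
      case True
      then have "v' \<noteq> w'" using jk \<open>v \<noteq> w\<close> by auto
      then have "frm p (lam * (a k * d k)) v' w' = 0" using V(1)[of k] jk True by (auto simp: negset_def)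
      then show ?thesis using scale[of k v' w'] jk True by simp
    next
      case False
      then show ?thesis using cross jk by simp
    qed
  qed
  have "card W = (\<Sum>k=1..n. card (E k ` V k))"
    unfolding W_def
  proof (rule card_UN_disjoint)
    show "\<forall>i\<in>{1..n}. \<forall>j\<in>{1..n}. i \<noteq> j \<longrightarrow> E i ` V i \<inter> E j ` V j = {}"
    proof (intro ballI impI, rule ccontr)
      fix i j assume ij: "i \<in> {1..n}" "j \<in> {1..n}" "i \<noteq> j" and "E i ` V i \<inter> E j ` V j \<noteq> {}"
      then obtain v w where "v \<in> V i" "w \<in> V j" "E i v = E j w" by blast
      \<comment> \<open>A common element would be orthogonal to itself and yet negative; the same
        argument gives injectivity of the embeddings below.\<close>
      then show False using cross[OF ij, of v w] neg[OF ij(1), of v] by simp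
    qed
  qed (use fV in auto)
  also have "\<dots> = (\<Sum>k=1..n. Nf (lam * (a k * d k)))"
  proof (intro sum.cong refl)
    fix k assume k: "k \<in> {1..n}"
    have "inj_on (E k) (V k)"
    proof (rule inj_onI, rule ccontr)
      fix v w assume vw: "v \<in> V k" "w \<in> V k" "E k v = E k w" "v \<noteq> w"
      then have "frm p (lam * (a k * d k)) v w = 0" using V(1)[of k] by (auto simp: negset_def)
      then show False using scale[OF k vw(1,2)] neg[OF k vw(1)] vw(3) by simp
    qed
    then show "card (E k ` V k) = Nf (lam * (a k * d k))" using V(2) by (simp add: card_image)
  qed
  finally show ?thesis using card_le_nind W b unfolding Nf_def by metis
qed

lemma negbound_all: "\<exists>m. negbound X0 (frm p lam) m"
proof -
  define \<theta> where "\<theta> = Max ((\<lambda>k. a k * \<bar>d k\<bar>) ` {1..n})"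
  have fin: "finite ((\<lambda>k. a k * \<bar>d k\<bar>) ` {1..n})" "(\<lambda>k. a k * \<bar>d k\<bar>) ` {1..n} \<noteq> {}" using n by auto
  have \<theta>1: "\<theta> < 1" unfolding \<theta>_def using fin contract by simp
  have \<theta>: "a k * \<bar>d k\<bar> \<le> \<theta>" if "k \<in> {1..n}" for k unfolding \<theta>_def using fin that by simp
  have \<theta>0: "\<theta> \<ge> 0" using \<theta>[of 1] n a_pos[of 1] by (auto intro: order_trans[rotated])
  \<comment> \<open>\<open>j\<close> counts the subdivisions after which all parameters have shrunk,
    by at least the factor \<open>\<theta>\<close> each time, into the range of
    \<open>negbound_small\<close>.\<close>
  have main: "\<exists>m. negbound X0 (frm p lam) m" if "2 * (\<bar>lam\<bar> * \<theta> ^ j) * n2 p \<le> 1" for j lam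
    using that
  proof (induction j arbitrary: lam)
    case 0
    then show ?case using negbound_small[of lam] by auto
  next
    case (Suc j)
    have "\<exists>m. negbound X0 (frm p (lam * (a k * d k))) m" if k: "k \<in> {1..n}" for k
    proof (rule Suc.IH)
      have "\<bar>lam * (a k * d k)\<bar> = \<bar>lam\<bar> * (a k * \<bar>d k\<bar>)" using a_pos[OF k] by (simp add: abs_mult)
      also have "\<dots> \<le> \<bar>lam\<bar> * \<theta>" using \<theta>[OF k] by (intro mult_left_mono) auto
      finally have "2 * (\<bar>lam * (a k * d k)\<bar> * \<theta> ^ j) * n2 p \<le> 2 * (\<bar>lam\<bar> * \<theta> * \<theta> ^ j) * n2 p"
        using \<theta>0 n2_nonneg by (intro mult_right_mono mult_left_mono) auto
      then show "2 * (\<bar>lam * (a k * d k)\<bar> * \<theta> ^ j) * n2 p \<le> 1" using Suc.prems by (simp add: mult_ac)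
    qed
    then show ?case using negbound_cells by blast
  qed
  have "(\<lambda>j. 2 * (\<bar>lam\<bar> * \<theta> ^ j) * n2 p) \<longlonglongrightarrow> 2 * (\<bar>lam\<bar> * 0) * n2 p"
    using \<theta>0 \<theta>1 by (intro tendsto_intros LIMSEQ_power_zero) auto
  then have "\<forall>\<^sub>F j in sequentially. 2 * (\<bar>lam\<bar> * \<theta> ^ j) * n2 p < 1" by (intro order_tendstoD) auto
  then obtain j where "2 * (\<bar>lam\<bar> * \<theta> ^ j) * n2 p < 1" unfolding eventually_sequentially by blast
  then show ?thesis using main[of lam j] by simp
qed

lemma Nf_recursion:
  "(\<Sum>k=1..n. Nf (lam * (a k * d k))) \<le> Nf lam"
  "Nf lam \<le> (\<Sum>k=1..n. Nf (lam * (a k * d k))) + (n - 1)"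
  using Nf_cells_lower negbound_all nind_le[OF negbound_cells] unfolding Nf_def by auto

end

section \<open>Unique continuation and the jumps of the index\<close>

lemma n2_triangle:
  assumes f: "f \<in> l2" and g: "g \<in> l2"
  shows "n2 (\<lambda>x. f x + g x) \<le> n2 f + n2 g"
proof (rule power2_le_imp_le)
  show "0 \<le> n2 f + n2 g" by (simp add: n2_nonneg)
  have [measurable]: "f \<in> borel_measurable borel" "g \<in> borel_measurable borel"
    using f g by (auto dest: l2_measurable)
  have "(\<lambda>x. 1 * f x + g x) \<in> l2" using l2_lincl[unfolded lincl_def, THEN conjunct2, rule_format, OF f g] .
  then have fg: "(\<lambda>x. f x + g x) \<in> l2" by simp
  have "(n2 (\<lambda>x. f x + g x))\<^sup>2 \<le>
    (LINT x|lborel. (norm (f x))\<^sup>2 + (norm (g x))\<^sup>2 + 2 * (norm (f x) * norm (g x)))"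
    unfolding n2_sq
  proof (rule integral_mono)
    show "(norm (f x + g x))\<^sup>2 \<le> (norm (f x))\<^sup>2 + (norm (g x))\<^sup>2 + 2 * (norm (f x) * norm (g x))" for x
      using power_mono[OF norm_triangle_ineq[of "f x" "g x"], of 2] by (simp add: power2_sum)
  qed (use l2_integrable[OF fg] l2_integrable[OF f] l2_integrable[OF g] l2_mult_norm_integrable[OF f g] in auto)
  also have "\<dots> = (n2 f)\<^sup>2 + (n2 g)\<^sup>2 + 2 * (LINT x|lborel. norm (f x) * norm (g x))"
    unfolding n2_sq using l2_integrable[OF f] l2_integrable[OF g] l2_mult_norm_integrable[OF f g] by simp
  also have "\<dots> \<le> (n2 f + n2 g)\<^sup>2" using l2_Cauchy_Schwarz[OF f g] by (simp add: power2_sum)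
  finally show "(n2 (\<lambda>x. f x + g x))\<^sup>2 \<le> (n2 f + n2 g)\<^sup>2" .
qed

lemma n2_cut_split:
  assumes u: "u \<in> l2" and "a \<le> b" "b \<le> c"
  shows "n2 (cut a c u) \<le> n2 (cut a b u) + n2 (cut b c u)"
proof -
  have "cut a c u = (\<lambda>x. cut a b u x + cut b c u x)" using assms by (auto simp: cut_def fun_eq_iff)
  then show ?thesis using n2_triangle[OF cut_l2[OF u] cut_l2[OF u], of a b b c] by simp
qed

lemma n2_cut_mono:
  assumes u: "u \<in> l2" and "a' \<le> a" "b \<le> b'"
  shows "n2 (cut a b u) \<le> n2 (cut a' b' u)"
  by (rule n2_mono[OF cut_l2[OF u]]) (use assms cut_l2[OF u] in \<open>auto simp: cut_def dest: l2_measurable\<close>)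

lemma n2_scale: "n2 (\<lambda>x. c * u x) = norm c * n2 u"
  unfolding n2_def by (simp add: norm_mult power_mult_distrib real_sqrt_mult)

lemma ip_cut_self: "ip u (cut a b u) = of_real ((n2 (cut a b u))\<^sup>2)"
  unfolding ip_self[symmetric] unfolding ip_def
  by (intro Bochner_Integration.integral_cong) (auto simp: cut_def)

context weight
begin

text \<open>For a test element \<open>z\<close> whose primitive lives on \<open>(0, c]\<close>, only
  the part of \<open>u\<close> on that interval enters the first term. \<open>M\<close> and
  \<open>M'\<close> collect the smallness of the two primitives.\<close>

lemma bf_estimate:
  assumes u: "u \<in> X1" and z: "z \<in> X1" and M: "M \<ge> 0" and M': "M' \<ge> 0"
    and zero: "\<And>x. c \<le> x \<Longrightarrow> prim z x = 0"
    and pz: "\<And>x. 0 < x \<Longrightarrow> x \<le> c \<Longrightarrow> norm (prim z x) \<le> M"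
    and pu: "\<And>x. z x \<noteq> 0 \<Longrightarrow> norm (prim u x) \<le> M'"
  shows "norm (bf p u z) \<le> n2 p * (M * n2 (cut 0 c u) + M' * n2 z)"
proof -
  have m: "prim u \<in> borel_measurable borel" "prim z \<in> borel_measurable borel"
    using prim_measurable X1_measurable u z by auto
  have m': "(\<lambda>x. cnj (prim z x)) \<in> borel_measurable borel" using m(2) by measurable
  have "(LINT x|lborel. p x * (u x * cnj (prim z x))) = (LINT x|lborel. p x * (cut 0 c u x * cnj (prim z x)))"
  proof (intro Bochner_Integration.integral_cong refl)
    fix x
    have "u x * cnj (prim z x) = cut 0 c u x * cnj (prim z x)"
      using zero[of x] X1_outside[OF u, of x] by (auto simp: cut_def)
    then show "p x * (u x * cnj (prim z x)) = p x * (cut 0 c u x * cnj (prim z x))" by simp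
  qed
  also have "norm \<dots> \<le> M * (n2 p * n2 (cut 0 c u))"
    by (rule l2_triple(2)[OF p_l2 cut_l2[OF X1_l2[OF u]] m' M]) (use pz in \<open>auto simp: cut_def split: if_splits\<close>)
  finally have 1: "norm (LINT x|lborel. p x * (u x * cnj (prim z x))) \<le> M * (n2 p * n2 (cut 0 c u))" .
  have 2: "norm (LINT x|lborel. p x * (prim u x * cnj (z x))) \<le> M' * (n2 p * n2 z)"
    using l2_triple(2)[OF p_l2 cnj_l2[OF X1_l2[OF z]] m(1) M'] pu
    by (simp add: mult.commute n2_cnj)
  show ?thesis
    unfolding bf_parts(3)[OF u z]
    using norm_triangle_ineq[of "LINT x|lborel. p x * (u x * cnj (prim z x))" "LINT x|lborel. p x * (prim u x * cnj (z x))"] 1 2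
    by (simp add: algebra_simps)
qed

text \<open>Since \<open>prim u h = 0\<close>, the truncation \<open>cut 0 h u\<close> has zero mean
  and is an admissible test element. Its inner product with \<open>u\<close> is the squared norm to
  be estimated, and on a short interval the weight term is at most half of it.\<close>

lemma continuation_start:
  assumes u: "u \<in> X0" and h: "0 < h" "h \<le> 1" and uh: "prim u h = 0"
    and small: "2 * (\<bar>lam\<bar> * n2 p) * sqrt h \<le> 1 / 2" and \<tau>0: "\<tau> \<ge> 0"
    and \<tau>: "\<And>z. z \<in> X0 \<Longrightarrow> norm (frm p lam u z) \<le> \<tau> * n2 z"
  shows "n2 (cut 0 h u) \<le> 2 * \<tau>"
proof -
  have u1: "u \<in> X1" and ul: "u \<in> l2" using u by (auto intro: X0_X1 X1_l2)
  define z where "z = cut 0 h u"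
  define S where "S = n2 z"
  have S: "S \<ge> 0" by (simp add: S_def n2_nonneg)
  have z1: "z \<in> X1" unfolding z_def by (rule cut_X1[OF u1])
  have "(LINT x|lborel. z x) = 0"
    unfolding z_def using prim_diff[OF u1, of 0 h] h uh prim_le_0[OF u1, of 0] by simp
  then have z0: "z \<in> X0" using z1 by (simp add: X0_def)
  have "norm (prim v x) \<le> sqrt h * S" if "0 < x" "x \<le> h" "v \<in> X1" "cut 0 h v = z" for v x
  proof -
    have "norm (prim v x) \<le> sqrt x * n2 (cut 0 x v)"
      using prim_Holder[OF that(3), of 0 x] prim_le_0[OF that(3), of 0] that(1) by simp
    also have "\<dots> \<le> sqrt h * S"
      unfolding S_def that(4)[symmetric] using that h
      by (intro mult_mono n2_cut_mono X1_l2) (auto simp: n2_nonneg)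
    finally show ?thesis .
  qed
  note bound = this
  have zz: "cut 0 h z = z" unfolding z_def by (auto simp: cut_def fun_eq_iff)
  have "prim z x = 0" if "h \<le> x" for x
  proof -
    have "prim z x = (LINT t|lborel. z t)" unfolding prim_def using that
      by (intro Bochner_Integration.integral_cong) (auto simp: z_def cut_def)
    then show ?thesis using \<open>(LINT x|lborel. z x) = 0\<close> by simp
  qed
  then have bf: "norm (bf p u z) \<le> n2 p * (sqrt h * S * n2 (cut 0 h u) + sqrt h * S * n2 z)"
    using S h
    by (intro bf_estimate u1 z1 bound) (auto simp: z_def[symmetric] zz intro: bound u1, auto simp: z_def cut_def split: if_splits)
  have "S\<^sup>2 = norm (ip u z)" unfolding S_def z_def ip_cut_self by (simp add: norm_power)
  also have "\<dots> = norm (frm p lam u z - of_real lam * bf p u z)" by (simp add: frm_def)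
  also have "\<dots> \<le> norm (frm p lam u z) + \<bar>lam\<bar> * norm (bf p u z)"
    using norm_triangle_ineq4[of "frm p lam u z" "of_real lam * bf p u z"] by (simp add: norm_mult)
  also have "\<dots> \<le> \<tau> * S + \<bar>lam\<bar> * (n2 p * (sqrt h * S * S + sqrt h * S * S))"
    using \<tau>[OF z0] bf unfolding S_def z_def[symmetric] by (intro add_mono mult_left_mono) auto
  also have "\<dots> = \<tau> * S + 2 * (\<bar>lam\<bar> * n2 p) * sqrt h * S\<^sup>2" by (simp add: power2_eq_square algebra_simps)
  also have "\<dots> \<le> \<tau> * S + 1 / 2 * S\<^sup>2" using small by (intro add_left_mono mult_right_mono) auto
  finally have "S * S \<le> (2 * \<tau>) * S" by (simp add: power2_eq_square)
  then show ?thesis using S \<tau>0 unfolding S_def z_def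
    by (cases "n2 (cut 0 h u) = 0") (auto simp: less_le)
qed

text \<open>The truncation to \<open>(c, c + h]\<close> need not have zero mean, so a constant on
  \<open>(0, c]\<close> is added to make it a test element. This correction is controlled by the
  truncation, and its inner product with \<open>u\<close> only sees \<open>(0, c]\<close>, where
  \<open>u\<close> is already estimated.\<close>

lemma continuation_step:
  assumes u: "u \<in> X0" and c: "0 < h" "h \<le> c" "c + h \<le> 1"
    and small: "3 * (\<bar>lam\<bar> * n2 p) * sqrt h \<le> 1 / 2" and \<tau>0: "\<tau> \<ge> 0"
    and \<tau>: "\<And>z. z \<in> X0 \<Longrightarrow> norm (frm p lam u z) \<le> \<tau> * n2 z"
  shows "n2 (cut c (c + h) u) \<le> 4 * \<tau> + 2 * (1 + 3 * (\<bar>lam\<bar> * n2 p)) * n2 (cut 0 c u)"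
proof -
  have u1: "u \<in> X1" and ul: "u \<in> l2" using u by (auto intro: X0_X1 X1_l2)
  have c0: "c > 0" using c by simp
  define z1 where "z1 = cut c (c + h) u"
  define z2 :: cfn where "z2 = indicator {0<..c}"
  define \<delta> where "\<delta> = (LINT x|lborel. z1 x)"
  \<comment> \<open>The height that makes the mean of \<open>z\<close> vanish.\<close>
  define k where "k = - \<delta> / of_real c"
  define z where "z = (\<lambda>x. k * z2 x + z1 x)"
  define S where "S = n2 z1"
  define A where "A = n2 (cut 0 c u)"
  define \<kappa> where "\<kappa> = \<bar>lam\<bar> * n2 p"
  have \<kappa>: "\<kappa> \<ge> 0" by (simp add: \<kappa>_def n2_nonneg)
  have S: "S \<ge> 0" and A: "A \<ge> 0" by (simp_all add: S_def A_def n2_nonneg)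
  have sh: "sqrt h \<le> 1" "sqrt h \<ge> 0" using c by auto
  have z1X: "z1 \<in> X1" unfolding z1_def by (rule cut_X1[OF u1])
  have z2l: "z2 \<in> l2" unfolding z2_def using indicator_l2(1)[of 0 c] c0 by simp
  have z2X: "z2 \<in> X1" using z2l c by (auto simp: X1_def z2_def indicator_def)
  have z2n: "n2 z2 = sqrt c" unfolding z2_def using indicator_l2(2)[of 0 c] c0 by simp
  have zX: "z \<in> X1"
    unfolding z_def using X1_lincl[unfolded lincl_def, THEN conjunct2, rule_format, OF z2X z1X] .
  have "z2 = (\<lambda>x. of_real (indicator {0<..c} x))" by (auto simp: z2_def indicator_def fun_eq_iff)
  then have "(LINT x|lborel. z2 x) = of_real c" using c0 by simp
  then have "(LINT x|lborel. z x) = 0"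
    unfolding z_def using X1_integrable[OF z1X] X1_integrable[OF z2X] c0
    by (simp add: \<delta>_def[symmetric] k_def)
  then have z0: "z \<in> X0" using zX by (simp add: X0_def)
  have "norm \<delta> \<le> (LINT x|lborel. norm (z1 x))" unfolding \<delta>_def by simp
  also have "\<dots> \<le> sqrt h * S"
    unfolding S_def z1_def using cut_integral(2)[OF ul, of c "c + h"] c by simp
  finally have \<delta>: "norm \<delta> \<le> sqrt h * S" .
  have k: "norm k * sqrt c * sqrt c \<le> sqrt h * S" using \<delta> c0 by (simp add: k_def norm_divide mult.assoc)
  \<comment> \<open>By \<open>h \<le> c\<close> the correction is no larger in norm than the
    truncation.\<close>
  have kS: "norm k * sqrt c \<le> S"
  proof -
    have "sqrt h * S \<le> sqrt c * S" using c S by (intro mult_right_mono) auto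
    then have "(norm k * sqrt c) * sqrt c \<le> S * sqrt c" using k by (simp add: mult.commute)
    then show ?thesis using c0 by simp
  qed
  have nz: "n2 z \<le> 2 * S"
  proof -
    have "(\<lambda>x. k * z2 x) \<in> l2"
      by (rule l2_dominated[OF z2l, of _ "norm k"]) (use l2_measurable[OF z2l] in \<open>auto simp: norm_mult\<close>)
    then have "n2 z \<le> n2 (\<lambda>x. k * z2 x) + n2 z1" unfolding z_def by (rule n2_triangle[OF _ X1_l2[OF z1X]])
    also have "\<dots> = norm k * sqrt c + S" by (simp add: n2_scale z2n S_def)
    finally show ?thesis using kS by simp
  qed
  have pz0: "prim z x = 0" if "c + h \<le> x" for x
  proof -
    have "prim z x = (LINT t|lborel. z t)" unfolding prim_def using that c
      by (intro Bochner_Integration.integral_cong) (auto simp: z_def z1_def z2_def cut_def indicator_def)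
    then show ?thesis using \<open>(LINT x|lborel. z x) = 0\<close> by simp
  qed
  \<comment> \<open>On \<open>(0, c]\<close> the primitive is estimated from 0, where only the
    correction contributes; beyond \<open>c\<close> it is estimated backwards from
    \<open>c + h\<close>, where it vanishes again.\<close>
  have pz: "norm (prim z x) \<le> sqrt h * S" if x: "0 < x" "x \<le> c + h" for x
  proof (cases "x \<le> c")
    case True
    have "norm (prim z x) \<le> sqrt x * n2 (cut 0 x z)"
      using prim_Holder[OF zX, of 0 x] prim_le_0[OF zX, of 0] x by simp
    also have "\<dots> \<le> sqrt c * n2 (cut 0 c z)"
      using True x c0 by (intro mult_mono n2_cut_mono X1_l2 zX) (auto simp: n2_nonneg)
    also have "cut 0 c z = (\<lambda>x. k * z2 x)"
      by (auto simp: cut_def z_def z1_def z2_def indicator_def fun_eq_iff)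
    finally show ?thesis using k by (simp add: n2_scale z2n mult_ac)
  next
    case False
    have "norm (prim z x) \<le> sqrt (c + h - x) * n2 (cut x (c + h) z)"
      using prim_Holder[OF zX, of x "c + h"] pz0[of "c + h"] x by simp
    also have "cut x (c + h) z = cut x (c + h) u"
      using False by (auto simp: cut_def z_def z1_def z2_def indicator_def fun_eq_iff)
    also have "sqrt (c + h - x) * n2 (cut x (c + h) u) \<le> sqrt h * S"
      unfolding S_def z1_def using False x by (intro mult_mono n2_cut_mono ul) (auto simp: n2_nonneg)
    finally show ?thesis .
  qed
  have puc: "norm (prim u x) \<le> A" if "0 < x" "x \<le> c" for x
  proof -
    have "norm (prim u x) \<le> sqrt x * n2 (cut 0 x u)"
      using prim_Holder[OF u1, of 0 x] prim_le_0[OF u1, of 0] that by simp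
    also have "\<dots> \<le> 1 * A"
      unfolding A_def using that c by (intro mult_mono n2_cut_mono ul) (auto simp: n2_nonneg)
    finally show ?thesis by simp
  qed
  have pu: "norm (prim u x) \<le> A + sqrt h * S" if "z x \<noteq> 0" for x
  proof -
    have x: "0 < x" "x \<le> c + h" using that c by (auto simp: z_def z1_def z2_def cut_def indicator_def split: if_splits)
    show ?thesis
    proof (cases "x \<le> c")
      case True
      then show ?thesis using puc[OF x(1)] sh S mult_nonneg_nonneg[of "sqrt h" S] by linarith
    next
      case False
      have "norm (prim u x - prim u c) \<le> sqrt (x - c) * n2 (cut c x u)"
        using prim_Holder[OF u1, of c x] False by simp
      also have "\<dots> \<le> sqrt h * S"
        unfolding S_def z1_def using False x by (intro mult_mono n2_cut_mono ul) (auto simp: n2_nonneg)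
      finally have "norm (prim u x - prim u c) \<le> sqrt h * S" .
      then show ?thesis
        using puc[OF c0] norm_triangle_ineq[of "prim u x - prim u c" "prim u c"] by simp
    qed
  qed
  have "norm (bf p u z) \<le> n2 p * (sqrt h * S * n2 (cut 0 (c + h) u) + (A + sqrt h * S) * n2 z)"
    using S A sh by (intro bf_estimate u1 zX pz0 pz pu) auto
  also have "\<dots> \<le> n2 p * (sqrt h * S * (A + S) + (A + sqrt h * S) * (2 * S))"
  proof (intro mult_left_mono add_mono nz)
    show "n2 (cut 0 (c + h) u) \<le> A + S"
      unfolding A_def S_def z1_def using c by (intro n2_cut_split ul) auto
  qed (use S A sh in \<open>auto simp: n2_nonneg\<close>)
  also have "\<dots> \<le> n2 p * (3 * A * S + 3 * sqrt h * S\<^sup>2)"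
  proof (intro mult_left_mono)
    \<comment> \<open>Terms linear in \<open>A\<close> can give up the factor \<open>sqrt h\<close>;
      those quadratic in \<open>S\<close> keep it, so that they can be absorbed.\<close>
    have "sqrt h * (S * A) \<le> 1 * (S * A)" using sh S A by (intro mult_right_mono) auto
    then show "sqrt h * S * (A + S) + (A + sqrt h * S) * (2 * S) \<le> 3 * A * S + 3 * sqrt h * S\<^sup>2"
      by (simp add: power2_eq_square algebra_simps)
  qed (simp add: n2_nonneg)
  finally have bf: "\<bar>lam\<bar> * norm (bf p u z) \<le> \<bar>lam\<bar> * (n2 p * (3 * A * S + 3 * sqrt h * S\<^sup>2))"
    by (intro mult_left_mono) auto
  have ipz: "ip u z = cnj k * ip u z2 + of_real (S\<^sup>2)"
  proof -
    have "ip u z = cnj k * ip u z2 + ip u z1"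
      using herm_right[OF herm_frm_X1[of 0] z2X z1X u1, of k] unfolding z_def frm_def by simp
    then show ?thesis unfolding z1_def ip_cut_self S_def .
  qed
  have "ip u z2 = ip (cut 0 c u) z2"
    unfolding ip_def by (intro Bochner_Integration.integral_cong) (auto simp: cut_def z2_def indicator_def)
  then have "norm (ip u z2) \<le> A * sqrt c"
    using ip_bound[OF cut_l2[OF ul] z2l, of 0 c] unfolding A_def z2n by simp
  then have "norm k * norm (ip u z2) \<le> norm k * (A * sqrt c)" by (intro mult_left_mono) auto
  also have "\<dots> \<le> A * S" using mult_left_mono[OF kS A] by (simp add: mult_ac)
  finally have ip2: "norm (cnj k * ip u z2) \<le> A * S" by (simp add: norm_mult)
  have "S\<^sup>2 = norm (frm p lam u z - of_real lam * bf p u z - cnj k * ip u z2)"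
    unfolding frm_def ipz by (simp add: norm_power)
  also have "\<dots> \<le> norm (frm p lam u z) + \<bar>lam\<bar> * norm (bf p u z) + norm (cnj k * ip u z2)"
    using norm_triangle_ineq4[of "frm p lam u z - of_real lam * bf p u z" "cnj k * ip u z2"]
      norm_triangle_ineq4[of "frm p lam u z" "of_real lam * bf p u z"] by (simp add: norm_mult)
  also have "\<dots> \<le> \<tau> * (2 * S) + \<bar>lam\<bar> * (n2 p * (3 * A * S + 3 * sqrt h * S\<^sup>2)) + A * S"
    using \<tau>[OF z0] mult_left_mono[OF nz \<tau>0] bf ip2 by linarith
  also have "\<dots> = (2 * \<tau> + (1 + 3 * \<kappa>) * A) * S + 3 * \<kappa> * sqrt h * S\<^sup>2"
    by (simp add: \<kappa>_def algebra_simps)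
  also have "\<dots> \<le> (2 * \<tau> + (1 + 3 * \<kappa>) * A) * S + 1 / 2 * S\<^sup>2"
    using small unfolding \<kappa>_def by (intro add_left_mono mult_right_mono) auto
  finally have "S\<^sup>2 \<le> 2 * ((2 * \<tau> + (1 + 3 * \<kappa>) * A) * S)" by linarith
  then have "S * S \<le> (2 * (2 * \<tau> + (1 + 3 * \<kappa>) * A)) * S" by (simp only: power2_eq_square mult.assoc)
  moreover have "0 \<le> 2 * (2 * \<tau> + (1 + 3 * \<kappa>) * A)" using \<tau>0 \<kappa> A by simp
  ultimately have "S \<le> 2 * (2 * \<tau> + (1 + 3 * \<kappa>) * A)"
    using S by (cases "S = 0") (auto simp: less_le)
  then show ?thesis by (simp add: S_def z1_def A_def \<kappa>_def algebra_simps)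
qed

text \<open>The condition \<open>prim u h = 0\<close> replaces the vanishing of the quasi-derivative at \<open>0\<close>,
  which has no meaning for approximate null vectors.\<close>

lemma unique_continuation:
  "\<exists>h C. 0 < h \<and> C \<ge> 0 \<and> (\<forall>u\<in>X0. \<forall>\<tau>\<ge>0. prim u h = 0 \<longrightarrow>
    (\<forall>z\<in>X0. norm (frm p lam u z) \<le> \<tau> * n2 z) \<longrightarrow> n2 u \<le> C * \<tau>)"
proof -
  define \<kappa> where "\<kappa> = \<bar>lam\<bar> * n2 p"
  have \<kappa>: "\<kappa> \<ge> 0" by (simp add: \<kappa>_def n2_nonneg)
  \<comment> \<open>The unit interval is cut into \<open>K\<close> pieces of length
    \<open>h = 1 / K\<close>, so short that \<open>3 * \<kappa> * sqrt h \<le> 1 / 2\<close>; the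
    added 1 keeps \<open>K\<close> positive also for \<open>\<kappa> = 0\<close>.\<close>
  obtain K :: nat where "real K > (6 * \<kappa> + 1)\<^sup>2" using reals_Archimedean2 by blast
  moreover have "(6 * \<kappa> + 1)\<^sup>2 \<ge> 1" using \<kappa> by (simp add: one_le_power)
  ultimately have K: "real K \<ge> (6 * \<kappa> + 1)\<^sup>2" "K \<ge> 1" by auto
  define h where "h = 1 / real K"
  have h: "0 < h" "h \<le> 1" "real K * h = 1" using K by (auto simp: h_def)
  have "6 * \<kappa> \<le> sqrt (real K)" using real_le_rsqrt[OF K(1)] by simp
  then have small: "3 * \<kappa> * sqrt h \<le> 1 / 2" using K unfolding h_def by (simp add: real_sqrt_divide field_simps)
  then have small2: "2 * \<kappa> * sqrt h \<le> 1 / 2" using \<kappa> mult_nonneg_nonneg[of \<kappa> "sqrt h"] h by simp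
  \<comment> \<open>The growth per piece: 1 for the old part, \<open>2 * (1 + 3 * \<kappa>)\<close>
    from \<open>continuation_step\<close>, and 4 for the defect \<open>\<tau>\<close>.\<close>
  define B where "B = 7 + 6 * \<kappa>"
  have B: "B \<ge> 1" using \<kappa> by (simp add: B_def)
  have "n2 u \<le> B ^ K * \<tau>" if u: "u \<in> X0" and \<tau>0: "\<tau> \<ge> 0" and uh: "prim u h = 0"
    and \<tau>: "\<And>z. z \<in> X0 \<Longrightarrow> norm (frm p lam u z) \<le> \<tau> * n2 z" for u \<tau>
  proof -
    have "n2 (cut 0 (real j * h) u) \<le> B ^ j * \<tau>" if "1 \<le> j" "j \<le> K" for j
      using that
    proof (induction j rule: dec_induct)
      case base
      have "n2 (cut 0 h u) \<le> 2 * \<tau>"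
        by (rule continuation_start[OF u h(1,2) uh _ \<tau>0 \<tau>]) (use small2 \<kappa>_def in auto)
      also have "\<dots> \<le> B * \<tau>" using \<tau>0 \<kappa> by (intro mult_right_mono) (auto simp: B_def)
      finally show ?case by simp
    next
      case (step j)
      define c where "c = real j * h"
      have jh: "real (Suc j) * h = c + h" by (simp add: c_def algebra_simps)
      have c: "h \<le> c" "c + h \<le> 1"
        using step h mult_right_mono[of 1 "real j" h] mult_right_mono[of "real (Suc j)" "real K" h]
        unfolding c_def by (auto simp: algebra_simps)
      have IH: "n2 (cut 0 c u) \<le> B ^ j * \<tau>" using step by (simp add: c_def)
      have "n2 (cut c (c + h) u) \<le> 4 * \<tau> + 2 * (1 + 3 * \<kappa>) * n2 (cut 0 c u)"
        unfolding \<kappa>_def by (rule continuation_step[OF u h(1) c _ \<tau>0 \<tau>]) (use small \<kappa>_def in auto)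
      moreover have "n2 (cut 0 (c + h) u) \<le> n2 (cut 0 c u) + n2 (cut c (c + h) u)"
        using c h u by (intro n2_cut_split X1_l2 X0_X1) auto
      ultimately have "n2 (cut 0 (c + h) u) \<le> 4 * \<tau> + (3 + 6 * \<kappa>) * n2 (cut 0 c u)"
        by (simp add: algebra_simps)
      also have "\<dots> \<le> 4 * (B ^ j * \<tau>) + (3 + 6 * \<kappa>) * (B ^ j * \<tau>)"
        using IH \<kappa> mult_right_mono[OF one_le_power[OF B, of j] \<tau>0] by (intro add_mono mult_left_mono) auto
      also have "\<dots> = B ^ Suc j * \<tau>" by (simp add: B_def algebra_simps)
      finally show ?case unfolding jh .
    qed
    from this[of K] show ?thesis using K h X1_cut_01[OF X0_X1[OF u]] by simp
  qed
  then show ?thesis using h(1) B by (intro exI[of _ h] exI[of _ "B ^ K"]) auto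
qed

text \<open>A jump by 2 leaves room for one condition besides orthogonality to a maximal family
  \<open>V\<close>, namely \<open>prim u h = 0\<close>. The resulting \<open>u\<close> has form
  value between 0 and \<open>\<eta>\<close> times its squared norm; Cauchy-Schwarz on the complement
  of \<open>V\<close> makes it an approximate null vector, and \<open>unique_continuation\<close>
  excludes it for small \<open>\<eta>\<close>.\<close>

lemma Nf_jump:
  assumes b: "\<And>lam. \<exists>m. negbound X0 (frm p lam) m"
  shows "\<exists>\<eta>0>0. \<forall>\<eta>. 0 < \<eta> \<longrightarrow> \<eta> < \<eta>0 \<longrightarrow> Nf ((1 + \<eta>) * lam) \<le> Nf lam + 1"
proof -
  let ?q = "frm p lam"
  obtain m where m: "negbound X0 ?q m" using b by blast
  obtain V where V: "negset X0 ?q V" "card V = Nf lam"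
    and max: "\<And>g. g \<in> X0 \<Longrightarrow> (\<And>v. v \<in> V \<Longrightarrow> ?q g v = 0) \<Longrightarrow> Re (?q g g) \<ge> 0"
    using nind_maximal[OF herm_frm m] unfolding Nf_def by metis
  have fV: "finite V" "V \<subseteq> X0" and neg: "\<And>v. v \<in> V \<Longrightarrow> Re (?q v v) < 0"
    and orth: "\<And>v w. v \<in> V \<Longrightarrow> w \<in> V \<Longrightarrow> v \<noteq> w \<Longrightarrow> ?q v w = 0"
    using V(1) by (auto simp: negset_def)
  obtain h C where h: "0 < h" "C \<ge> 0"
    and uc: "\<And>u \<tau>. u \<in> X0 \<Longrightarrow> \<tau> \<ge> 0 \<Longrightarrow> prim u h = 0 \<Longrightarrow>
      (\<And>z. z \<in> X0 \<Longrightarrow> norm (?q u z) \<le> \<tau> * n2 z) \<Longrightarrow> n2 u \<le> C * \<tau>"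
    using unique_continuation[of lam] by metis
  define B where "B = 1 + 2 * \<bar>lam\<bar> * n2 p"
  have B: "B \<ge> 1" by (simp add: B_def n2_nonneg)
  \<comment> \<open>Bounds the form on the component of \<open>z\<close> orthogonal to
    \<open>V\<close>: the first summand is for \<open>z\<close> itself, the sum for the subtracted
    components.\<close>
  define CV where "CV = B + (\<Sum>v\<in>V. B\<^sup>2 * (n2 v)\<^sup>2 / norm (?q v v))"
  have "(\<Sum>v\<in>V. B\<^sup>2 * (n2 v)\<^sup>2 / norm (?q v v)) \<ge> 0" by (intro sum_nonneg) auto
  then have CV: "CV \<ge> 1" using B by (simp add: CV_def)
  \<comment> \<open>Small enough for \<open>\<eta> * (C\<^sup>2 * CV) < 1\<close> whenever
    \<open>\<eta> < \<eta>0\<close>, which contradicts the final estimate.\<close>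
  define \<eta>0 where "\<eta>0 = 1 / (C\<^sup>2 * CV + 1)"
  have den: "C\<^sup>2 * CV + 1 > 0" using CV by (simp add: add_nonneg_pos)
  have "Nf ((1 + \<eta>) * lam) \<le> Nf lam + 1" if \<eta>: "0 < \<eta>" "\<eta> < \<eta>0" for \<eta>
  proof (rule ccontr)
    assume "\<not> Nf ((1 + \<eta>) * lam) \<le> Nf lam + 1"
    moreover obtain m' where m': "negbound X0 (frm p ((1 + \<eta>) * lam)) m'" using b by blast
    then obtain W where W: "negset X0 (frm p ((1 + \<eta>) * lam)) W" "card W = Nf ((1 + \<eta>) * lam)"
      using nind_attained unfolding Nf_def by metis
    ultimately have big: "card V + 1 < card W" using V(2) by simp
    define J where "J = insert (\<lambda>u. prim u h) ((\<lambda>v u. ?q u v) ` V)"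
    have "card J \<le> Suc (card V)"
      unfolding J_def using card_image_le[OF fV(1)] fV(1) by (metis card_insert_le_m1 card_insert_if finite_imageI le_SucI not_less_eq_eq)
    then have card: "card J < card W" using big by simp
    have "finite J" using fV by (simp add: J_def)
    moreover have "linf X0 \<phi>" if \<phi>: "\<phi> \<in> J" for \<phi>
    proof -
      consider "\<phi> = (\<lambda>u. prim u h)" | v where "v \<in> V" "\<phi> = (\<lambda>u. ?q u v)" using \<phi> unfolding J_def by blast
      then show ?thesis
      proof cases
        case 1
        then show ?thesis unfolding linf_def using prim_lin X1_integrable X0_X1 by blast
      next
        case 2
        then show ?thesis using herm_linf[OF herm_frm] fV by blast
      qed
    qed
    ultimately obtain u where u: "u \<in> X0" "Re (frm p ((1 + \<eta>) * lam) u u) < 0" and uJ: "\<forall>\<phi>\<in>J. \<phi> u = 0"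
      using negset_test[OF herm_frm W(1) _ _ card] by blast
    have uh: "prim u h = 0" and uV: "\<And>v. v \<in> V \<Longrightarrow> ?q u v = 0" using uJ unfolding J_def by auto
    have q0: "Re (?q u u) \<ge> 0" by (rule max[OF u(1) uV])
    have neg': "(n2 u)\<^sup>2 + (1 + \<eta>) * (lam * Re (bf p u u)) < 0" using u(2) unfolding frm_self by (simp add: mult.assoc)
    have qu: "Re (?q u u) \<le> \<eta> * (n2 u)\<^sup>2"
    proof -
      \<comment> \<open>The last bracket is the form at \<open>(1 + \<eta>) * lam\<close>, which is
        negative at \<open>u\<close>.\<close>
      have "(1 + \<eta>) * Re (?q u u) = \<eta> * (n2 u)\<^sup>2 + ((n2 u)\<^sup>2 + (1 + \<eta>) * (lam * Re (bf p u u)))"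
        unfolding frm_self by (simp add: algebra_simps)
      then have "(1 + \<eta>) * Re (?q u u) \<le> \<eta> * (n2 u)\<^sup>2" using neg' by linarith
      moreover have "Re (?q u u) \<le> (1 + \<eta>) * Re (?q u u)" using q0 \<eta> mult_right_mono[of 1 "1 + \<eta>"] by simp
      ultimately show ?thesis by linarith
    qed
    have n2u: "n2 u > 0"
    proof (rule ccontr)
      assume "\<not> n2 u > 0"
      then have "n2 u = 0" using n2_nonneg[of u] by simp
      then have "bf p u u = 0" using bf_bound[OF X0_X1[OF u(1)] X0_X1[OF u(1)]] by simp
      then show False using neg' \<open>n2 u = 0\<close> by simp
    qed
    have main: "norm (?q u z) \<le> (sqrt (\<eta> * CV) * n2 u) * n2 z" if z: "z \<in> X0" for z
    proof (rule power2_le_imp_le)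
      show "0 \<le> (sqrt (\<eta> * CV) * n2 u) * n2 z" using \<eta> CV by (simp add: n2_nonneg)
      \<comment> \<open>These coefficients project \<open>z\<close> onto the complement of
        \<open>V\<close>, where the form is nonnegative and Cauchy-Schwarz applies. As
        \<open>u\<close> is orthogonal to \<open>V\<close>, the projection \<open>w\<close> pairs
        with \<open>u\<close> as \<open>z\<close> does.\<close>
      define c where "c v = - ?q z v / ?q v v" for v
      define w where "w = (\<lambda>x. 1 * z x + comb V c x)"
      have cV: "comb V c \<in> X0" by (rule comb_mem[OF X0_lincl fV])
      have w: "w \<in> X0"
        unfolding w_def using X0_lincl[unfolded lincl_def, THEN conjunct2, rule_format, OF z cV] .
      have qv: "?q v v \<noteq> 0" if "v \<in> V" for v using neg[OF that] by auto
      have wV: "?q w v = 0" if v: "v \<in> V" for v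
      proof -
        have vX: "v \<in> X0" using v fV by blast
        have "?q (comb V c) v = (\<Sum>v'\<in>{v}. c v' * ?q v' v)"
          unfolding herm_comb_left[OF herm_frm fV vX]
          by (rule sum.mono_neutral_right) (use fV v orth in auto)
        also have "\<dots> = - ?q z v" using qv[OF v] by (simp add: c_def)
        finally show ?thesis unfolding w_def herm_left[OF herm_frm z cV vX] by simp
      qed
      have "?q u (comb V c) = 0"
        using uV unfolding herm_comb_right[OF herm_frm fV u(1)] by simp
      then have uw: "?q u w = ?q u z" unfolding w_def herm_right[OF herm_frm z cV u(1)] by simp
      have "?q w (comb V c) = 0"
        using wV unfolding herm_comb_right[OF herm_frm fV w] by simp
      then have "?q w w = ?q w z" using herm_right[OF herm_frm[of lam] z cV w, of 1] unfolding w_def by simp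
      also have "\<dots> = ?q z z + (\<Sum>v\<in>V. c v * ?q v z)"
        unfolding w_def herm_left[OF herm_frm z cV z] herm_comb_left[OF herm_frm fV z] by simp
      finally have "Re (?q w w) \<le> norm (?q z z + (\<Sum>v\<in>V. c v * ?q v z))"
        using complex_Re_le_cmod by metis
      also have "\<dots> \<le> norm (?q z z) + (\<Sum>v\<in>V. norm (c v * ?q v z))"
        using norm_triangle_ineq[of "?q z z" "\<Sum>v\<in>V. c v * ?q v z"] norm_sum[of "\<lambda>v. c v * ?q v z" V] by linarith
      also have "\<dots> \<le> B * (n2 z)\<^sup>2 + (\<Sum>v\<in>V. B\<^sup>2 * (n2 v)\<^sup>2 / norm (?q v v) * (n2 z)\<^sup>2)"
      proof (intro add_mono sum_mono)
        show "norm (?q z z) \<le> B * (n2 z)\<^sup>2"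
          using frm_bound[OF X0_X1[OF z] X0_X1[OF z], of lam] by (simp add: B_def power2_eq_square mult.assoc)
        fix v assume v: "v \<in> V"
        then have vX: "v \<in> X1" using fV X0_X1 by blast
        have "norm (?q z v) * norm (?q v z) \<le> (B * n2 z * n2 v) * (B * n2 v * n2 z)"
          using frm_bound[OF X0_X1[OF z] vX, of lam] frm_bound[OF vX X0_X1[OF z], of lam] B
          unfolding B_def[symmetric] by (intro mult_mono) (auto simp: n2_nonneg)
        then have "norm (?q z v) * norm (?q v z) / norm (?q v v) \<le> (B * n2 z * n2 v) * (B * n2 v * n2 z) / norm (?q v v)"
          by (rule divide_right_mono) simp
        then show "norm (c v * ?q v z) \<le> B\<^sup>2 * (n2 v)\<^sup>2 / norm (?q v v) * (n2 z)\<^sup>2"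
          by (simp add: c_def norm_mult norm_divide power2_eq_square mult_ac)
      qed
      also have "\<dots> = CV * (n2 z)\<^sup>2" by (simp add: CV_def distrib_right sum_distrib_right)
      finally have qw: "Re (?q w w) \<le> CV * (n2 z)\<^sup>2" .
      have "(norm (?q u w))\<^sup>2 \<le> Re (?q u u) * Re (?q w w)"
      proof (rule herm_Cauchy_Schwarz[OF herm_frm u(1) w])
        fix c d
        have dw: "(\<lambda>x. d * w x + (\<lambda>x. 0) x) \<in> X0"
          using X0_lincl[unfolded lincl_def, THEN conjunct2, rule_format, OF w, of "\<lambda>x. 0"] X0_lincl
          by (simp add: lincl_def)
        have "(\<lambda>x. c * u x + d * w x) \<in> X0"
          using X0_lincl[unfolded lincl_def, THEN conjunct2, rule_format, OF u(1) dw, of c] by simp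
        moreover have "?q (\<lambda>x. c * u x + d * w x) v = 0" if v: "v \<in> V" for v
        proof -
          have vX: "v \<in> X0" using v fV by blast
          have 0: "(\<lambda>x. 0) \<in> X0" using X0_lincl by (simp add: lincl_def)
          have "?q (\<lambda>x. 0) v = 0" by (simp add: frm_def ip_def bf_def prim_def)
          then have "?q (\<lambda>x. d * w x) v = 0"
            using herm_left[OF herm_frm[of lam] w 0 vX, of d] wV[OF v] by simp
          then show ?thesis
            using herm_left[OF herm_frm[of lam] u(1) dw vX, of c] uV[OF v] by simp
        qed
        ultimately show "0 \<le> Re (?q (\<lambda>x. c * u x + d * w x) (\<lambda>x. c * u x + d * w x))" by (rule max)
      qed
      also have "\<dots> \<le> (\<eta> * (n2 u)\<^sup>2) * (CV * (n2 z)\<^sup>2)"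
        using qu qw q0 \<eta> CV by (intro mult_mono) (auto intro: order_trans[OF _ qw] max[OF w wV])
      also have "\<dots> = ((sqrt (\<eta> * CV) * n2 u) * n2 z)\<^sup>2"
        using \<eta> CV by (simp add: power_mult_distrib)
      finally show "(norm (?q u z))\<^sup>2 \<le> ((sqrt (\<eta> * CV) * n2 u) * n2 z)\<^sup>2" unfolding uw .
    qed
    have "n2 u \<le> C * (sqrt (\<eta> * CV) * n2 u)"
      by (rule uc[OF u(1) _ uh main]) (use \<eta> CV in \<open>auto simp: n2_nonneg\<close>)
    then have "1 \<le> C * sqrt (\<eta> * CV)" using n2u by (simp flip: mult.assoc)
    then have "1\<^sup>2 \<le> (C * sqrt (\<eta> * CV))\<^sup>2" by (intro power_mono) auto
    then have "1 \<le> \<eta> * (C\<^sup>2 * CV)" using \<eta> CV by (simp add: power_mult_distrib mult_ac)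
    also have "\<dots> \<le> \<eta> * (C\<^sup>2 * CV + 1)" using \<eta> by simp
    also have "\<dots> < \<eta>0 * (C\<^sup>2 * CV + 1)" using \<eta>(2) den by (rule mult_strict_right_mono)
    also have "\<dots> = 1" using den by (simp add: \<eta>0_def)
    finally show False by simp
  qed
  moreover have "\<eta>0 > 0" using den by (simp add: \<eta>0_def)
  ultimately show ?thesis by blast
qed

end

section \<open>Elements of \<open>H\<close> as primitives\<close>

definition aeq :: "cfn \<Rightarrow> cfn \<Rightarrow> bool" where
  "aeq f g \<longleftrightarrow> (AE x in lborel. 0 < x \<and> x < 1 \<longrightarrow> f x = g x)"

lemma unit_AE_iff: "(AE x in unit_leb. Q x) \<longleftrightarrow> (AE x in lborel. 0 < x \<and> x < (1::real) \<longrightarrow> Q x)"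
proof -
  have "(AE x in unit_leb. Q x) \<longleftrightarrow> (AE x in lborel. x \<in> {0..1} \<longrightarrow> Q x)"
    by (subst AE_restrict_space_iff) (simp_all add: AE_completion_iff)
  also have "\<dots> \<longleftrightarrow> (AE x in lborel. 0 < x \<and> x < 1 \<longrightarrow> Q x)"
  proof
    assume "AE x in lborel. x \<in> {0..1} \<longrightarrow> Q x"
    then show "AE x in lborel. 0 < x \<and> x < 1 \<longrightarrow> Q x" by eventually_elim auto
  next
    assume "AE x in lborel. 0 < x \<and> x < 1 \<longrightarrow> Q x"
    then show "AE x in lborel. x \<in> {0..1} \<longrightarrow> Q x"
      using AE_lborel_singleton[of 0] AE_lborel_singleton[of 1] by eventually_elim auto
  qed
  finally show ?thesis .
qed

text \<open>The bridge from Lebesgue measurable functions on closed intervals, used in the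
  definitions, to Borel functions on the line; endpoints only matter up to null sets.\<close>

lemma interval_integral_eq_prim:
  assumes F: "F \<in> borel_measurable unit_leb" and G: "G \<in> borel_measurable borel"
    and out: "\<And>x. x \<notin> {0<..1} \<Longrightarrow> G x = 0" and eq: "aeq F G" and b: "0 \<le> b" "b \<le> 1"
  shows "(LINT t|lebesgue_on {0..b}. F t) = prim G b"
proof -
  have Fm: "(\<lambda>x. indicator {0..1} x *\<^sub>R F x) \<in> borel_measurable lebesgue"
    using F by (subst (asm) borel_measurable_restrict_space_iff) auto
  have "(\<lambda>x. indicator {0..b} x *\<^sub>R (indicator {0..1} x *\<^sub>R F x)) \<in> borel_measurable lebesgue"
    by (rule borel_measurable_scaleR[OF borel_measurable_indicator Fm]) simp
  moreover have "(\<lambda>x. indicator {0..b} x *\<^sub>R (indicator {0..1} x *\<^sub>R F x)) = (\<lambda>x. indicator {0..b} x *\<^sub>R F x)"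
    using b by (auto simp: indicator_def)
  ultimately have Fb: "(\<lambda>x. indicator {0..b} x *\<^sub>R F x) \<in> borel_measurable lebesgue" by simp
  have Gm: "(\<lambda>t. if t \<le> b then G t else 0) \<in> borel_measurable lborel" using G by measurable
  have "(LINT t|lebesgue_on {0..b}. F t) = (LINT t|lebesgue. indicator {0..b} t *\<^sub>R F t)"
    by (subst integral_restrict_space) auto
  also have "\<dots> = (LINT t|lebesgue. (if t \<le> b then G t else 0))"
  proof (rule integral_cong_AE[OF Fb measurable_completion[OF Gm]])
    have "AE t in lborel. indicator {0..b} t *\<^sub>R F t = (if t \<le> b then G t else 0)"
      using eq[unfolded aeq_def] AE_lborel_singleton[of 0] AE_lborel_singleton[of 1]
    proof eventually_elim
      case (elim t)
      then show ?case using out[of t] b by (auto simp: indicator_def)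
    qed
    then show "AE t in lebesgue. indicator {0..b} t *\<^sub>R F t = (if t \<le> b then G t else 0)"
      by (rule AE_completion)
  qed
  also have "\<dots> = prim G b" unfolding prim_def by (rule integral_completion[OF Gm])
  finally show ?thesis .
qed

lemma unit_integral_eq:
  assumes "F \<in> borel_measurable unit_leb" "G \<in> borel_measurable borel"
    "\<And>x. x \<notin> {0<..1} \<Longrightarrow> G x = 0" "aeq F G"
  shows "(LINT x|unit_leb. F x) = (LINT x|lborel. G x)"
proof -
  have "(LINT x|unit_leb. F x) = prim G 1" by (rule interval_integral_eq_prim[OF assms]) auto
  also have "\<dots> = (LINT x|lborel. G x)"
    unfolding prim_def using assms(3) by (intro Bochner_Integration.integral_cong) auto
  finally show ?thesis .
qed

lemma borel_measurable_unit_leb: "g \<in> borel_measurable borel \<Longrightarrow> g \<in> borel_measurable unit_leb"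
  by (intro measurable_restrict_space1 measurable_completion) simp

lemma L2_measurable: "f \<in> L2 \<Longrightarrow> f \<in> borel_measurable unit_leb"
  by (simp add: L2_def)

lemma X1_L2:
  assumes g: "g \<in> X1" shows "g \<in> L2"
proof -
  have "(\<lambda>x. indicator {0..1} x *\<^sub>R (norm (g x))\<^sup>2) = (\<lambda>x. (norm (g x))\<^sup>2)"
  proof
    fix x
    show "indicator {0..1} x *\<^sub>R (norm (g x))\<^sup>2 = (norm (g x))\<^sup>2"
      using X1_outside[OF g, of x] by (cases "x \<in> {0<..1}") auto
  qed
  moreover have "integrable lebesgue (\<lambda>x. (norm (g x))\<^sup>2)"
    using l2_integrable[OF X1_l2[OF g]] X1_measurable[OF g] by (subst integrable_completion) auto
  ultimately have "integrable unit_leb (\<lambda>x. (norm (g x))\<^sup>2)"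
    by (subst integrable_restrict_space) auto
  then show ?thesis using borel_measurable_unit_leb[OF X1_measurable[OF g]] by (simp add: L2_def)
qed

text \<open>A Lebesgue measurable function agrees almost everywhere with a Borel one. This is
  applied to the real and imaginary parts, followed by truncation to the half-open interval.\<close>

lemma L2_representative:
  assumes f: "f \<in> L2"
  shows "\<exists>g\<in>X1. aeq f g"
proof -
  have fm: "f \<in> borel_measurable unit_leb" using f by (rule L2_measurable)
  have "\<exists>r\<in>borel_measurable lborel. AE x in lborel. (if x \<in> {0..1} then \<phi> (f x) else 0) = r x"
    if "\<phi> \<in> borel_measurable borel" for \<phi> :: "complex \<Rightarrow> real"
  proof (rule completion_ex_borel_measurable_real)
    have "(\<lambda>x. \<phi> (f x)) \<in> borel_measurable unit_leb" by (rule measurable_compose[OF fm that])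
    then show "(\<lambda>x. if x \<in> {0..1} then \<phi> (f x) else 0) \<in> borel_measurable lebesgue"
      by (rule borel_measurable_if_I) auto
  qed
  from this[of Re] this[of Im] obtain r i
    where [measurable]: "r \<in> borel_measurable borel" "i \<in> borel_measurable borel"
      and ri: "AE x in lborel. (if x \<in> {0..1} then Re (f x) else 0) = r x"
        "AE x in lborel. (if x \<in> {0..1} then Im (f x) else 0) = i x"
    by auto
  define g where "g x = (if 0 < x \<and> x \<le> 1 then of_real (r x) + \<i> * of_real (i x) else 0)" for x
  have gm[measurable]: "g \<in> borel_measurable borel" unfolding g_def[abs_def] by measurable
  have eq: "aeq f g" unfolding aeq_def using ri by eventually_elim (auto simp: g_def complex_eq_iff)
  have int: "integrable lebesgue (\<lambda>x. indicator {0..1} x *\<^sub>R (norm (f x))\<^sup>2)"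
    using f unfolding L2_def by (subst integrable_restrict_space[symmetric]) auto
  have ae: "AE x in lebesgue. indicator {0..1} x *\<^sub>R (norm (f x))\<^sup>2 = (norm (g x))\<^sup>2"
  proof (rule AE_completion)
    show "AE x in lborel. indicator {0..1} x *\<^sub>R (norm (f x))\<^sup>2 = (norm (g x))\<^sup>2"
      using eq[unfolded aeq_def] AE_lborel_singleton[of 0] AE_lborel_singleton[of 1]
    proof eventually_elim
      case (elim x)
      then show ?case by (auto simp: indicator_def g_def)
    qed
  qed
  have gm2: "(\<lambda>x. (norm (g x))\<^sup>2) \<in> borel_measurable lborel" by measurable
  have "integrable lebesgue (\<lambda>x. (norm (g x))\<^sup>2)"
    by (rule integrable_cong_AE_imp[OF int measurable_completion[OF gm2]]) (use ae in \<open>simp add: eq_commute\<close>)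
  then have "integrable lborel (\<lambda>x. (norm (g x))\<^sup>2)" using gm2 by (subst (asm) integrable_completion) auto
  then have "g \<in> X1" using gm by (auto simp: X1_def l2_def g_def)
  then show ?thesis using eq by blast
qed

lemma has_L2_deriv_prim:
  assumes g: "g \<in> X1" shows "has_L2_deriv (prim g) g"
proof -
  have "aeq g g" by (simp add: aeq_def)
  then have "(LINT t|lebesgue_on {0..x}. g t) = prim g x" if "x \<in> {0..1}" for x
    using that X1_outside[OF g] borel_measurable_unit_leb[OF X1_measurable[OF g]] X1_measurable[OF g]
    by (intro interval_integral_eq_prim) auto
  then show ?thesis unfolding has_L2_deriv_def using X1_L2[OF g] prim_le_0[OF g, of 0] by simp
qed

lemma prim_in_H: "g \<in> X0 \<Longrightarrow> prim g \<in> H"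
  unfolding H_def
  using has_L2_deriv_prim[OF X0_X1, of g] prim_le_0[OF X0_X1, of g] prim_X0_ge_1[of g] by force

text \<open>Together with \<open>prim_in_H\<close> this describes \<open>H\<close> as the set of
  primitives of \<open>X0\<close>, with equality at every point; only the derivative is determined
  merely almost everywhere.\<close>

lemma H_representative:
  assumes y: "y \<in> H"
  shows "L2_deriv y \<in> L2" "\<exists>g\<in>X0. y = prim g \<and> aeq (L2_deriv y) g"
proof -
  have y0: "y 0 = 0" "y 1 = 0" and yo: "\<And>x. x \<notin> {0..1} \<Longrightarrow> y x = 0" and ex: "\<exists>g. has_L2_deriv y g"
    using y by (auto simp: H_def)
  have d: "has_L2_deriv y (L2_deriv y)" unfolding L2_deriv_def using ex by (rule someI_ex)
  then show L: "L2_deriv y \<in> L2" by (simp add: has_L2_deriv_def)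
  obtain g where g: "g \<in> X1" "aeq (L2_deriv y) g" using L2_representative[OF L] by blast
  have yx: "y x = prim g x" if "x \<in> {0..1}" for x
    using d y0 interval_integral_eq_prim[OF L2_measurable[OF L] X1_measurable[OF g(1)] X1_outside[OF g(1)] g(2), of x] that
    by (simp add: has_L2_deriv_def)
  have "(LINT x|lborel. g x) = 0" using prim_ge_1[OF g(1), of 1] yx[of 1] y0 by simp
  then have g0: "g \<in> X0" using g by (simp add: X0_def)
  have "y x = prim g x" for x
  proof -
    consider "x < 0" | "x \<in> {0..1}" | "x > 1" by fastforce
    then show ?thesis
      using yx yo[of x] prim_le_0[OF g(1), of x] prim_X0_ge_1[OF g0, of x] by cases auto
  qed
  then show "\<exists>g\<in>X0. y = prim g \<and> aeq (L2_deriv y) g" using g0 g(2) by (intro bexI[of _ g]) auto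
qed

text \<open>\<open>L2_deriv\<close> picks an arbitrary representative; injectivity of primitives
  identifies it with \<open>g\<close> almost everywhere.\<close>

lemma L2_deriv_prim:
  assumes g: "g \<in> X0"
  shows "L2_deriv (prim g) \<in> L2" "aeq (L2_deriv (prim g)) g"
proof -
  show "L2_deriv (prim g) \<in> L2" by (rule H_representative(1)[OF prim_in_H[OF g]])
  obtain h where h: "h \<in> X0" "prim g = prim h" "aeq (L2_deriv (prim g)) h"
    using H_representative(2)[OF prim_in_H[OF g]] by blast
  have "AE x in lborel. g x = h x" using prim_inject_AE[OF X0_X1[OF g] X0_X1[OF h(1)]] h(2) by simp
  with h(3)[unfolded aeq_def] show "aeq (L2_deriv (prim g)) g"
    unfolding aeq_def by eventually_elim auto
qed

lemma prim_zero_n2: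
  assumes g: "g \<in> X1" and z: "\<And>x. prim g x = 0"
  shows "n2 g = 0"
proof -
  have 0: "(\<lambda>x. 0) \<in> X1" using X1_lincl by (simp add: lincl_def)
  have "AE x in lborel. g x = (\<lambda>x. 0) x"
    by (rule prim_inject_AE[OF g 0]) (simp add: z, simp add: prim_def)
  then have "(LINT x|lborel. (norm (g x))\<^sup>2) = 0" by (intro integral_eq_zero_AE) (auto elim: eventually_mono)
  then show ?thesis by (simp add: n2_def)
qed

lemma H_norm_prim:
  assumes g: "g \<in> X0" shows "H_norm (prim g) = n2 g"
proof -
  have [measurable]: "L2_deriv (prim g) \<in> borel_measurable unit_leb" "g \<in> borel_measurable borel"
    using L2_deriv_prim[OF g] L2_measurable X1_measurable[OF X0_X1[OF g]] by auto
  have "of_real (LINT x|unit_leb. (norm (L2_deriv (prim g) x))\<^sup>2) =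
    (LINT x|unit_leb. of_real ((norm (L2_deriv (prim g) x))\<^sup>2) :: complex)"
    by (simp only: integral_complex_of_real)
  also have "\<dots> = (LINT x|lborel. of_real ((norm (g x))\<^sup>2))"
  proof (rule unit_integral_eq)
    show "aeq (\<lambda>x. of_real ((norm (L2_deriv (prim g) x))\<^sup>2)) (\<lambda>x. of_real ((norm (g x))\<^sup>2))"
      using L2_deriv_prim(2)[OF g] unfolding aeq_def by eventually_elim auto
  qed (use X1_outside[OF X0_X1[OF g]] in auto)
  also have "\<dots> = of_real (LINT x|lborel. (norm (g x))\<^sup>2)" by (simp only: integral_complex_of_real)
  finally have "(LINT x|unit_leb. (norm (L2_deriv (prim g) x))\<^sup>2) = (LINT x|lborel. (norm (g x))\<^sup>2)"
    by (simp only: of_real_eq_iff)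
  then show ?thesis by (simp add: H_norm_def n2_def)
qed

lemma prim_cut: "0 \<le> t \<Longrightarrow> t \<le> x \<Longrightarrow> g \<in> X1 \<Longrightarrow> prim (cut 0 x g) t = prim g t"
  unfolding prim_def
  by (intro Bochner_Integration.integral_cong) (auto simp: cut_def X1_outside)

text \<open>\<open>integral_product_rule\<close> for the factors truncated at \<open>x\<close> is
  the pointwise product rule. It shows that the argument of \<open>\<rho>\<close> in the pencil lies
  in \<open>H\<close> and has derivative \<open>k\<close>.\<close>

lemma prim_product:
  assumes g: "g \<in> X0" and h: "h \<in> X0"
  defines "k \<equiv> (\<lambda>x. cnj (g x) * prim h x + cnj (prim g x) * h x)"
  shows "k \<in> X0" "prim k = (\<lambda>x. cnj (prim g x) * prim h x)"
proof -
  have g1: "g \<in> X1" and h1: "h \<in> X1" and c1: "(\<lambda>x. cnj (g x)) \<in> X1"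
    using g h by (auto intro: X0_X1 cnj_X1)
  have [measurable]: "g \<in> borel_measurable borel" "h \<in> borel_measurable borel"
    "prim g \<in> borel_measurable borel" "prim h \<in> borel_measurable borel"
    using g1 h1 by (auto intro: X1_measurable prim_measurable)
  have "(\<lambda>x. cnj (g x) * prim h x) \<in> l2"
    by (rule l2_dominated[OF X1_l2[OF g1], of _ "n2 h"])
      (use prim_bound[OF h1] in \<open>auto simp: norm_mult mult.commute[of "n2 h"] intro: mult_left_mono\<close>)
  moreover have "(\<lambda>x. cnj (prim g x) * h x) \<in> l2"
    by (rule l2_dominated[OF X1_l2[OF h1], of _ "n2 g"])
      (use prim_bound[OF g1] in \<open>auto simp: norm_mult intro: mult_right_mono\<close>)
  ultimately have "(\<lambda>x. 1 * (cnj (g x) * prim h x) + cnj (prim g x) * h x) \<in> l2"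
    using l2_lincl[unfolded lincl_def, THEN conjunct2, rule_format] by blast
  then have k1: "k \<in> X1" using X1_outside[OF g1] X1_outside[OF h1] unfolding k_def X1_def by simp
  have pk: "prim k x = cnj (prim g x) * prim h x" if x: "0 \<le> x" for x
  proof -
    have "prim k x = (LINT t|lborel. cut 0 x (\<lambda>x. cnj (g x)) t * prim (cut 0 x h) t +
      prim (cut 0 x (\<lambda>x. cnj (g x))) t * cut 0 x h t)"
      unfolding prim_def[of k]
    proof (intro Bochner_Integration.integral_cong refl)
      fix t
      show "(if t \<le> x then k t else 0) = cut 0 x (\<lambda>x. cnj (g x)) t * prim (cut 0 x h) t +
        prim (cut 0 x (\<lambda>x. cnj (g x))) t * cut 0 x h t"
      proof (cases "0 < t \<and> t \<le> x")
        case True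
        then show ?thesis
          using prim_cut[of t x h, OF _ _ h1] prim_cut[of t x "\<lambda>x. cnj (g x)", OF _ _ c1]
          by (simp add: k_def prim_cnj cut_def)
      next
        case False
        then show ?thesis using X1_outside[OF k1, of t] by (auto simp: cut_def)
      qed
    qed
    also have "\<dots> = (LINT t|lborel. cut 0 x (\<lambda>x. cnj (g x)) t) * (LINT t|lborel. cut 0 x h t)"
      by (rule integral_product_rule[OF cut_X1[OF c1] cut_X1[OF h1]])
    also have "\<dots> = cnj (prim g x) * prim h x"
      using prim_diff[OF c1 x] prim_diff[OF h1 x] prim_le_0[OF c1, of 0] prim_le_0[OF h1, of 0]
      by (simp add: prim_cnj)
    finally show ?thesis .
  qed
  show "prim k = (\<lambda>x. cnj (prim g x) * prim h x)"
  proof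
    fix x
    show "prim k x = cnj (prim g x) * prim h x"
      using pk[of x] prim_le_0[OF k1, of x] prim_le_0[OF g1, of x] by (cases "0 \<le> x") auto
  qed
  show "k \<in> X0"
    using k1 pk[of 1] prim_ge_1[OF k1, of 1] prim_X0_ge_1[OF h, of 1] by (simp add: X0_def)
qed

lemma comb_prim:
  assumes "finite V" "V \<subseteq> X1"
  shows "prim (comb V c) = (\<lambda>x. \<Sum>v\<in>V. c v * prim v x)"
proof
  fix x
  have "linf X1 (\<lambda>u. prim u x)" unfolding linf_def using prim_lin X1_integrable by blast
  then show "prim (comb V c) x = (\<Sum>v\<in>V. c v * prim v x)" using linf_comb[OF X1_lincl assms] by blast
qed

lemma sum_cfun_apply:
  fixes f :: "'k \<Rightarrow> cfn"
  shows "(\<Sum>k\<in>K. f k) = (\<lambda>x. \<Sum>k\<in>K. f k x)"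
  by (induction K rule: infinite_finite_induct) (auto simp: fun_eq_iff)

text \<open>Extracting just \<open>Suc m\<close> elements of a basis treats infinite and finite
  dimension alike.\<close>

lemma edim_gt_obtains_independent:
  assumes M: "cfun.subspace M" and gt: "edim M > enat m"
  obtains B where "finite B" "B \<subseteq> M" "\<not> cfun.dependent B" "card B = Suc m"
proof -
  obtain B0 where B0: "B0 \<subseteq> M" "\<not> cfun.dependent B0" "M \<subseteq> cfun.span B0" "card B0 = cfun.dim M"
    using cfun.basis_exists by blast
  have spanB0: "cfun.span B0 = M" using B0 M cfun.span_minimal by blast
  have "\<exists>B\<subseteq>B0. finite B \<and> card B = Suc m"
  proof (cases "finite B0")
    case True
    then have "edim M = enat (card B0)" using spanB0 B0(4) unfolding edim_def by auto
    then have "Suc m \<le> card B0" using gt by simp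
    then show ?thesis using obtain_subset_with_card_n[of "Suc m" B0] True by (metis finite_subset)
  next
    case False
    then show ?thesis using infinite_arbitrarily_large[of B0 "Suc m"] by blast
  qed
  then show ?thesis using that B0 cfun.independent_mono by (metis subset_trans)
qed

section \<open>The index of inertia of the pencil as the index of the form\<close>

locale pencil_weight = weight +
  fixes P :: cfn and \<rho> :: functional
  assumes P_L2: "P \<in> L2" and P_p: "aeq P p" and deriv: "is_derivative_of \<rho> P"
    and bounded: "\<And>lam. \<exists>m. negbound X0 (frm p lam) m"
begin

lemma pairing_product:
  assumes g: "g \<in> X0" and h: "h \<in> X0"
  shows "pairing \<rho> (\<lambda>x. cnj (prim g x) * prim h x) = - bf p g h"
proof -
  define k where "k = (\<lambda>x. cnj (g x) * prim h x + cnj (prim g x) * h x)"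
  have k: "k \<in> X0" "prim k = (\<lambda>x. cnj (prim g x) * prim h x)"
    unfolding k_def by (rule prim_product[OF g h])+
  have [measurable]: "P \<in> borel_measurable unit_leb" "L2_deriv (prim k) \<in> borel_measurable unit_leb"
    "p \<in> borel_measurable borel" "k \<in> borel_measurable borel"
    using P_L2 L2_deriv_prim(1)[OF k(1)] L2_measurable l2_measurable[OF p_l2] X1_measurable[OF X0_X1[OF k(1)]] by auto
  have "pairing \<rho> (prim k) = - (LINT x|unit_leb. P x * cnj (L2_deriv (prim k) x))"
    using deriv prim_in_H[OF k(1)] by (simp add: is_derivative_of_def)
  also have "(LINT x|unit_leb. P x * cnj (L2_deriv (prim k) x)) = (LINT x|lborel. p x * cnj (k x))"
  proof (rule unit_integral_eq)
    show "aeq (\<lambda>x. P x * cnj (L2_deriv (prim k) x)) (\<lambda>x. p x * cnj (k x))"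
      using L2_deriv_prim(2)[OF k(1)] P_p unfolding aeq_def by eventually_elim auto
  qed (use X1_outside[OF X0_X1[OF k(1)]] in auto)
  also have "\<dots> = bf p g h" by (simp add: bf_def k_def)
  finally show ?thesis unfolding k(2) .
qed

lemma pencil_prim:
  assumes g: "g \<in> X0" and h: "h \<in> X0"
  shows "pencil \<rho> (complex_of_real lam) (prim g) (prim h) = frm p lam g h"
proof -
  have [measurable]: "L2_deriv (prim g) \<in> borel_measurable unit_leb" "L2_deriv (prim h) \<in> borel_measurable unit_leb"
    "g \<in> borel_measurable borel" "h \<in> borel_measurable borel"
    using L2_deriv_prim(1)[OF g] L2_deriv_prim(1)[OF h] L2_measurable X1_measurable X0_X1 g h by auto
  have "(LINT x|unit_leb. L2_deriv (prim g) x * cnj (L2_deriv (prim h) x)) = ip g h"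
    unfolding ip_def
  proof (rule unit_integral_eq)
    show "aeq (\<lambda>x. L2_deriv (prim g) x * cnj (L2_deriv (prim h) x)) (\<lambda>x. g x * cnj (h x))"
      using L2_deriv_prim(2)[OF g] L2_deriv_prim(2)[OF h] unfolding aeq_def by eventually_elim auto
  qed (use X1_outside[OF X0_X1[OF g]] in auto)
  then show ?thesis
    using prim_in_H[OF h] pairing_product[OF g h] unfolding pencil_def frm_def by simp
qed

lemma frm_real: "g \<in> X0 \<Longrightarrow> frm p lam g g = of_real (Re (frm p lam g g))"
  using herm_sym[OF herm_frm, of g g lam] by (metis Reals_cnj_iff complex_is_Real_iff of_real_Re)

text \<open>The primitives of a negative family span a negative subspace of the same dimension: a
  nontrivial combination is negative for the form, so its primitive cannot vanish
  identically.\<close>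

lemma ind_ge:
  assumes V: "negset X0 (frm p lam) V"
  shows "enat (card V) \<le> ind (pencil \<rho> (complex_of_real lam))"
proof -
  have fV: "finite V" "V \<subseteq> X0" using V by (auto simp: negset_def)
  then have V1: "V \<subseteq> X1" using X0_X1 by blast
  obtain \<epsilon> where \<epsilon>: "\<epsilon> > 0" "\<And>c. Re (frm p lam (comb V c) (comb V c)) \<le> - \<epsilon> * (n2 (comb V c))\<^sup>2"
    using negset_uniform[OF V] by blast
  have nz: "\<exists>x. prim (comb V c) x \<noteq> 0" if "\<exists>v\<in>V. c v \<noteq> 0" for c
  proof (rule ccontr)
    assume "\<not> ?thesis"
    then have "n2 (comb V c) = 0" using prim_zero_n2 comb_mem[OF X1_lincl fV(1) V1] by blast
    then have "frm p lam (comb V c) (comb V c) = 0"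
      using frm_bound[OF comb_mem[OF X1_lincl fV(1) V1] comb_mem[OF X1_lincl fV(1) V1], of lam c c] by simp
    then show False using negset_comb_neg[OF herm_frm V that] by simp
  qed
  have inj: "inj_on prim V"
  proof (rule inj_onI, rule ccontr)
    fix v w assume vw: "v \<in> V" "w \<in> V" "prim v = prim w" "v \<noteq> w"
    \<comment> \<open>The combination \<open>v - w\<close> has zero primitive, which is impossible
      for distinct members of the family.\<close>
    define c where "c = (\<lambda>u. if u = v then 1 else if u = w then -1 else 0 :: complex)"
    have "prim (comb V c) x = (\<Sum>u\<in>{v, w}. c u * prim u x)" for x
      unfolding comb_prim[OF fV(1) V1]
      by (rule sum.mono_neutral_right) (use vw fV in \<open>auto simp: c_def\<close>)
    then have "prim (comb V c) x = 0" for x using vw by (simp add: c_def)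
    moreover have "\<exists>u\<in>V. c u \<noteq> 0" using vw(1) by (intro bexI[of _ v]) (simp_all add: c_def)
    ultimately show False using nz[of c] by blast
  qed
  define M where "M = cfun.span (prim ` V)"
  have sum_eq: "(\<Sum>w\<in>prim ` V. (\<lambda>x. u w * w x)) = prim (comb V (\<lambda>v. u (prim v)))" for u
    unfolding comb_prim[OF fV(1) V1] sum.reindex[OF inj] by (simp add: sum_cfun_apply)
  have M: "M = range (\<lambda>u. prim (comb V (\<lambda>v. u (prim v))))"
    unfolding M_def cfun.span_finite[OF finite_imageI[OF fV(1)]] sum_eq ..
  have "\<not> cfun.dependent (prim ` V)"
  proof
    assume "cfun.dependent (prim ` V)"
    then obtain u where u: "\<exists>w\<in>prim ` V. u w \<noteq> 0" "(\<Sum>w\<in>prim ` V. (\<lambda>x. u w * w x)) = 0"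
      using cfun.dependent_finite[OF finite_imageI[OF fV(1)]] by blast
    then show False using nz[of "\<lambda>v. u (prim v)"] unfolding sum_eq by auto
  qed
  then have "cfun.dim M = card V"
    unfolding M_def using cfun.dim_span_eq_card_independent inj by (simp add: card_image)
  then have dimM: "edim M = enat (card V)" unfolding edim_def M_def using fV by auto
  have "neg_subspace (pencil \<rho> (complex_of_real lam)) M"
    unfolding neg_subspace_def
  proof (intro conjI exI[of _ \<epsilon>] ballI \<epsilon>(1))
    show "cfun.subspace M" unfolding M_def by simp
    have comb0: "comb V c \<in> X0" for c by (rule comb_mem[OF X0_lincl fV])
    show "M \<subseteq> H" unfolding M using prim_in_H[OF comb0] by auto
    fix y assume "y \<in> M"
    then obtain c where y: "y = prim (comb V c)" unfolding M by blast
    show "pairing (pencil \<rho> (complex_of_real lam) y) y \<le> - of_real (\<epsilon> * (H_norm y)\<^sup>2)"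
      unfolding y pairing_def pencil_prim[OF comb0 comb0] H_norm_prim[OF comb0]
      using \<epsilon>(2)[of c] frm_real[OF comb0, of lam c] by (simp add: less_eq_complex_def complex_eq_iff)
  qed
  then have "edim M \<le> ind (pencil \<rho> (complex_of_real lam))"
    unfolding ind_def by (intro SUP_upper) simp
  then show ?thesis unfolding dimM .
qed

text \<open>A negative subspace of dimension above \<open>Nf lam\<close> contains a nonzero element
  orthogonal to a maximal family. There the form is both nonnegative and at most
  \<open>- \<epsilon>\<close> times the squared norm, which forces the element to vanish.\<close>

lemma ind_le: "ind (pencil \<rho> (complex_of_real lam)) \<le> enat (Nf lam)"
  unfolding ind_def
proof (rule SUP_least, rule ccontr)
  fix M assume "M \<in> {M. neg_subspace (pencil \<rho> (complex_of_real lam)) M}" and "\<not> edim M \<le> enat (Nf lam)"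
  then obtain \<epsilon> where sub: "cfun.subspace M" "M \<subseteq> H" and gt: "edim M > enat (Nf lam)" and \<epsilon>: "\<epsilon> > 0"
    and neg: "\<And>y. y \<in> M \<Longrightarrow> pairing (pencil \<rho> (complex_of_real lam) y) y \<le> - of_real (\<epsilon> * (H_norm y)\<^sup>2)"
    by (auto simp: neg_subspace_def)
  obtain B where B: "finite B" "B \<subseteq> M" "\<not> cfun.dependent B" "card B = Suc (Nf lam)"
    using edim_gt_obtains_independent[OF sub(1) gt] .
  obtain m where m: "negbound X0 (frm p lam) m" using bounded by blast
  obtain V where V: "negset X0 (frm p lam) V" "card V = Nf lam"
    and max: "\<And>g. g \<in> X0 \<Longrightarrow> (\<And>v. v \<in> V \<Longrightarrow> frm p lam g v = 0) \<Longrightarrow> Re (frm p lam g g) \<ge> 0"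
    using nind_maximal[OF herm_frm m] unfolding Nf_def by metis
  have fV: "finite V" "V \<subseteq> X0" using V(1) by (auto simp: negset_def)
  have "\<forall>b\<in>B. \<exists>g\<in>X0. b = prim g" using B(2) sub(2) H_representative(2) by blast
  then obtain G where G: "\<And>b. b \<in> B \<Longrightarrow> G b \<in> X0" "\<And>b. b \<in> B \<Longrightarrow> prim (G b) = b" by metis
  have injG: "inj_on G B" using G(2) by (metis inj_onI)
  define W where "W = G ` B"
  have fW: "finite W" "W \<subseteq> X0" "W \<subseteq> X1" and cW: "card V < card W"
    using B G injG X0_X1 V(2) by (auto simp: W_def card_image)
  obtain c where c: "\<exists>w\<in>W. c w \<noteq> 0" "\<forall>v\<in>V. (\<Sum>w\<in>W. c w * frm p lam w v) = 0"
    using linear_system_nontrivial[OF fV(1) fW(1) cW, of "\<lambda>v w. frm p lam w v"] by blast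
  define u where "u = comb W c"
  have u: "u \<in> X0" unfolding u_def by (rule comb_mem[OF X0_lincl fW(1,2)])
  have "prim u = (\<Sum>b\<in>B. (\<lambda>x. c (G b) * b x))"
    unfolding u_def comb_prim[OF fW(1,3)] sum_cfun_apply unfolding W_def sum.reindex[OF injG]
    using G(2) by (auto intro!: sum.cong)
  moreover have "(\<Sum>b\<in>B. (\<lambda>x. c (G b) * b x)) \<in> M"
    by (rule cfun.subspace_sum[OF sub(1)]) (use cfun.subspace_scale[OF sub(1)] B(2) in blast)
  moreover have "(\<Sum>b\<in>B. (\<lambda>x. c (G b) * b x)) \<noteq> 0"
  proof
    assume "(\<Sum>b\<in>B. (\<lambda>x. c (G b) * b x)) = 0"
    moreover have "\<exists>b\<in>B. c (G b) \<noteq> 0" using c(1) by (auto simp: W_def)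
    ultimately have "\<exists>u. (\<exists>b\<in>B. u b \<noteq> 0) \<and> (\<Sum>b\<in>B. (\<lambda>x. u b * b x)) = 0"
      by (intro exI[of _ "\<lambda>b. c (G b)"] conjI)
    then show False using B(3) unfolding cfun.dependent_finite[OF B(1)] by (rule notE[rotated])
  qed
  ultimately have uM: "prim u \<in> M" and unz: "prim u \<noteq> 0" by auto
  have "Re (frm p lam u u) \<ge> 0"
  proof (rule max[OF u])
    fix v assume v: "v \<in> V"
    then show "frm p lam u v = 0"
      using c(2) herm_comb_left[OF herm_frm fW(1,2), of v lam c] fV(2) unfolding u_def by auto
  qed
  moreover have "Re (frm p lam u u) \<le> - (\<epsilon> * (n2 u)\<^sup>2)"
    using neg[OF uM] unfolding pairing_def pencil_prim[OF u u] H_norm_prim[OF u] by (simp add: less_eq_complex_def)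
  ultimately have "\<epsilon> * (n2 u)\<^sup>2 \<le> 0" by linarith
  then have "n2 u = 0" using \<epsilon> by (simp add: mult_le_0_iff)
  then have "prim u x = 0" for x using prim_bound[OF X0_X1[OF u], of x] by simp
  then show False using unz by (simp add: fun_eq_iff)
qed

lemma ind_eq: "ind (pencil \<rho> (complex_of_real lam)) = enat (Nf lam)"
proof (rule antisym[OF ind_le])
  obtain m where m: "negbound X0 (frm p lam) m" using bounded by blast
  obtain V where "negset X0 (frm p lam) V" "card V = Nf lam" using nind_attained[OF m] unfolding Nf_def by metis
  then show "enat (Nf lam) \<le> ind (pencil \<rho> (complex_of_real lam))" using ind_ge by metis
qed

lemma Nf_pos_eventually:
  assumes y: "y \<in> H" and s: "s = 1 \<or> s = -1"
    and pos: "s * Re (pairing \<rho> (\<lambda>x. complex_of_real ((norm (y x))\<^sup>2))) > 0"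
  shows "\<exists>l0>0. \<forall>l\<ge>l0. Nf (s * l) \<ge> 1"
proof -
  obtain g where g: "g \<in> X0" "y = prim g" using H_representative(2)[OF y] by blast
  have "(\<lambda>x. complex_of_real ((norm (y x))\<^sup>2)) = (\<lambda>x. cnj (prim g x) * prim g x)"
    unfolding g(2) complex_norm_square by (simp add: mult.commute)
  then have b: "s * Re (bf p g g) < 0" using pos pairing_product[OF g(1) g(1)] by simp
  define b where "b = - (s * Re (bf p g g))"
  have b: "b > 0" using b by (simp add: b_def)
  show ?thesis
  \<comment> \<open>From this threshold on, \<open>l * b\<close> exceeds the squared norm of the
    single test element \<open>g\<close>; the sign comes from the minus in
    \<open>pairing_product\<close>.\<close>
  proof (intro exI[of _ "((n2 g)\<^sup>2 + 1) / b"] conjI allI impI)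
    show "0 < ((n2 g)\<^sup>2 + 1) / b" using b by (simp add: add_nonneg_pos)
    fix l assume "((n2 g)\<^sup>2 + 1) / b \<le> l"
    then have "(n2 g)\<^sup>2 + 1 \<le> l * b" using b by (simp add: field_simps)
    then have "Re (frm p (s * l) g g) < 0" unfolding frm_self by (simp add: b_def algebra_simps)
    then have "negset X0 (frm p (s * l)) {g}" using g by (simp add: negset_def)
    then have "card {g} \<le> Nf (s * l)" using card_le_nind bounded unfolding Nf_def by metis
    then show "1 \<le> Nf (s * l)" by simp
  qed
qed

end

section \<open>Asymptotics of solutions of the counting recursion\<close>

text \<open>What is kept of the spectral problem: the two-sided recursion, vanishing near 0 and unit
  jumps. Time is the logarithm of the parameter in units of \<open>\<nu>\<close>, so a cell acts as
  a delay \<open>l k\<close> and a sign \<open>e k\<close>.\<close>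

locale counting_recursion =
  fixes N :: "real \<Rightarrow> nat" and K :: "'k set" and l :: "'k \<Rightarrow> nat" and e :: "'k \<Rightarrow> real"
    and \<kappa> \<nu> M :: real
  assumes finK: "finite K" and l_pos: "\<And>k. k \<in> K \<Longrightarrow> l k \<ge> 1"
    and e_sign: "\<And>k. k \<in> K \<Longrightarrow> e k = 1 \<or> e k = -1"
    and gcd1: "\<And>g::nat. (\<And>k. k \<in> K \<Longrightarrow> g dvd l k) \<Longrightarrow> g = 1"
    and \<kappa>: "\<kappa> > 0" and \<nu>: "\<nu> > 0" and M: "M \<ge> 0"
    and p_sum: "(\<Sum>k\<in>K. exp (- \<kappa> * real (l k))) = 1"
    and N_lower: "\<And>\<sigma> t. (\<Sum>k\<in>K. real (N (\<sigma> * e k * exp (\<nu> * (t - real (l k)))))) \<le> real (N (\<sigma> * exp (\<nu> * t)))"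
    and N_upper: "\<And>\<sigma> t. real (N (\<sigma> * exp (\<nu> * t))) \<le> (\<Sum>k\<in>K. real (N (\<sigma> * e k * exp (\<nu> * (t - real (l k)))))) + M"
    and N_small: "\<exists>t0. \<forall>t\<le>t0. \<forall>\<sigma>\<in>{1, -1}. N (\<sigma> * exp (\<nu> * t)) = 0"
    and N_jump: "\<And>\<sigma> t. \<exists>\<delta>>0. \<forall>t'. \<bar>t' - t\<bar> < \<delta> \<longrightarrow> \<bar>real (N (\<sigma> * exp (\<nu> * t'))) - real (N (\<sigma> * exp (\<nu> * t)))\<bar> \<le> 1"
begin

definition p :: "'k \<Rightarrow> real" where
  "p k = exp (- \<kappa> * real (l k))"

definition u :: "real \<Rightarrow> real \<Rightarrow> real" where
  "u \<sigma> t = exp (- \<kappa> * t) * real (N (\<sigma> * exp (\<nu> * t)))"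

definition L :: nat where
  "L = (\<Sum>k\<in>K. l k)"

lemma l_le_L: "k \<in> K \<Longrightarrow> l k \<le> L"
  unfolding L_def by (rule member_le_sum) (use finK in auto)

lemma K_nonempty: "K \<noteq> {}"
  using p_sum by auto

lemma p_pos: "p k > 0"
  by (simp add: p_def)

lemma p_sum1: "(\<Sum>k\<in>K. p k) = 1"
  using p_sum by (simp add: p_def)

lemma u_nonneg: "u \<sigma> t \<ge> 0"
  by (simp add: u_def)

lemma pu: "p k * u \<sigma> (t - real (l k)) = exp (- \<kappa> * t) * real (N (\<sigma> * exp (\<nu> * (t - real (l k)))))"
  unfolding p_def u_def by (simp add: algebra_simps flip: exp_add)

lemma u_lower: "(\<Sum>k\<in>K. p k * u (\<sigma> * e k) (t - real (l k))) \<le> u \<sigma> t"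
  unfolding pu sum_distrib_left[symmetric] unfolding u_def by (intro mult_left_mono N_lower) auto

lemma u_upper: "u \<sigma> t \<le> (\<Sum>k\<in>K. p k * u (\<sigma> * e k) (t - real (l k))) + M * exp (- \<kappa> * t)"
proof -
  have "u \<sigma> t \<le> exp (- \<kappa> * t) * ((\<Sum>k\<in>K. real (N (\<sigma> * e k * exp (\<nu> * (t - real (l k)))))) + M)"
    unfolding u_def by (intro mult_left_mono N_upper) auto
  then show ?thesis unfolding pu sum_distrib_left[symmetric] by (simp add: algebra_simps)
qed

text \<open>Adding \<open>A * exp (- \<kappa> * t)\<close> absorbs the error \<open>M\<close>, so
  that the sum is at most the average of its past values. It is bounded on an interval of length
  \<open>L\<close> on which \<open>u\<close> vanishes, and delays of at least 1 carry the bound on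
  in unit steps.\<close>

lemma u_bounded: "\<exists>B. \<forall>\<sigma>\<in>{1, -1}. \<forall>t. u \<sigma> t \<le> B"
proof -
  obtain t0 where t0': "\<forall>t\<le>t0. \<forall>\<sigma>\<in>{1, -1}. N (\<sigma> * exp (\<nu> * t)) = 0"
    using N_small ..
  have t0: "N (\<sigma> * exp (\<nu> * t)) = 0" if "t \<le> t0" "\<sigma> \<in> {1, -1}" for t \<sigma>
    by (rule t0'[THEN spec, THEN mp, THEN bspec, OF that])
  \<comment> \<open>The solution of \<open>A + M = A * exp \<kappa>\<close>, where
    \<open>exp \<kappa>\<close> is the least gain from looking back by at least one unit.\<close>
  define A where "A = M / (exp \<kappa> - 1)"
  have e1: "exp \<kappa> > 1" using \<kappa> by simp
  have A: "A \<ge> 0" "A + M \<le> A * exp \<kappa>" using M e1 unfolding A_def by (auto simp: field_simps)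
  define z where "z \<sigma> t = u \<sigma> t + A * exp (- \<kappa> * t)" for \<sigma> t
  define B where "B = A * exp (- \<kappa> * (t0 - real L))"
  have sub: "z \<sigma> t \<le> (\<Sum>k\<in>K. p k * z (\<sigma> * e k) (t - real (l k)))" for \<sigma> t
  proof -
    have "(A + M) * exp (- \<kappa> * t) \<le> A * exp \<kappa> * exp (- \<kappa> * t)"
      using A by (intro mult_right_mono) auto
    also have "\<dots> = A * exp (- \<kappa> * (t - 1))" by (simp add: algebra_simps flip: exp_add)
    also have "\<dots> = (\<Sum>k\<in>K. p k * (A * exp (- \<kappa> * (t - 1))))" by (simp only: sum_distrib_right[symmetric] p_sum1 mult_1)
    also have "\<dots> \<le> (\<Sum>k\<in>K. p k * (A * exp (- \<kappa> * (t - real (l k)))))"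
      using p_pos A l_pos \<kappa> by (intro sum_mono mult_left_mono) (auto simp: less_imp_le)
    finally have "(A + M) * exp (- \<kappa> * t) \<le> (\<Sum>k\<in>K. p k * (A * exp (- \<kappa> * (t - real (l k)))))" .
    then show ?thesis using u_upper[of \<sigma> t] unfolding z_def by (simp add: distrib_left sum.distrib distrib_right)
  qed
  have zero: "u \<sigma> t = 0" if "t \<le> t0" "\<sigma> \<in> {1, -1}" for \<sigma> t using t0[OF that] by (simp add: u_def)
  have main: "z \<sigma> t \<le> B" if "\<sigma> \<in> {1, -1}" "t0 - real L \<le> t" "t \<le> t0 + real j" for \<sigma> t j
    using that
  proof (induction j arbitrary: \<sigma> t)
    case 0
    then show ?case using zero[of t \<sigma>] A \<kappa> unfolding z_def B_def by (auto intro!: mult_left_mono)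
  next
    case (Suc j)
    show ?case
    proof (cases "t \<le> t0")
      case True
      then show ?thesis using zero[of t \<sigma>] A \<kappa> Suc.prems unfolding z_def B_def by (auto intro!: mult_left_mono)
    next
      case False
      have "z \<sigma> t \<le> (\<Sum>k\<in>K. p k * z (\<sigma> * e k) (t - real (l k)))" by (rule sub)
      also have "\<dots> \<le> (\<Sum>k\<in>K. p k * B)"
      proof (intro sum_mono mult_left_mono)
        fix k assume k: "k \<in> K"
        have "real (l k) \<ge> 1" "real (l k) \<le> real L" using l_pos[OF k] l_le_L[OF k] by auto
        then show "z (\<sigma> * e k) (t - real (l k)) \<le> B"
          using Suc.prems False e_sign[OF k] by (intro Suc.IH) auto
      qed (simp add: p_pos less_imp_le)
      also have "\<dots> = B" by (simp only: sum_distrib_right[symmetric] p_sum1 mult_1)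
      finally show ?thesis .
    qed
  qed
  have "u \<sigma> t \<le> max B 0" if \<sigma>: "\<sigma> \<in> {1, -1}" for \<sigma> t
  proof (cases "t \<le> t0")
    case True
    then show ?thesis using zero \<sigma> by simp
  next
    case False
    obtain j :: nat where "t - t0 \<le> real j" using real_arch_simple by blast
    then have "z \<sigma> t \<le> B" using main[OF \<sigma>, of t j] False by auto
    then show ?thesis using A unfolding z_def by (smt (verit) exp_gt_zero mult_nonneg_nonneg)
  qed
  then show ?thesis by blast
qed

text \<open>The jump of \<open>N\<close> enters multiplied by \<open>exp (- \<kappa> * t)\<close>,
  and close to \<open>t\<close> the change of the exponential factor contributes no more than that
  order.\<close>

lemma u_jump:
  "\<exists>\<delta>>0. \<forall>t'. \<bar>t' - t\<bar> < \<delta> \<longrightarrow> \<bar>u \<sigma> t' - u \<sigma> t\<bar> \<le> 3 * exp (- \<kappa> * t)"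
proof -
  obtain \<delta>1 where \<delta>1: "\<delta>1 > 0" "\<And>t'. \<bar>t' - t\<bar> < \<delta>1 \<Longrightarrow>
    \<bar>real (N (\<sigma> * exp (\<nu> * t'))) - real (N (\<sigma> * exp (\<nu> * t)))\<bar> \<le> 1"
    using N_jump[of t \<sigma>] by blast
  define n0 where "n0 = real (N (\<sigma> * exp (\<nu> * t)))"
  have "isCont (\<lambda>t. exp (- \<kappa> * t)) t" by (intro continuous_intros)
  \<comment> \<open>The tolerance is divided by \<open>n0 + 1\<close> because the change of the
    exponential is multiplied by values of \<open>N\<close> of up to this size.\<close>
  moreover have eps: "exp (- \<kappa> * t) / (n0 + 1) > 0" by (simp add: n0_def add_nonneg_pos)
  ultimately obtain \<delta>2 where \<delta>2: "\<delta>2 > 0" "\<And>t'. \<bar>t' - t\<bar> < \<delta>2 \<Longrightarrow>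
    \<bar>exp (- \<kappa> * t') - exp (- \<kappa> * t)\<bar> < exp (- \<kappa> * t) / (n0 + 1)"
    unfolding continuous_at_eps_delta dist_real_def by blast
  have "\<bar>u \<sigma> t' - u \<sigma> t\<bar> \<le> 3 * exp (- \<kappa> * t)" if t': "\<bar>t' - t\<bar> < min \<delta>1 \<delta>2" for t'
  proof -
    define x where "x = exp (- \<kappa> * t) / (n0 + 1)"
    define E where "E = exp (- \<kappa> * t') - exp (- \<kappa> * t)"
    have E: "\<bar>E\<bar> \<le> x" using \<delta>2(2)[of t'] t' unfolding x_def E_def by simp
    have n0: "n0 \<ge> 0" by (simp add: n0_def)
    have x: "x * (n0 + 1) = exp (- \<kappa> * t)" "x > 0" using n0 eps by (auto simp: x_def)
    define D where "D = real (N (\<sigma> * exp (\<nu> * t'))) - n0"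
    have D: "\<bar>D\<bar> \<le> 1" using \<delta>1(2)[of t'] t' unfolding D_def n0_def by simp
    have "u \<sigma> t' - u \<sigma> t = exp (- \<kappa> * t) * D + E * D + E * n0"
      unfolding u_def D_def E_def n0_def by (simp add: algebra_simps)
    also have "\<bar>\<dots>\<bar> \<le> \<bar>exp (- \<kappa> * t) * D\<bar> + \<bar>E * D\<bar> + \<bar>E * n0\<bar>" by linarith
    also have "\<dots> \<le> exp (- \<kappa> * t) * 1 + x * 1 + x * n0"
      unfolding abs_mult using E D n0 x(2) by (intro add_mono mult_mono) auto
    also have "\<dots> = 2 * exp (- \<kappa> * t)" using x(1) by (simp add: algebra_simps)
    finally show ?thesis by (smt (verit) exp_gt_zero)
  qed
  then show ?thesis using \<delta>1(1) \<delta>2(1) by (intro exI[of _ "min \<delta>1 \<delta>2"]) auto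
qed

text \<open>The walk with steps \<open>l k\<close> and sign changes \<open>e k\<close> is irreducible and aperiodic on \<open>T\<close>.\<close>

definition mixing :: "real set \<Rightarrow> bool" where
  "mixing T \<longleftrightarrow> T \<subseteq> {1, -1} \<and> (\<forall>\<sigma>\<in>T. \<forall>k\<in>K. \<sigma> * e k \<in> T) \<and>
    (\<exists>J. \<forall>s\<ge>J. \<forall>\<sigma>\<in>T. \<forall>\<tau>\<in>T. \<exists>\<rho>. reach K l e s \<rho> \<and> \<sigma> * \<rho> = \<tau>)"

lemma reach_total: "\<exists>J. \<forall>s\<ge>J. \<exists>\<tau>. reach K l e s \<tau>"
  using K_nonempty l_pos gcd1 by (intro reach_eventually) (auto simp: Suc_le_eq)

lemma reach_sign: "reach K l e s \<tau> \<Longrightarrow> \<tau> = 1 \<or> \<tau> = -1"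
  by (induction rule: reach.induct) (auto dest: e_sign)

lemma mixing_single:
  assumes pos: "\<And>k. k \<in> K \<Longrightarrow> e k = 1" and \<sigma>: "\<sigma> \<in> {1, -1}"
  shows "mixing {\<sigma>}"
proof -
  have one: "\<tau> = 1" if "reach K l e s \<tau>" for s \<tau>
    using that by (induction rule: reach.induct) (use pos in auto)
  show ?thesis unfolding mixing_def using reach_total one pos \<sigma> by fastforce
qed

text \<open>The word of \<open>l i\<close> letters \<open>k\<close> and the word of
  \<open>l k\<close> letters \<open>i\<close> have the same delay but different signs. Appended to a
  word of the remaining delay, they make both signs available at every large time.\<close>

lemma mixing_both:
  assumes k: "k \<in> K" "i \<in> K" and ne: "e k ^ l i \<noteq> e i ^ l k"
  shows "mixing {1, -1}"
proof -
  obtain J where J: "\<And>s. s \<ge> J \<Longrightarrow> \<exists>\<tau>. reach K l e s \<tau>" using reach_total by blast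
  define s0 where "s0 = l i * l k"
  have r1: "reach K l e s0 (e k ^ l i)" using reach_mult[OF reach_single[OF k(1)]] by (simp add: s0_def)
  have r2: "reach K l e s0 (e i ^ l k)"
    using reach_mult[OF reach_single[OF k(2)], where m = "l k"] by (simp add: s0_def mult.commute)
  have s0: "reach K l e s0 \<rho>" if "\<rho> = 1 \<or> \<rho> = -1" for \<rho>
    using r1 r2 reach_sign[OF r1] reach_sign[OF r2] ne that by metis
  have all: "reach K l e s \<rho>" if s: "s \<ge> J + s0" and \<rho>: "\<rho> = 1 \<or> \<rho> = -1" for s \<rho>
  proof -
    have "J \<le> s - s0" using s by simp
    then obtain \<tau> where \<tau>: "reach K l e (s - s0) \<tau>" using J by blast
    have \<tau>s: "\<tau> = 1 \<or> \<tau> = -1" by (rule reach_sign[OF \<tau>])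
    have "reach K l e ((s - s0) + s0) (\<tau> * (\<tau> * \<rho>))"
      by (rule reach_add[OF \<tau> s0]) (use \<tau>s \<rho> in auto)
    moreover have "\<tau> * (\<tau> * \<rho>) = \<rho>" using \<tau>s by auto
    ultimately show ?thesis using s by simp
  qed
  show ?thesis unfolding mixing_def
  proof (intro conjI exI[of _ "J + s0"] allI impI ballI)
    fix s \<sigma> \<tau> assume s: "J + s0 \<le> s" and "\<sigma> \<in> {1, -1::real}" "\<tau> \<in> {1, -1::real}"
    then show "\<exists>\<rho>. reach K l e s \<rho> \<and> \<sigma> * \<rho> = \<tau>"
      using all[OF s, of "\<sigma> * \<tau>"] by (intro exI[of _ "\<sigma> * \<tau>"]) auto
  qed (auto dest: e_sign)
qed

text \<open>Along \<open>\<tau> + real j\<close> the error of the renewal equation is geometric in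
  \<open>j\<close>, and its constant depends on \<open>\<tau>\<close> only through
  \<open>\<tau> \<ge> -1\<close>. The margin below 0 leaves room for comparing the limit at
  neighbouring points.\<close>

lemma u_osc:
  assumes T: "mixing T" and \<epsilon>: "\<epsilon> > 0"
  shows "\<exists>I. \<forall>\<tau>\<ge>-1. \<forall>\<sigma>\<in>T. \<forall>\<sigma>'\<in>T. \<forall>i\<ge>I. \<forall>j\<ge>I. \<bar>u \<sigma> (\<tau> + real i) - u \<sigma>' (\<tau> + real j)\<bar> \<le> \<epsilon>"
proof -
  have T1: "T \<subseteq> {1, -1}" and T2: "\<And>\<sigma> k. \<sigma> \<in> T \<Longrightarrow> k \<in> K \<Longrightarrow> \<sigma> * e k \<in> T" using T by (auto simp: mixing_def)
  obtain J where J: "\<And>s \<sigma> \<tau>. s \<ge> J \<Longrightarrow> \<sigma> \<in> T \<Longrightarrow> \<tau> \<in> T \<Longrightarrow> \<exists>\<rho>. reach K l e s \<rho> \<and> \<sigma> * \<rho> = \<tau>"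
    using T unfolding mixing_def by metis
  have finT: "finite T" using T1 by (rule finite_subset) simp
  interpret renewal K p l e L T
    by unfold_locales (use finK p_pos p_sum1 l_pos l_le_L T2 in auto)
  obtain B where B: "\<And>\<sigma> t. \<sigma> \<in> {1, -1} \<Longrightarrow> u \<sigma> t \<le> B" using u_bounded by blast
  have r: "0 < exp (- \<kappa>)" "exp (- \<kappa>) < 1" using \<kappa> by auto
  have "M * exp \<kappa> \<ge> 0" using M by simp
  then have "\<exists>I. \<forall>x. (\<forall>\<sigma>\<in>T. \<forall>j. \<bar>x \<sigma> j\<bar> \<le> B) \<longrightarrow>
    (\<forall>\<sigma>\<in>T. \<forall>j\<ge>L. \<bar>x \<sigma> j - (\<Sum>k\<in>K. p k * x (\<sigma> * e k) (j - l k))\<bar> \<le> (M * exp \<kappa>) * exp (- \<kappa>) ^ j) \<longrightarrow>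
    (\<forall>\<sigma>\<in>T. \<forall>\<tau>\<in>T. \<forall>i\<ge>I. \<forall>j\<ge>I. \<bar>x \<sigma> i - x \<tau> j\<bar> \<le> \<epsilon>)"
    using J by (intro renewal_osc[of J, OF finT _ r _ \<epsilon>])
  then obtain I where I': "\<forall>x. (\<forall>\<sigma>\<in>T. \<forall>j. \<bar>x \<sigma> j\<bar> \<le> B) \<longrightarrow>
    (\<forall>\<sigma>\<in>T. \<forall>j\<ge>L. \<bar>x \<sigma> j - (\<Sum>k\<in>K. p k * x (\<sigma> * e k) (j - l k))\<bar> \<le> (M * exp \<kappa>) * exp (- \<kappa>) ^ j) \<longrightarrow>
    (\<forall>\<sigma>\<in>T. \<forall>\<tau>\<in>T. \<forall>i\<ge>I. \<forall>j\<ge>I. \<bar>x \<sigma> i - x \<tau> j\<bar> \<le> \<epsilon>)" ..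
  note I = I'[THEN spec, THEN mp, THEN mp]
  show ?thesis
  proof (intro exI[of _ I] allI impI)
    fix \<tau> :: real assume \<tau>: "-1 \<le> \<tau>"
    show "\<forall>\<sigma>\<in>T. \<forall>\<sigma>'\<in>T. \<forall>i\<ge>I. \<forall>j\<ge>I. \<bar>u \<sigma> (\<tau> + real i) - u \<sigma>' (\<tau> + real j)\<bar> \<le> \<epsilon>"
    proof (rule I[of "\<lambda>\<sigma> j. u \<sigma> (\<tau> + real j)"])
      show "\<forall>\<sigma>\<in>T. \<forall>j. \<bar>u \<sigma> (\<tau> + real j)\<bar> \<le> B" using B T1 u_nonneg by auto
      show "\<forall>\<sigma>\<in>T. \<forall>j\<ge>L. \<bar>u \<sigma> (\<tau> + real j) - (\<Sum>k\<in>K. p k * u (\<sigma> * e k) (\<tau> + real (j - l k)))\<bar> \<le> (M * exp \<kappa>) * exp (- \<kappa>) ^ j"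
      proof (intro ballI allI impI)
        fix \<sigma> j assume j: "L \<le> j"
        have "(\<Sum>k\<in>K. p k * u (\<sigma> * e k) (\<tau> + real (j - l k))) = (\<Sum>k\<in>K. p k * u (\<sigma> * e k) (\<tau> + real j - real (l k)))"
        proof (intro sum.cong refl)
          fix k assume "k \<in> K"
          then have "real (j - l k) = real j - real (l k)" using l_le_L j by (simp add: order_trans[OF l_le_L] of_nat_diff)
          then show "p k * u (\<sigma> * e k) (\<tau> + real (j - l k)) = p k * u (\<sigma> * e k) (\<tau> + real j - real (l k))"
            by (simp add: algebra_simps)
        qed
        moreover have "M * exp (- \<kappa> * (\<tau> + real j)) \<le> (M * exp \<kappa>) * exp (- \<kappa>) ^ j"
        proof -
          have "- \<kappa> * (\<tau> + real j) \<le> \<kappa> + real j * (- \<kappa>)" 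
            using mult_left_mono[OF \<tau>, of \<kappa>] \<kappa> by (simp add: algebra_simps)
          then have "exp (- \<kappa> * (\<tau> + real j)) \<le> exp (\<kappa> + real j * (- \<kappa>))" by simp
          also have "\<dots> = exp \<kappa> * exp (- \<kappa>) ^ j" by (simp only: exp_add exp_of_nat_mult)
          finally show ?thesis using M by (simp only: mult.assoc mult_left_mono)
        qed
        ultimately show "\<bar>u \<sigma> (\<tau> + real j) - (\<Sum>k\<in>K. p k * u (\<sigma> * e k) (\<tau> + real (j - l k)))\<bar> \<le> (M * exp \<kappa>) * exp (- \<kappa>) ^ j"
          using u_lower[of \<sigma> "\<tau> + real j"] u_upper[of \<sigma> "\<tau> + real j"] by simp
      qed
    qed
  qed
qed

section \<open>The periodic limit functions\<close>

definition s :: "real \<Rightarrow> real \<Rightarrow> real" where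
  "s \<sigma> t = lim (\<lambda>m. u \<sigma> (frac t + real m))"

lemma s_periodic: "s \<sigma> (t + of_int m) = s \<sigma> t"
  by (simp add: s_def frac_def)

context
  fixes T assumes T: "mixing T"
begin

lemma s_limit:
  assumes \<sigma>: "\<sigma> \<in> T"
  shows "(\<lambda>m. u \<sigma> (frac t + real m)) \<longlonglongrightarrow> s \<sigma> t"
proof -
  have "Cauchy (\<lambda>m. u \<sigma> (frac t + real m))"
  proof (rule CauchyI')
    fix \<epsilon> :: real assume "\<epsilon> > 0"
    then obtain I where "\<forall>\<tau>\<ge>-1. \<forall>\<sigma>\<in>T. \<forall>\<sigma>'\<in>T. \<forall>i\<ge>I. \<forall>j\<ge>I. \<bar>u \<sigma> (\<tau> + real i) - u \<sigma>' (\<tau> + real j)\<bar> \<le> \<epsilon> / 2"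
      using u_osc[OF T, of "\<epsilon> / 2"] by auto
    then have "\<bar>u \<sigma> (frac t + real i) - u \<sigma> (frac t + real j)\<bar> < \<epsilon>" if "i \<ge> I" "j \<ge> I" for i j
      using \<sigma> that \<open>\<epsilon> > 0\<close> frac_ge_0[of t] by (smt (verit) field_sum_of_halves)
    then show "\<exists>M. \<forall>m\<ge>M. \<forall>n>m. dist (u \<sigma> (frac t + real m)) (u \<sigma> (frac t + real n)) < \<epsilon>"
      unfolding dist_real_def by (intro exI[of _ I]) auto
  qed
  then show ?thesis unfolding s_def by (simp add: Cauchy_convergent_iff convergent_LIMSEQ_iff)
qed

lemma s_nonneg: "\<sigma> \<in> T \<Longrightarrow> s \<sigma> t \<ge> 0"
  by (rule LIMSEQ_le_const[OF s_limit]) (auto simp: u_nonneg)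

lemma s_equal:
  assumes "\<sigma> \<in> T" "\<sigma>' \<in> T" shows "s \<sigma> t = s \<sigma>' t"
proof -
  have "\<bar>s \<sigma> t - s \<sigma>' t\<bar> \<le> \<epsilon>" if \<epsilon>: "\<epsilon> > 0" for \<epsilon>
  proof -
    obtain I where I: "\<forall>\<tau>\<ge>-1. \<forall>\<sigma>\<in>T. \<forall>\<sigma>'\<in>T. \<forall>i\<ge>I. \<forall>j\<ge>I. \<bar>u \<sigma> (\<tau> + real i) - u \<sigma>' (\<tau> + real j)\<bar> \<le> \<epsilon>"
      using u_osc[OF T \<epsilon>] by blast
    show ?thesis
    proof (rule LIMSEQ_le_const2)
      show "(\<lambda>m. \<bar>u \<sigma> (frac t + real m) - u \<sigma>' (frac t + real m)\<bar>) \<longlonglongrightarrow> \<bar>s \<sigma> t - s \<sigma>' t\<bar>"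
        by (intro tendsto_intros s_limit assms)
      show "\<exists>N. \<forall>n\<ge>N. \<bar>u \<sigma> (frac t + real n) - u \<sigma>' (frac t + real n)\<bar> \<le> \<epsilon>"
        using I assms frac_ge_0[of t] by (intro exI[of _ I]) (smt (verit))
    qed
  qed
  then show ?thesis by (metis abs_ge_zero dense_ge eq_iff_diff_eq_0 abs_le_zero_iff)
qed

lemma u_close:
  assumes \<sigma>: "\<sigma> \<in> T" and \<epsilon>: "\<epsilon> > 0"
  shows "\<exists>I. \<forall>\<tau>\<ge>-1. \<forall>i\<ge>I. \<bar>u \<sigma> (\<tau> + real i) - s \<sigma> \<tau>\<bar> \<le> \<epsilon>"
proof -
  obtain I where I: "\<And>\<tau> i j. \<tau> \<ge> -1 \<Longrightarrow> i \<ge> I \<Longrightarrow> j \<ge> I \<Longrightarrow> \<bar>u \<sigma> (\<tau> + real i) - u \<sigma> (\<tau> + real j)\<bar> \<le> \<epsilon>"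
    using u_osc[OF T \<epsilon>] \<sigma> by metis
  have "\<bar>u \<sigma> (\<tau> + real i) - s \<sigma> \<tau>\<bar> \<le> \<epsilon>" if \<tau>: "\<tau> \<ge> -1" and i: "i \<ge> I + 1" for \<tau> i
  proof -
    have fl: "\<lfloor>\<tau>\<rfloor> \<ge> -1" using \<tau> by (simp add: le_floor_iff)
    \<comment> \<open>This moves \<open>\<tau> + real i\<close> onto the progression starting at
      \<open>frac \<tau>\<close>; the floor may be -1, hence the threshold
      \<open>I + 1\<close>.\<close>
    define i' where "i' = nat (\<lfloor>\<tau>\<rfloor> + int i)"
    have i': "i' \<ge> I" "\<tau> + real i = frac \<tau> + real i'"
      using fl i unfolding i'_def frac_def by auto
    show ?thesis
    proof (rule LIMSEQ_le_const2)
      show "(\<lambda>m. \<bar>u \<sigma> (\<tau> + real i) - u \<sigma> (frac \<tau> + real m)\<bar>) \<longlonglongrightarrow> \<bar>u \<sigma> (\<tau> + real i) - s \<sigma> \<tau>\<bar>"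
        by (intro tendsto_intros s_limit \<sigma>)
      show "\<exists>N. \<forall>n\<ge>N. \<bar>u \<sigma> (\<tau> + real i) - u \<sigma> (frac \<tau> + real n)\<bar> \<le> \<epsilon>"
        unfolding i'(2) using I[of "frac \<tau>" i'] i'(1) frac_ge_0[of \<tau>] by (intro exI[of _ I]) auto
    qed
  qed
  then show ?thesis by (intro exI[of _ "I + 1"]) auto
qed

lemma u_asymptotic:
  assumes \<sigma>: "\<sigma> \<in> T"
  shows "((\<lambda>t. u \<sigma> t - s \<sigma> t) \<longlongrightarrow> 0) at_top"
proof (rule tendstoI)
  fix \<epsilon> :: real assume "\<epsilon> > 0"
  then obtain I where I: "\<And>\<tau> i. \<tau> \<ge> -1 \<Longrightarrow> i \<ge> I \<Longrightarrow> \<bar>u \<sigma> (\<tau> + real i) - s \<sigma> \<tau>\<bar> \<le> \<epsilon> / 2"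
    using u_close[OF \<sigma>, of "\<epsilon> / 2"] by auto
  have "dist (u \<sigma> t - s \<sigma> t) 0 < \<epsilon>" if t: "t \<ge> real I" for t
  proof -
    have "\<bar>u \<sigma> ((t - real I) + real I) - s \<sigma> (t - real I)\<bar> \<le> \<epsilon> / 2"
      by (rule I) (use t in auto)
    moreover have "s \<sigma> (t - real I) = s \<sigma> t" using s_periodic[of \<sigma> t "- int I"] by simp
    ultimately show ?thesis using \<open>\<epsilon> > 0\<close> by (simp add: dist_real_def)
  qed
  then show "\<forall>\<^sub>F t in at_top. dist (u \<sigma> t - s \<sigma> t) 0 < \<epsilon>"
    unfolding eventually_at_top_linorder by blast
qed

text \<open>\<open>u\<close> itself jumps, but near \<open>c + real i\<close> by at most
  \<open>3 * exp (- \<kappa> * (c + real i))\<close>, while its translates by \<open>i\<close>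
  approximate \<open>s\<close> uniformly. Both errors are small for one large \<open>i\<close>,
  which fixes \<open>\<delta>\<close>.\<close>

lemma s_continuous:
  assumes \<sigma>: "\<sigma> \<in> T"
  shows "continuous_on UNIV (s \<sigma>)"
proof (rule continuous_at_imp_continuous_on, rule ballI)
  fix t0 :: real
  show "isCont (s \<sigma>) t0"
    unfolding continuous_at_eps_delta dist_real_def
  proof (intro allI impI)
    fix \<epsilon> :: real assume \<epsilon>: "\<epsilon> > 0"
    obtain I where I: "\<And>\<tau> i. \<tau> \<ge> -1 \<Longrightarrow> i \<ge> I \<Longrightarrow> \<bar>u \<sigma> (\<tau> + real i) - s \<sigma> \<tau>\<bar> \<le> \<epsilon> / 4"
      using u_close[OF \<sigma>, of "\<epsilon> / 4"] \<epsilon> by auto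
    define c where "c = frac t0"
    have c: "c \<ge> 0" by (simp add: c_def frac_ge_0)
    have shift: "s \<sigma> (c + h) = s \<sigma> (t0 + h)" for h
      using s_periodic[of \<sigma> "t0 + h" "- \<lfloor>t0\<rfloor>"] by (simp add: c_def frac_def algebra_simps)
    have "(\<lambda>i. 3 * (exp (- \<kappa>)) ^ i) \<longlonglongrightarrow> 3 * 0"
      using \<kappa> by (intro tendsto_intros LIMSEQ_power_zero) auto
    then have "\<forall>\<^sub>F i in sequentially. 3 * (exp (- \<kappa>)) ^ i < \<epsilon> / 4"
      by (rule order_tendstoD(2)) (use \<epsilon> in simp)
    then obtain i0 where i0: "\<And>i. i \<ge> i0 \<Longrightarrow> 3 * (exp (- \<kappa>)) ^ i < \<epsilon> / 4" unfolding eventually_sequentially by blast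
    define i where "i = max I i0"
    have "exp (- \<kappa> * (c + real i)) \<le> exp (real i * (- \<kappa>))" using c \<kappa> by (simp add: algebra_simps)
    also have "\<dots> = exp (- \<kappa>) ^ i" by (rule exp_of_nat_mult)
    finally have small: "3 * exp (- \<kappa> * (c + real i)) < \<epsilon> / 4" using i0[of i] by (simp add: i_def)
    obtain \<delta> where \<delta>: "\<delta> > 0" "\<And>t'. \<bar>t' - (c + real i)\<bar> < \<delta> \<Longrightarrow> \<bar>u \<sigma> t' - u \<sigma> (c + real i)\<bar> \<le> 3 * exp (- \<kappa> * (c + real i))"
      using u_jump[of "c + real i" \<sigma>] by blast
    have "\<bar>s \<sigma> t - s \<sigma> t0\<bar> < \<epsilon>" if t: "\<bar>t - t0\<bar> < min \<delta> 1" for t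
    proof -
      define h where "h = t - t0"
      have h: "\<bar>h\<bar> < \<delta>" "c + h \<ge> -1" using t c by (auto simp: h_def)
      have 1: "\<bar>u \<sigma> (c + h + real i) - s \<sigma> (c + h)\<bar> \<le> \<epsilon> / 4" by (rule I) (use h in \<open>auto simp: i_def\<close>)
      have 2: "\<bar>u \<sigma> (c + real i) - s \<sigma> c\<bar> \<le> \<epsilon> / 4" by (rule I) (use c in \<open>auto simp: i_def\<close>)
      have 3: "\<bar>u \<sigma> (c + h + real i) - u \<sigma> (c + real i)\<bar> < \<epsilon> / 4"
        using \<delta>(2)[of "c + h + real i"] h small by auto
      have "s \<sigma> (c + h) = s \<sigma> t" "s \<sigma> c = s \<sigma> t0" using shift[of h] shift[of 0] by (auto simp: h_def)
      then show ?thesis using 1 2 3 \<epsilon> by linarith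
    qed
    then show "\<exists>\<delta>>0. \<forall>t. \<bar>t - t0\<bar> < \<delta> \<longrightarrow> \<bar>s \<sigma> t - s \<sigma> t0\<bar> < \<epsilon>"
      using \<delta>(1) by (intro exI[of _ "min \<delta> 1"]) auto
  qed
qed

text \<open>Multiplication by \<open>e k\<close> permutes \<open>T\<close>, so the sum
  \<open>w\<close> of \<open>u\<close> over \<open>T\<close> satisfies a scalar inequality without
  signs. A positive lower bound on one window of length \<open>L\<close> then persists, and in the
  limit all signs in \<open>T\<close> contribute equally.\<close>

lemma s_positive:
  assumes \<sigma>: "\<sigma> \<in> T" and l0: "l0 > 0" "\<And>x. x \<ge> l0 \<Longrightarrow> N (\<sigma> * x) \<ge> 1"
  shows "s \<sigma> t > 0"
proof -
  have T1: "T \<subseteq> {1, -1}" and T2: "\<And>\<sigma> k. \<sigma> \<in> T \<Longrightarrow> k \<in> K \<Longrightarrow> \<sigma> * e k \<in> T" using T by (auto simp: mixing_def)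
  have finT: "finite T" using T1 by (rule finite_subset) simp
  define w where "w t = (\<Sum>\<tau>\<in>T. u \<tau> t)" for t
  have rec: "(\<Sum>k\<in>K. p k * w (t - real (l k))) \<le> w t" for t
  proof -
    have "(\<Sum>k\<in>K. p k * w (t - real (l k))) = (\<Sum>k\<in>K. \<Sum>\<tau>\<in>T. p k * u (\<tau> * e k) (t - real (l k)))"
    proof (intro sum.cong refl)
      fix k assume k: "k \<in> K"
      have inv: "\<tau> * e k * e k = \<tau>" for \<tau> using e_sign[OF k] by auto
      have "w (t - real (l k)) = (\<Sum>\<tau>\<in>T. u (\<tau> * e k) (t - real (l k)))"
        unfolding w_def
        by (rule sum.reindex_bij_witness[of _ "\<lambda>\<tau>. \<tau> * e k" "\<lambda>\<tau>. \<tau> * e k"]) (simp_all only: inv T2[OF _ k])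
      then show "p k * w (t - real (l k)) = (\<Sum>\<tau>\<in>T. p k * u (\<tau> * e k) (t - real (l k)))"
        by (simp add: sum_distrib_left)
    qed
    also have "\<dots> = (\<Sum>\<tau>\<in>T. \<Sum>k\<in>K. p k * u (\<tau> * e k) (t - real (l k)))" by (rule sum.swap)
    also have "\<dots> \<le> w t" unfolding w_def by (intro sum_mono u_lower)
    finally show ?thesis .
  qed
  define t1 where "t1 = ln l0 / \<nu>"
  have w1: "exp (- \<kappa> * t) \<le> w t" if "t \<ge> t1" for t
  proof -
    have "ln l0 \<le> \<nu> * t" using that \<nu> by (simp add: t1_def field_simps)
    then have "l0 \<le> exp (\<nu> * t)" using l0(1) by (metis exp_le_cancel_iff exp_ln)
    then have "1 \<le> real (N (\<sigma> * exp (\<nu> * t)))" using l0(2) by fastforce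
    then have "exp (- \<kappa> * t) \<le> u \<sigma> t" unfolding u_def by simp
    also have "\<dots> \<le> w t" unfolding w_def using finT \<sigma> by (intro member_le_sum u_nonneg) auto
    finally show ?thesis .
  qed
  \<comment> \<open>The least value of \<open>exp (- \<kappa> * t)\<close> on the starting window
    from \<open>t1\<close> to \<open>t1 + real L\<close>.\<close>
  define c0 where "c0 = exp (- \<kappa> * (t1 + real L))"
  have w2: "c0 \<le> w t" if "t1 \<le> t" "t \<le> t1 + real L + real j" for t j
    using that
  proof (induction j arbitrary: t)
    case 0
    then have "c0 \<le> exp (- \<kappa> * t)" using \<kappa> by (simp add: c0_def)
    then show ?case using w1[of t] 0 by simp
  next
    case (Suc j)
    show ?case
    proof (cases "t \<le> t1 + real L")
      case True
      then have "c0 \<le> exp (- \<kappa> * t)" using \<kappa> by (simp add: c0_def)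
      then show ?thesis using w1[of t] Suc.prems by simp
    next
      case False
      have "c0 = (\<Sum>k\<in>K. p k * c0)" by (simp only: sum_distrib_right[symmetric] p_sum1 mult_1)
      also have "\<dots> \<le> (\<Sum>k\<in>K. p k * w (t - real (l k)))"
      proof (intro sum_mono mult_left_mono)
        fix k assume k: "k \<in> K"
        have "real (l k) \<ge> 1" "real (l k) \<le> real L" using l_pos[OF k] l_le_L[OF k] by auto
        then show "c0 \<le> w (t - real (l k))" using Suc.prems False by (intro Suc.IH) auto
      qed (simp add: p_pos less_imp_le)
      also have "\<dots> \<le> w t" by (rule rec)
      finally show ?thesis .
    qed
  qed
  have w3: "c0 \<le> w t" if "t \<ge> t1" for t
  proof -
    obtain j :: nat where "t - t1 \<le> real j" using real_arch_simple by blast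
    then show ?thesis using w2[of t j] that by simp
  qed
  have "(\<lambda>m. w (frac t + real m)) \<longlonglongrightarrow> (\<Sum>\<tau>\<in>T. s \<tau> t)"
    unfolding w_def by (intro tendsto_sum s_limit)
  moreover obtain m0 :: nat where m0: "t1 \<le> real m0" using real_arch_simple by blast
  have "\<exists>M. \<forall>m\<ge>M. c0 \<le> w (frac t + real m)"
    using m0 frac_ge_0[of t] by (intro exI[of _ m0] allI impI w3) (smt (verit) of_nat_mono)
  ultimately have "c0 \<le> (\<Sum>\<tau>\<in>T. s \<tau> t)" by (rule LIMSEQ_le_const)
  also have "\<dots> = (\<Sum>\<tau>\<in>T. s \<sigma> t)" by (intro sum.cong refl s_equal \<sigma>)
  also have "\<dots> = real (card T) * s \<sigma> t" by simp
  finally have "real (card T) * s \<sigma> t > 0" using exp_gt_zero[of "- \<kappa> * (t1 + real L)"] unfolding c0_def by linarith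
  then show ?thesis using s_nonneg[OF \<sigma>, of t] by (simp add: zero_less_mult_iff)
qed

end

end

section \<open>The main theorem\<close>

lemma AE_lborel_affine:
  fixes c t :: real
  assumes Q: "AE x in lborel. Q x" and c: "c \<noteq> 0"
  shows "AE x in lborel. Q (t + c * x)"
proof -
  obtain N where N: "N \<in> null_sets lborel" "{x\<in>space lborel. \<not> Q x} \<subseteq> N"
    using Q unfolding eventually_ae_filter by blast
  have [measurable]: "N \<in> sets borel" using N(1) by (auto simp: null_sets_def)
  have "AE x in lborel. t + c * x \<notin> N"
    by (rule AE_borel_affine[OF c]) (use AE_not_in[OF N(1)] in auto)
  then show ?thesis using N(2) by (auto elim!: eventually_mono)
qed

lemma n2_emb: "a > 0 \<Longrightarrow> (n2 (emb al a g))\<^sup>2 = (n2 g)\<^sup>2 / a"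
proof -
  assume "a > 0"
  then have "complex_of_real ((n2 (emb al a g))\<^sup>2) = complex_of_real ((n2 g)\<^sup>2 / a)"
    using ip_emb[of a al g g] unfolding ip_self by simp
  then show ?thesis by (simp only: of_real_eq_iff)
qed

context cells
begin

lemma n2_cells:
  assumes w: "w \<in> X1"
  shows "(n2 w)\<^sup>2 = (\<Sum>k=1..n. (n2 (cut (alpha a k) (alpha a k + a k) w))\<^sup>2)"
proof -
  define v :: cfn where "v x = of_real ((norm (w x))\<^sup>2)" for x
  have cutv: "cut b c v x = of_real ((norm (cut b c w x))\<^sup>2)" for b c x by (simp add: cut_def v_def)
  have pt: "(norm (w x))\<^sup>2 = (\<Sum>k=1..n. (norm (cut (alpha a k) (alpha a k + a k) w x))\<^sup>2)" for x
  proof -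
    have "complex_of_real ((norm (w x))\<^sup>2) =
      complex_of_real (\<Sum>k=1..n. (norm (cut (alpha a k) (alpha a k + a k) w x))\<^sup>2)"
      unfolding of_real_sum cutv[symmetric]
      using cut_cells[of v x] X1_outside[OF w] by (simp add: v_def)
    then show ?thesis by (simp only: of_real_eq_iff)
  qed
  show ?thesis unfolding n2_sq pt
    by (rule Bochner_Integration.integral_sum) (use l2_integrable[OF cut_l2[OF X1_l2[OF w]]] in auto)
qed

text \<open>The squared norm splits over the cells, and the part on cell \<open>k\<close> is
  \<open>a k * \<bar>d k\<bar>\<^sup>2\<close> times the whole. These factors sum to less than 1, so
  the norm is zero.\<close>

lemma linear_self_similar_zero:
  assumes w: "w \<in> X1" and sim: "\<And>k. k \<in> {1..n} \<Longrightarrow>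
      AE x in lborel. 0 < x \<and> x < 1 \<longrightarrow> w (alpha a k + a k * x) = of_real (d k) * w x"
    and contr: "(\<Sum>k=1..n. a k * \<bar>d k\<bar>\<^sup>2) < 1"
  shows "AE x in lborel. w x = 0"
proof -
  have [measurable]: "w \<in> borel_measurable borel" using w by (rule X1_measurable)
  have "(n2 (cut (alpha a k) (alpha a k + a k) w))\<^sup>2 = a k * \<bar>d k\<bar>\<^sup>2 * (n2 w)\<^sup>2" if k: "k \<in> {1..n}" for k
  proof -
    note ak = cell[OF k]
    have [measurable]: "res (alpha a k) (a k) w \<in> borel_measurable borel"
      using res_X1[OF X1_l2[OF w] ak(1)] by (rule X1_measurable)
    have "(n2 (res (alpha a k) (a k) w))\<^sup>2 = (LINT x|lborel. (a k * \<bar>d k\<bar>)\<^sup>2 * (norm (w x))\<^sup>2)"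
      unfolding n2_sq
    proof (rule integral_cong_AE)
      show "AE x in lborel. (norm (res (alpha a k) (a k) w x))\<^sup>2 = (a k * \<bar>d k\<bar>)\<^sup>2 * (norm (w x))\<^sup>2"
        using sim[OF k] AE_lborel_singleton[of 1]
      proof eventually_elim
        case (elim x)
        show ?case
        proof (cases "0 < x \<and> x < 1")
          case True
          then show ?thesis using elim ak(1) by (simp add: res_def norm_mult power_mult_distrib)
        next
          case False
          then show ?thesis using elim X1_outside[OF w, of x] by (auto simp: res_def)
        qed
      qed
    qed measurable
    also have "\<dots> = (a k * \<bar>d k\<bar>)\<^sup>2 * (n2 w)\<^sup>2" by (simp add: n2_sq)
    finally show ?thesis
      unfolding emb_res[OF ak(1), symmetric] n2_emb[OF ak(1)] using ak(1) by (simp add: power2_eq_square)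
  qed
  then have "(n2 w)\<^sup>2 = (\<Sum>k=1..n. a k * \<bar>d k\<bar>\<^sup>2) * (n2 w)\<^sup>2"
    unfolding sum_distrib_right by (subst n2_cells[OF w]) (auto intro: sum.cong)
  then have "(1 - (\<Sum>k=1..n. a k * \<bar>d k\<bar>\<^sup>2)) * (n2 w)\<^sup>2 = 0" by (simp add: left_diff_distrib)
  then have "(LINT x|lborel. (norm (w x))\<^sup>2) = 0" using contr unfolding n2_sq by simp
  then have "AE x in lborel. (norm (w x))\<^sup>2 = 0"
    using integral_nonneg_eq_0_iff_AE[OF l2_integrable[OF X1_l2[OF w]]] by simp
  then show ?thesis by eventually_elim simp
qed

lemma sim_op_cell:
  assumes k: "k \<in> {1..n}" and x: "0 < x" "x < 1"
  shows "sim_op n a d \<beta> f (alpha a k + a k * x) = of_real (\<beta> k) + of_real (d k) * f x"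
proof -
  let ?y = "alpha a k + a k * x"
  note ak = cell[OF k]
  have y: "alpha a k < ?y" "?y < alpha a k + a k" using x ak by auto
  have out: "?y \<notin> {alpha a j<..<alpha a (j + 1)}" if j: "j \<in> {1..n}" "j \<noteq> k" for j
    using cells_disjoint[OF j(1) k j(2)] y alpha_Suc[of j] j by auto
  have "sim_op n a d \<beta> f ?y = (\<Sum>j\<in>{k}. of_real (\<beta> j) * indicator {alpha a j<..<alpha a (j + 1)} ?y
               + of_real (d j) * sim_piece a j f ?y)"
    unfolding sim_op_def by (rule sum.mono_neutral_right) (use k out in \<open>auto simp: sim_piece_def\<close>)
  also have "\<dots> = of_real (\<beta> k) + of_real (d k) * f x"
    using y alpha_Suc[of k] k ak by (simp add: sim_piece_def)
  finally show ?thesis .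
qed

end

text \<open>All parameters are real, so the imaginary part solves the equation with every
  \<open>\<beta> k\<close> replaced by 0 and vanishes almost everywhere by
  \<open>linear_self_similar_zero\<close>.\<close>

lemma real_representative:
  assumes P: "self_similar n a d \<beta> P"
  shows "\<exists>p. self_sim_weight p n a d \<beta> \<and> aeq P p"
proof -
  have n: "n > 1" and a: "\<And>k. k \<in> {1..n} \<Longrightarrow> a k > 0" "(\<Sum>k=1..n. a k) = 1"
    and contr: "(\<Sum>k=1..n. a k * \<bar>d k\<bar>\<^sup>2) < 1" and L: "P \<in> L2"
    and G: "AE x in unit_leb. sim_op n a d \<beta> P x = P x"
    using P by (auto simp: self_similar_def self_sim_params_def)
  interpret cells n a by unfold_locales (use n a in auto)
  obtain p0 where p0: "p0 \<in> X1" "aeq P p0" using L2_representative[OF L] by blast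
  have sim: "AE x in lborel. 0 < x \<and> x < 1 \<longrightarrow> p0 (alpha a k + a k * x) = of_real (\<beta> k) + of_real (d k) * p0 x"
    if k: "k \<in> {1..n}" for k
  proof -
    note ak = cell[OF k]
    have nz: "a k \<noteq> 0" using ak(1) by simp
    show ?thesis
      using AE_lborel_affine[OF G[unfolded unit_AE_iff] nz, of "alpha a k"]
        AE_lborel_affine[OF p0(2)[unfolded aeq_def] nz, of "alpha a k"] p0(2)[unfolded aeq_def]
    proof eventually_elim
      case (elim x)
      show ?case
      proof
        assume x: "0 < x \<and> x < 1"
        have "a k * x < a k" "0 < a k * x" using x ak(1) by auto
        then have "0 < alpha a k + a k * x" "alpha a k + a k * x < 1" using ak by linarith+
        then show "p0 (alpha a k + a k * x) = of_real (\<beta> k) + of_real (d k) * p0 x"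
          using elim x sim_op_cell[OF k, of x] by metis
      qed
    qed
  qed
  have [measurable]: "p0 \<in> borel_measurable borel" using p0(1) by (rule X1_measurable)
  define w :: cfn where "w x = of_real (Im (p0 x))" for x
  have "w \<in> l2"
    by (rule l2_dominated[OF X1_l2[OF p0(1)], of _ 1]) (use abs_Im_le_cmod in \<open>auto simp: w_def[abs_def]\<close>)
  then have w: "w \<in> X1" using X1_outside[OF p0(1)] by (auto simp: X1_def w_def)
  have "AE x in lborel. w x = 0"
  proof (rule linear_self_similar_zero[OF w _ contr])
    fix k assume "k \<in> {1..n}"
    from sim[OF this] show "AE x in lborel. 0 < x \<and> x < 1 \<longrightarrow> w (alpha a k + a k * x) = of_real (d k) * w x"
      by eventually_elim (simp add: w_def)
  qed
  define p :: cfn where "p x = of_real (Re (p0 x))" for x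
  have pl: "p \<in> l2"
    by (rule l2_dominated[OF X1_l2[OF p0(1)], of _ 1]) (use abs_Re_le_cmod in \<open>auto simp: p_def[abs_def]\<close>)
  have "aeq P p"
    unfolding aeq_def using p0(2)[unfolded aeq_def] \<open>AE x in lborel. w x = 0\<close>
    by eventually_elim (auto simp: p_def w_def complex_eq_iff)
  moreover have "self_sim_weight p n a d \<beta>"
  proof unfold_locales
    fix k assume k: "k \<in> {1..n}"
    from sim[OF k] show "AE x in lborel. 0 < x \<and> x < 1 \<longrightarrow> p (alpha a k + a k * x) = of_real (\<beta> k) + of_real (d k) * p x"
      by eventually_elim (simp add: p_def)
    have "a k * \<bar>d k\<bar>\<^sup>2 \<le> (\<Sum>k=1..n. a k * \<bar>d k\<bar>\<^sup>2)"
      using k a(1) by (intro member_le_sum) (auto simp: less_imp_le)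
    then have 1: "a k * \<bar>d k\<bar>\<^sup>2 < 1" using contr by simp
    have "a k \<le> (\<Sum>k=1..n. a k)" using k a(1) by (intro member_le_sum) (auto simp: less_imp_le)
    then have 2: "a k \<le> 1" using a(2) by simp
    \<comment> \<open>The assumption bounds \<open>a k * \<bar>d k\<bar>\<^sup>2\<close>; the extra
      factor \<open>a k \<le> 1\<close> passes this on to the contraction ratio.\<close>
    have "(a k * \<bar>d k\<bar>)\<^sup>2 = a k * (a k * \<bar>d k\<bar>\<^sup>2)" by (simp add: power2_eq_square)
    also have "\<dots> \<le> 1 * (a k * \<bar>d k\<bar>\<^sup>2)" using 2 a(1)[OF k] by (intro mult_right_mono) auto
    finally have "(a k * \<bar>d k\<bar>)\<^sup>2 < 1\<^sup>2" using 1 by simp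
    then show "a k * \<bar>d k\<bar> < 1" by (rule power_less_imp_less_base) simp
  qed (use pl in \<open>auto simp: p_def\<close>)
  ultimately show ?thesis by blast
qed

section \<open>The counting recursion for the pencil\<close>

context self_sim_weight
begin

text \<open>Towards 0 the index is locally constant, by left continuity and monotonicity; away from
  0 it grows at first by at most 1.\<close>

lemma Nf_scaling_jump:
  assumes \<nu>: "\<nu> > 0"
  shows "\<exists>\<delta>>0. \<forall>t'. \<bar>t' - t\<bar> < \<delta> \<longrightarrow> \<bar>real (Nf (\<sigma> * exp (\<nu> * t'))) - real (Nf (\<sigma> * exp (\<nu> * t)))\<bar> \<le> 1"
proof -
  let ?x = "\<sigma> * exp (\<nu> * t)"
  obtain s0 where s0: "s0 < 1" "\<And>s. s0 < s \<Longrightarrow> s \<le> 1 \<Longrightarrow> Nf ?x \<le> Nf (s * ?x)"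
    using Nf_left_continuous[OF negbound_all] by blast
  obtain \<eta>0 where \<eta>0: "\<eta>0 > 0" "\<And>\<eta>. 0 < \<eta> \<Longrightarrow> \<eta> < \<eta>0 \<Longrightarrow> Nf ((1 + \<eta>) * ?x) \<le> Nf ?x + 1"
    using Nf_jump[OF negbound_all] by blast
  have mono: "Nf y \<le> Nf (s * y)" if "s \<ge> 1" for s y
  proof -
    obtain m where "negbound X0 (frm p (s * y)) m" using negbound_all by blast
    then show ?thesis by (rule Nf_scale_mono[OF _ that])
  qed
  have "isCont (\<lambda>t'. exp (\<nu> * (t' - t))) t" by (intro continuous_intros)
  moreover define \<epsilon> where "\<epsilon> = min (1 - s0) \<eta>0"
  moreover have "\<epsilon> > 0" using s0 \<eta>0 by (simp add: \<epsilon>_def)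
  ultimately obtain \<delta> where \<delta>: "\<delta> > 0" "\<And>t'. \<bar>t' - t\<bar> < \<delta> \<Longrightarrow> \<bar>exp (\<nu> * (t' - t)) - 1\<bar> < \<epsilon>"
    unfolding continuous_at_eps_delta dist_real_def by fastforce
  have "\<bar>real (Nf (\<sigma> * exp (\<nu> * t'))) - real (Nf ?x)\<bar> \<le> 1" if t': "\<bar>t' - t\<bar> < \<delta>" for t'
  proof -
    define s where "s = exp (\<nu> * (t' - t))"
    have eq: "\<sigma> * exp (\<nu> * t') = s * ?x" unfolding s_def by (simp add: algebra_simps flip: exp_add)
    have s: "s > 0" "\<bar>s - 1\<bar> < \<epsilon>" using \<delta>(2)[OF t'] by (auto simp: s_def)
    show ?thesis
    proof (cases "s \<le> 1")
      case True
      have "Nf ?x \<le> Nf (s * ?x)" by (rule s0(2)) (use s True \<epsilon>_def in auto)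
      moreover have "Nf (s * ?x) \<le> Nf ((1 / s) * (s * ?x))" by (rule mono) (use s True in simp)
      ultimately have "Nf (s * ?x) = Nf ?x" using s by simp
      then show ?thesis unfolding eq by simp
    next
      case False
      then have "Nf ?x \<le> Nf (s * ?x)" by (intro mono) simp
      moreover have "Nf ((1 + (s - 1)) * ?x) \<le> Nf ?x + 1"
        by (rule \<eta>0(2)) (use s False \<epsilon>_def in auto)
      ultimately show ?thesis unfolding eq by simp
    qed
  qed
  then show ?thesis using \<delta>(1) by blast
qed

lemma Nf_zero: "Nf 0 = 0"
  using nind_le[OF negbound_small[of 0]] by (simp add: Nf_def)

text \<open>With exponent \<open>D / 2 * \<nu>\<close> the weights are
  \<open>(a k * \<bar>d k\<bar>) powr (D / 2)\<close>, so the equation for \<open>D\<close> is their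
  normalisation. Cells with \<open>d k = 0\<close> drop out because \<open>Nf 0 = 0\<close>.\<close>

lemma counting_recursion_Nf:
  assumes K: "K = {k\<in>{1..n}. d k \<noteq> 0}" and l: "\<And>k. k \<in> K \<Longrightarrow> l k \<ge> 1"
    and al: "\<And>k. k \<in> K \<Longrightarrow> a k * \<bar>d k\<bar> = exp (- (\<nu> * real (l k)))"
    and gcd: "\<And>g::nat. (\<And>k. k \<in> K \<Longrightarrow> g dvd l k) \<Longrightarrow> g = 1"
    and \<nu>: "\<nu> > 0" and D: "is_spectral_order n a d D"
  shows "counting_recursion Nf K l (\<lambda>k. sgn (d k)) (D / 2 * \<nu>) \<nu> (real (n - 1))"
proof
  show "finite K" by (simp add: K)
  show "\<And>k. k \<in> K \<Longrightarrow> 1 \<le> l k" by (rule l)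
  show "\<And>k. k \<in> K \<Longrightarrow> sgn (d k) = 1 \<or> sgn (d k) = - 1" by (auto simp: K sgn_real_def)
  show "g = 1" if "\<And>k. k \<in> K \<Longrightarrow> g dvd l k" for g using gcd that by blast
  show "\<nu> > 0" "0 \<le> real (n - 1)" using \<nu> by auto
  show "D / 2 * \<nu> > 0" using D \<nu> by (simp add: is_spectral_order_def)
  have "1 = (\<Sum>k=1..n. (a k * \<bar>d k\<bar>) powr (D / 2))" using D by (simp add: is_spectral_order_def)
  also have "\<dots> = (\<Sum>k\<in>K. (a k * \<bar>d k\<bar>) powr (D / 2))"
    unfolding K by (rule sum.mono_neutral_right) auto
  also have "\<dots> = (\<Sum>k\<in>K. exp (- (D / 2 * \<nu>) * real (l k)))"
    by (intro sum.cong refl) (simp add: al powr_def algebra_simps)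
  finally show "(\<Sum>k\<in>K. exp (- (D / 2 * \<nu>) * real (l k))) = 1" by simp
  have sum_eq: "(\<Sum>k\<in>K. real (Nf (\<sigma> * sgn (d k) * exp (\<nu> * (t - real (l k)))))) =
    real (\<Sum>k=1..n. Nf (\<sigma> * exp (\<nu> * t) * (a k * d k)))" for \<sigma> t
  proof -
    have "real (\<Sum>k=1..n. Nf (\<sigma> * exp (\<nu> * t) * (a k * d k))) =
      (\<Sum>k=1..n. real (Nf (\<sigma> * exp (\<nu> * t) * (a k * d k))))" by simp
    also have "\<dots> = (\<Sum>k\<in>K. real (Nf (\<sigma> * exp (\<nu> * t) * (a k * d k))))"
      unfolding K by (rule sum.mono_neutral_right) (auto simp: Nf_zero)
    also have "\<dots> = (\<Sum>k\<in>K. real (Nf (\<sigma> * sgn (d k) * exp (\<nu> * (t - real (l k))))))"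
    proof (intro sum.cong refl)
      fix k assume k: "k \<in> K"
      have "a k * d k = sgn (d k) * (a k * \<bar>d k\<bar>)" by (simp add: sgn_mult_abs mult.left_commute)
      then have "\<sigma> * exp (\<nu> * t) * (a k * d k) = \<sigma> * sgn (d k) * exp (\<nu> * (t - real (l k)))"
        unfolding al[OF k] by (simp add: right_diff_distrib exp_diff exp_minus field_simps)
      then show "real (Nf (\<sigma> * exp (\<nu> * t) * (a k * d k))) = real (Nf (\<sigma> * sgn (d k) * exp (\<nu> * (t - real (l k)))))"
        by (simp only:)
    qed
    finally show ?thesis by simp
  qed
  show "(\<Sum>k\<in>K. real (Nf (\<sigma> * sgn (d k) * exp (\<nu> * (t - real (l k)))))) \<le> real (Nf (\<sigma> * exp (\<nu> * t)))" for \<sigma> t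
    unfolding sum_eq by (rule of_nat_mono[OF Nf_recursion(1)])
  show "real (Nf (\<sigma> * exp (\<nu> * t))) \<le>
    (\<Sum>k\<in>K. real (Nf (\<sigma> * sgn (d k) * exp (\<nu> * (t - real (l k)))))) + real (n - 1)" for \<sigma> t
    unfolding sum_eq of_nat_add[symmetric] by (rule of_nat_mono[OF Nf_recursion(2)])
  show "\<exists>\<delta>>0. \<forall>t'. \<bar>t' - t\<bar> < \<delta> \<longrightarrow>
    \<bar>real (Nf (\<sigma> * exp (\<nu> * t'))) - real (Nf (\<sigma> * exp (\<nu> * t)))\<bar> \<le> 1" for \<sigma> t
    by (rule Nf_scaling_jump[OF \<nu>])
  show "\<exists>t0. \<forall>t\<le>t0. \<forall>\<sigma>\<in>{1, -1}. Nf (\<sigma> * exp (\<nu> * t)) = 0"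
  proof (intro exI allI impI ballI)
    \<comment> \<open>The threshold puts \<open>exp (\<nu> * t)\<close> below
      \<open>1 / (2 * n2 p + 1)\<close>, inside the range of \<open>negbound_small\<close> for both
      signs.\<close>
    fix t \<sigma> :: real assume t: "t \<le> ln (1 / (2 * n2 p + 1)) / \<nu>" and \<sigma>: "\<sigma> \<in> {1, -1}"
    have pos: "2 * n2 p + 1 > 0" using n2_nonneg[of p] by simp
    have "\<nu> * t \<le> ln (1 / (2 * n2 p + 1))" using t \<nu> by (simp add: field_simps)
    then have "exp (\<nu> * t) \<le> 1 / (2 * n2 p + 1)" using pos by (metis exp_le_cancel_iff exp_ln zero_less_divide_1_iff)
    then have "exp (\<nu> * t) * (2 * n2 p + 1) \<le> 1" using pos by (simp add: field_simps)
    moreover have "\<bar>\<sigma> * exp (\<nu> * t)\<bar> = exp (\<nu> * t)" using \<sigma> by auto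
    ultimately have "2 * \<bar>\<sigma> * exp (\<nu> * t)\<bar> * n2 p \<le> 1" by (simp add: algebra_simps)
    then show "Nf (\<sigma> * exp (\<nu> * t)) = 0" using nind_le[OF negbound_small] by (simp add: Nf_def)
  qed
qed

end

text \<open>A common divisor \<open>g\<close> makes \<open>g * \<nu>\<close> admissible as well,
  which for \<open>g > 1\<close> would exceed the maximal \<open>\<nu>\<close>.\<close>

lemma step_gcd:
  assumes st: "is_step n a d \<nu>" and K: "K = {k\<in>{1..n}. d k \<noteq> 0}" "K \<noteq> {}"
    and l: "\<And>k. k \<in> K \<Longrightarrow> l k \<ge> (1::nat)"
    and al: "\<And>k. k \<in> K \<Longrightarrow> a k * \<bar>d k\<bar> = exp (- (\<nu> * real (l k)))"
    and g: "\<And>k. k \<in> K \<Longrightarrow> g dvd l k"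
  shows "g = 1"
proof -
  have \<nu>: "\<nu> > 0" using st by (simp add: is_step_def arith_with_def)
  obtain k0 where "k0 \<in> K" using K(2) by blast
  then have g0: "g > 0" using g l by (metis dvd_0_left not_one_le_zero gr0I)
  have "arith_with n a d (real g * \<nu>)"
    unfolding arith_with_def
  proof (intro conjI ballI)
    show "0 < real g * \<nu>" using g0 \<nu> by simp
    fix k assume k: "k \<in> {1..n}"
    show "\<exists>j\<ge>1. a k * \<bar>d k\<bar> * (a k * \<bar>d k\<bar> - exp (- real j * (real g * \<nu>))) = 0"
    proof (cases "d k = 0")
      case True
      then show ?thesis by auto
    next
      case False
      then have kK: "k \<in> K" using k K by simp
      then obtain j where j: "l k = g * j" using g by (auto simp: dvd_def)
      then have "j \<ge> 1" using l[OF kK] by (cases j) auto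
      moreover have "a k * \<bar>d k\<bar> = exp (- real j * (real g * \<nu>))" unfolding al[OF kK] j by (simp add: mult_ac)
      ultimately show ?thesis by (intro exI[of _ j]) simp
    qed
  qed
  then have "real g * \<nu> \<le> \<nu>" using st by (simp add: is_step_def)
  then have "real g \<le> 1" using \<nu> by simp
  then show ?thesis using g0 by simp
qed

theorem mainTheorem1:
  fixes P :: "real \<Rightarrow> complex" and \<rho> :: functional
    and n :: nat and a d \<beta> :: "nat \<Rightarrow> real" and \<nu> D :: real
  assumes "self_similar n a d \<beta> P"
    and "is_step n a d \<nu>"
    and "pos_spectral_order n d \<beta>"
    and "is_spectral_order n a d D"
    and "is_derivative_of \<rho> P"
    and "\<exists>k\<in>{1..n}.
           (d k > 0 \<and> (\<exists>m::int. odd m \<and> ln (a k * \<bar>d k\<bar>) / \<nu> = of_int m)) \<or>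
           (d k < 0 \<and> (\<exists>m::int. even m \<and> ln (a k * \<bar>d k\<bar>) / \<nu> = of_int m))"
  shows "\<exists>s_plus s_minus :: real \<Rightarrow> real.
     (continuous_on UNIV s_plus \<and> (\<forall>t. s_plus t \<ge> 0) \<and> (\<forall>t. s_plus (t + 1) = s_plus t)) \<and>
     (continuous_on UNIV s_minus \<and> (\<forall>t. s_minus t \<ge> 0) \<and> (\<forall>t. s_minus (t + 1) = s_minus t)) \<and>
     (\<exists>r :: real \<Rightarrow> real. (r \<longlongrightarrow> 0) at_top \<and>
        (\<forall>\<^sub>F l in at_top. ereal_of_enat (ind (pencil \<rho> (complex_of_real l)))
           = ereal (\<bar>l\<bar> powr (D / 2) * (s_plus (ln \<bar>l\<bar> / \<nu>) + r l)))) \<and>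
     (\<exists>r :: real \<Rightarrow> real. (r \<longlongrightarrow> 0) at_bot \<and>
        (\<forall>\<^sub>F l in at_bot. ereal_of_enat (ind (pencil \<rho> (complex_of_real l)))
           = ereal (\<bar>l\<bar> powr (D / 2) * (s_minus (ln \<bar>l\<bar> / \<nu>) + r l)))) \<and>
     ((\<exists>k\<in>{1..n}. d k < 0) \<longrightarrow> (\<forall>t. s_plus t = s_minus t)) \<and>
     ((\<exists>y\<in>H. pairing \<rho> (\<lambda>x. complex_of_real ((norm (y x))\<^sup>2)) > 0) \<longrightarrow> (\<forall>t. s_plus t > 0)) \<and>
     ((\<exists>y\<in>H. pairing \<rho> (\<lambda>x. complex_of_real ((norm (y x))\<^sup>2)) < 0) \<longrightarrow> (\<forall>t. s_minus t > 0))"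
proof -
  obtain p where ssw: "self_sim_weight p n a d \<beta>" and Pp: "aeq P p"
    using real_representative[OF assms(1)] by blast
  interpret self_sim_weight p n a d \<beta> by (rule ssw)
  interpret pencil_weight p P \<rho>
    by unfold_locales (use assms(1,5) Pp negbound_all in \<open>auto simp: self_similar_def\<close>)
  have \<nu>: "\<nu> > 0" using assms(2) by (simp add: is_step_def arith_with_def)
  define K where "K = {k\<in>{1..n}. d k \<noteq> 0}"
  have Kne: "K \<noteq> {}" using assms(3) unfolding pos_spectral_order_def K_def[symmetric] by auto
  have "\<forall>k\<in>K. \<exists>l::nat. l \<ge> 1 \<and> a k * \<bar>d k\<bar> = exp (- (\<nu> * real l))"
  proof
    fix k assume k: "k \<in> K"
    then have "k \<in> {1..n}" "a k * \<bar>d k\<bar> \<noteq> 0" using a_pos[of k] by (auto simp: K_def)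
    then obtain l :: nat where "l \<ge> 1" "a k * \<bar>d k\<bar> * (a k * \<bar>d k\<bar> - exp (- real l * \<nu>)) = 0"
      using assms(2) unfolding is_step_def arith_with_def by blast
    then show "\<exists>l::nat. l \<ge> 1 \<and> a k * \<bar>d k\<bar> = exp (- (\<nu> * real l))"
      using \<open>a k * \<bar>d k\<bar> \<noteq> 0\<close> by (intro exI[of _ l]) (auto simp: mult.commute)
  qed
  then obtain l :: "nat \<Rightarrow> nat" where l: "\<And>k. k \<in> K \<Longrightarrow> l k \<ge> 1"
    and al: "\<And>k. k \<in> K \<Longrightarrow> a k * \<bar>d k\<bar> = exp (- (\<nu> * real (l k)))" by metis
  have gcd: "g = 1" if "\<And>k. k \<in> K \<Longrightarrow> g dvd l k" for g
    using step_gcd[OF assms(2) K_def Kne l al that] by blast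
  interpret counting_recursion Nf K l "\<lambda>k. sgn (d k)" "D / 2 * \<nu>" \<nu> "real (n - 1)"
    by (rule counting_recursion_Nf[OF K_def l al gcd \<nu> assms(4)])
  have mix_neg: "mixing {1, -1}" if neg: "\<exists>k\<in>{1..n}. d k < 0"
  proof -
    obtain i where i: "i \<in> {1..n}" "d i < 0" using neg by blast
    then have iK: "i \<in> K" by (simp add: K_def)
    obtain k m where k: "k \<in> {1..n}" and m: "ln (a k * \<bar>d k\<bar>) / \<nu> = of_int m"
      and par: "(d k > 0 \<and> odd m) \<or> (d k < 0 \<and> even m)" using assms(6) by blast
    have kK: "k \<in> K" using k par by (auto simp: K_def)
    have "real_of_int m = real_of_int (- int (l k))" using m \<nu> unfolding al[OF kK] by simp
    \<comment> \<open>The logarithm is negative; the sign does not affect parity, so the condition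
      on \<open>m\<close> is one on \<open>l k\<close>.\<close>
    then have m': "m = - int (l k)" by (simp only: of_int_eq_iff)
    show ?thesis
    proof (cases "d k > 0")
      case True
      \<comment> \<open>A positive \<open>d k\<close> with odd \<open>l k\<close> against a negative
        \<open>d i\<close>: the two powers compared in \<open>mixing_both\<close> are 1 and
        -1.\<close>
      then have "odd (l k)" using par m' by simp
      then show ?thesis using mixing_both[OF kK iK] True i(2) by simp
    next
      case False
      then have dk: "d k < 0" "even (l k)" using par m' by auto
      \<comment> \<open>The roles change: an even \<open>l k\<close> with negative
        \<open>d k\<close> needs a partner of odd delay, which exists because the delays have no
        common factor 2.\<close>
      have "\<exists>j\<in>K. odd (l j)" using gcd[of 2] by (metis one_eq_numeral_iff semiring_norm(85))
      then obtain j where j: "j \<in> K" "odd (l j)" by blast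
      have "sgn (d j) = 1 \<or> sgn (d j) = -1" using e_sign[OF j(1)] .
      then have "sgn (d j) ^ l k = 1" using dk(2) by auto
      moreover have "sgn (d k) ^ l j = -1" using dk(1) j(2) by simp
      ultimately show ?thesis by (intro mixing_both[OF kK j(1)]) simp
    qed
  qed
  \<comment> \<open>If some \<open>d k\<close> is negative, both signs share one mixing set and
    hence one limit; otherwise each sign is a mixing set of its own.\<close>
  have mix: "\<exists>T. mixing T \<and> \<sigma> \<in> T" if \<sigma>: "\<sigma> \<in> {1, -1}" for \<sigma>
  proof (cases "\<exists>k\<in>{1..n}. d k < 0")
    case True
    then show ?thesis using mix_neg \<sigma> by blast
  next
    case False
    then have "sgn (d k) = 1" if "k \<in> K" for k using that by (force simp: K_def sgn_real_def)
    then have "mixing {\<sigma>}" using \<sigma> by (intro mixing_single)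
    then show ?thesis by blast
  qed
  have s1: "(1::real) \<in> {1, -1}" and s2: "(-1::real) \<in> {1, -1}" by auto
  have asym: "((\<lambda>t. u \<sigma> t - s \<sigma> t) \<longlongrightarrow> 0) at_top" if "\<sigma> \<in> {1, -1}" for \<sigma>
    using mix[OF that] u_asymptotic by blast
  have basic: "continuous_on UNIV (s \<sigma>) \<and> (\<forall>t. s \<sigma> t \<ge> 0) \<and> (\<forall>t. s \<sigma> (t + 1) = s \<sigma> t)"
    if "\<sigma> \<in> {1, -1}" for \<sigma>
    using mix[OF that] s_continuous s_nonneg s_periodic[of \<sigma> _ 1] by auto
  define r where "r \<sigma> x = u \<sigma> (ln x / \<nu>) - s \<sigma> (ln x / \<nu>)" for \<sigma> x
  have "filterlim (\<lambda>x. ln x / \<nu>) at_top at_top"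
    using filterlim_tendsto_pos_mult_at_top[OF tendsto_const[of "1 / \<nu>"] _ ln_at_top] \<nu> by simp
  then have r0: "(r \<sigma> \<longlongrightarrow> 0) at_top" if "\<sigma> \<in> {1, -1}" for \<sigma>
    unfolding r_def[abs_def] by (rule filterlim_compose[OF asym[OF that]])
  have repr: "ereal_of_enat (ind (pencil \<rho> (complex_of_real (\<sigma> * x)))) =
    ereal (x powr (D / 2) * (s \<sigma> (ln x / \<nu>) + r \<sigma> x))" if x: "x > 0" for \<sigma> x
  proof -
    have "u \<sigma> (ln x / \<nu>) = x powr (- (D / 2)) * real (Nf (\<sigma> * x))"
      unfolding u_def using x \<nu> by (simp add: powr_def)
    then have "x powr (D / 2) * (s \<sigma> (ln x / \<nu>) + r \<sigma> x) = real (Nf (\<sigma> * x))"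
      unfolding r_def using x by (simp add: powr_minus field_simps)
    then show ?thesis unfolding ind_eq by simp
  qed
  have pos: "\<forall>t. s \<sigma> t > 0" if \<sigma>: "\<sigma> \<in> {1, -1}" and y: "y \<in> H"
    and gt: "\<sigma> * Re (pairing \<rho> (\<lambda>x. complex_of_real ((norm (y x))\<^sup>2))) > 0" for \<sigma> y
  proof -
    obtain l0 where "l0 > 0" "\<forall>x\<ge>l0. Nf (\<sigma> * x) \<ge> 1"
      using Nf_pos_eventually[OF y _ gt] \<sigma> by auto
    moreover obtain T where "mixing T" "\<sigma> \<in> T" using mix[OF \<sigma>] by blast
    ultimately show ?thesis using s_positive by blast
  qed
  show ?thesis
  proof (rule exI[of _ "s 1"], rule exI[of _ "s (-1)"], intro conjI)
    show "\<exists>r. (r \<longlongrightarrow> 0) at_top \<and>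
        (\<forall>\<^sub>F l in at_top. ereal_of_enat (ind (pencil \<rho> (complex_of_real l)))
           = ereal (\<bar>l\<bar> powr (D / 2) * (s 1 (ln \<bar>l\<bar> / \<nu>) + r l)))"
    proof (intro exI[of _ "r 1"] conjI r0[OF s1])
      show "\<forall>\<^sub>F l in at_top. ereal_of_enat (ind (pencil \<rho> (complex_of_real l)))
           = ereal (\<bar>l\<bar> powr (D / 2) * (s 1 (ln \<bar>l\<bar> / \<nu>) + r 1 l))"
        using eventually_gt_at_top[of 0]
      proof eventually_elim
        case (elim x)
        then show ?case using repr[of x 1] by simp
      qed
    qed
    show "\<exists>r. (r \<longlongrightarrow> 0) at_bot \<and>
        (\<forall>\<^sub>F l in at_bot. ereal_of_enat (ind (pencil \<rho> (complex_of_real l)))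
           = ereal (\<bar>l\<bar> powr (D / 2) * (s (-1) (ln \<bar>l\<bar> / \<nu>) + r l)))"
    \<comment> \<open>A negative parameter \<open>l\<close> is read as sign -1 at the positive
      number \<open>- l\<close>.\<close>
    proof (intro exI[of _ "\<lambda>l. r (-1) (- l)"] conjI)
      show "((\<lambda>l. r (-1) (- l)) \<longlongrightarrow> 0) at_bot"
        by (rule filterlim_compose[OF r0[OF s2] filterlim_uminus_at_top_at_bot])
      show "\<forall>\<^sub>F l in at_bot. ereal_of_enat (ind (pencil \<rho> (complex_of_real l)))
           = ereal (\<bar>l\<bar> powr (D / 2) * (s (-1) (ln \<bar>l\<bar> / \<nu>) + r (-1) (- l)))"
        using eventually_gt_at_bot[of 0]
      proof eventually_elim
        case (elim x)
        then show ?case using repr[of "- x" "-1"] by simp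
      qed
    qed
    show "(\<exists>k\<in>{1..n}. d k < 0) \<longrightarrow> (\<forall>t. s 1 t = s (-1) t)"
      using s_equal[OF mix_neg] by blast
    show "(\<exists>y\<in>H. pairing \<rho> (\<lambda>x. complex_of_real ((norm (y x))\<^sup>2)) > 0) \<longrightarrow> (\<forall>t. s 1 t > 0)"
      using pos[OF s1] by (auto simp: less_complex_def)
    show "(\<exists>y\<in>H. pairing \<rho> (\<lambda>x. complex_of_real ((norm (y x))\<^sup>2)) < 0) \<longrightarrow> (\<forall>t. s (-1) t > 0)"
      using pos[OF s2] by (auto simp: less_complex_def)
  qed (use basic[OF s1] basic[OF s2] in auto)
qed

end
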